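(* Let $\mathcal{C}_1,\dots,\mathcal{C}_n\in\mathbb{C}^{I_1\times\cdots\times I_N\times I_1\times\cdots\times I_N}$ be positive definite Hermitian tensors with Hermitian rank $r$, and let $\|\cdot\|_{\rho}$ be a unitarily invariant tensor norm with corresponding symmetric gauge function $\rho$. Put $\iota=\sqrt{-1}$ and $\beta_0(t)=\frac{\pi}{2(\cosh(\pi t)+1)}$. (1) For any continuous function $f:(0,\infty)\to[0,\infty)$ such that $x\mapsto \log f(e^x)$ is convex on $\mathbb{R}$, $$\left\| f\left(\exp\left(\sum_{i=1}^n\log\mathcal{C}_i\right)\right)\right\|_{\rho}\le \exp\int_{-\infty}^{\infty}\log\left\| f\left(\left|\prod_{i=1}^n\mathcal{C}_i^{1+\iota t}\right|\right)\right\|_{\rho}\beta_0(t)\,dt.$$ (2) For any continuous function $g:(0,\infty)\to[0,\infty)$ such that $x\mapsto g(e^x)$ is convex on $\mathbb{R}$, $$\left\| g\left(\exp\left(\sum_{i=1}^n\log\mathcal{C}_i\right)\right)\right\|_{\rho}\le \int_{-\infty}^{\infty}\left\| g\left(\left|\prod_{i=1}^n\mathcal{C}_i^{1+\iota t}\right|\right)\right\|_{\rho}\beta_0(t)\,dt.$$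
   Context: Tensors in $\mathbb{T}=\mathbb{C}^{I_1\times\cdots\times I_N\times I_1\times\cdots\times I_N}$ are multiplied by the Einstein product $(\mathcal{A}\star_N\mathcal{B})_{i_1\dots i_N,k_1\dots k_N}=\sum_{j_1,\dots,j_N}a_{i_1\dots i_N j_1\dots j_N}b_{j_1\dots j_N k_1\dots k_N}$; $\prod_{i=1}^n\mathcal{A}_i=\mathcal{A}_1\star_N\cdots\star_N\mathcal{A}_n$ (ordered product). The identity tensor $\mathcal{I}$ has entries $\prod_{k}\delta_{i_k j_k}$. The conjugate transpose $\mathcal{A}^H$ has entries $(\mathcal{A}^H)_{j_1\dots j_N,i_1\dots i_N}=\overline{a_{i_1\dots i_N j_1\dots j_N}}$; $\mathcal{A}$ is Hermitian if $\mathcal{A}^H=\mathcal{A}$, and $\mathcal{U}$ is unitary if $\mathcal{U}^H\star_N\mathcal{U}=\mathcal{U}\star_N\mathcal{U}^H=\mathcal{I}$. Every Hermitian tensor has a decomposition $\mathcal{H}=\sum_{i=1}^r\lambda_i\,\mathcal{U}_i\otimes\mathcal{U}_i^H$ with $\lambda_i\in\mathbb{R}$ and $\mathcal{U}_i\in\mathbb{C}^{I_1\times\cdots\times I_N}$ orthonormal (with respect to $\langle\mathcal{X},\mathcal{Y}\rangle=\mathrm{Tr}(\mathcal{X}^H\mathcal{Y})$); the $\lambda_i$ are the Hermitian eigenvalues and the minimal such $r$ is the Hermitian rank. Positive definite (positive) means all Hermitian eigenvalues are positive. Functions of Hermitian tensors are defined spectrally, $f(\mathcal{H})=\sum_i f(\lambda_i)\mathcal{U}_i\otimes\mathcal{U}_i^H$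 (this defines $\exp$, $\log$ and complex powers $\mathcal{C}^{z}=\exp(z\log\mathcal{C})$ of positive tensors); $|\mathcal{A}|=(\mathcal{A}^H\star_N\mathcal{A})^{1/2}$. A unitarily invariant norm satisfies $\|\mathcal{U}\star_N\mathcal{H}\|_\rho=\|\mathcal{H}\star_N\mathcal{U}\|_\rho=\|\mathcal{H}\|_\rho$ for all unitary $\mathcal{U}$, and is given by $\|\mathcal{H}\|_\rho=\rho(\vec\lambda(|\mathcal{H}|))$ where $\rho:\mathbb{R}^r_{\ge0}\to\mathbb{R}_{\ge0}$ is a symmetric gauge function and $\vec\lambda(\cdot)$ is the vector of Hermitian eigenvalues in decreasing order. *)

theory Defs
  imports "HOL-Analysis.Analysis"
begin

text \<open>Tensors in C^(I_1 x ... x I_N x I_1 x ... x I_N) are represented as functions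
  of two multi-indices (lists of length N with i_k < I_k), vanishing outside the index set.
  The list dims = [I_1, ..., I_N] records the mode sizes.\<close>

type_synonym tensor = "nat list \<Rightarrow> nat list \<Rightarrow> complex"
type_synonym otensor = "nat list \<Rightarrow> complex"

definition tidx :: "nat list \<Rightarrow> nat list set" where
  "tidx dims = {is. length is = length dims \<and> (\<forall>k<length dims. is ! k < dims ! k)}"

definition tdim :: "nat list \<Rightarrow> nat" where
  "tdim dims = prod_list dims"

definition is_tensor :: "nat list \<Rightarrow> tensor \<Rightarrow> bool" where
  "is_tensor dims A \<longleftrightarrow> (\<forall>i j. i \<notin> tidx dims \<or> j \<notin> tidx dims \<longrightarrow> A i j = 0)"

definition is_otensor :: "nat list \<Rightarrow> otensor \<Rightarrow> bool" where
  "is_otensor dims X \<longleftrightarrow> (\<forall>i. i \<notin> tidx dims \<longrightarrow> X i = 0)"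

definition einstein :: "nat list \<Rightarrow> tensor \<Rightarrow> tensor \<Rightarrow> tensor" where
  "einstein dims A B = (\<lambda>i k. if i \<in> tidx dims \<and> k \<in> tidx dims
       then (\<Sum>j\<in>tidx dims. A i j * B j k) else 0)"

definition tid :: "nat list \<Rightarrow> tensor" where
  "tid dims = (\<lambda>i j. if i \<in> tidx dims \<and> j \<in> tidx dims \<and> i = j then 1 else 0)"

definition tprod :: "nat list \<Rightarrow> nat \<Rightarrow> (nat \<Rightarrow> tensor) \<Rightarrow> tensor" where
  "tprod dims n C = foldr (\<lambda>i acc. einstein dims (C i) acc) [1..<Suc n] (tid dims)"

definition tsum :: "nat \<Rightarrow> (nat \<Rightarrow> tensor) \<Rightarrow> tensor" where
  "tsum n A = (\<lambda>i j. \<Sum>k\<in>{1..n}. A k i j)"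

definition tct :: "tensor \<Rightarrow> tensor" where
  "tct A = (\<lambda>j i. cnj (A i j))"

definition hermitian :: "nat list \<Rightarrow> tensor \<Rightarrow> bool" where
  "hermitian dims A \<longleftrightarrow> is_tensor dims A \<and> tct A = A"

definition tinner :: "nat list \<Rightarrow> otensor \<Rightarrow> otensor \<Rightarrow> complex" where
  "tinner dims X Y = (\<Sum>i\<in>tidx dims. cnj (X i) * Y i)"

definition touter :: "otensor \<Rightarrow> otensor \<Rightarrow> tensor" where
  "touter U V = (\<lambda>i j. U i * cnj (V j))"

definition herm_dec :: "nat list \<Rightarrow> nat \<Rightarrow> tensor \<Rightarrow> (nat \<Rightarrow> real) \<Rightarrow> (nat \<Rightarrow> otensor) \<Rightarrow> bool" where
  "herm_dec dims r H lam U \<longleftrightarrow>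
     (\<forall>k<r. is_otensor dims (U k)) \<and>
     (\<forall>k<r. \<forall>l<r. tinner dims (U k) (U l) = (if k = l then 1 else 0)) \<and>
     H = (\<lambda>i j. \<Sum>k<r. complex_of_real (lam k) * touter (U k) (U k) i j)"

definition hrank :: "nat list \<Rightarrow> tensor \<Rightarrow> nat" where
  "hrank dims H = (LEAST r. \<exists>lam U. herm_dec dims r H lam U)"

text \<open>Full spectral decomposition (orthonormal basis of eigentensors) chosen once and for all;
  the Hermitian eigenvalues (with multiplicity) are its coefficients.\<close>
definition heig :: "nat list \<Rightarrow> tensor \<Rightarrow> (nat \<Rightarrow> real) \<times> (nat \<Rightarrow> otensor)" where
  "heig dims H = (SOME p. herm_dec dims (tdim dims) H (fst p) (snd p))"

definition pos_def :: "nat list \<Rightarrow> tensor \<Rightarrow> bool" where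
  "pos_def dims H \<longleftrightarrow> hermitian dims H \<and>
     (\<exists>lam U. herm_dec dims (tdim dims) H lam U \<and> (\<forall>k<tdim dims. lam k > 0))"

definition tfun :: "nat list \<Rightarrow> (real \<Rightarrow> real) \<Rightarrow> tensor \<Rightarrow> tensor" where
  "tfun dims f H = (\<lambda>i j. \<Sum>k<tdim dims.
      complex_of_real (f (fst (heig dims H) k)) * touter (snd (heig dims H) k) (snd (heig dims H) k) i j)"

definition texp :: "nat list \<Rightarrow> tensor \<Rightarrow> tensor" where
  "texp dims H = tfun dims exp H"

definition tlog :: "nat list \<Rightarrow> tensor \<Rightarrow> tensor" where
  "tlog dims H = tfun dims ln H"

definition tpow :: "nat list \<Rightarrow> tensor \<Rightarrow> complex \<Rightarrow> tensor" where
  "tpow dims C z = (\<lambda>i j. \<Sum>k<tdim dims.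
      exp (z * complex_of_real (ln (fst (heig dims C) k))) *
      touter (snd (heig dims C) k) (snd (heig dims C) k) i j)"

definition tabs :: "nat list \<Rightarrow> tensor \<Rightarrow> tensor" where
  "tabs dims A = tfun dims sqrt (einstein dims (tct A) A)"

definition heigvals :: "nat list \<Rightarrow> tensor \<Rightarrow> real list" where
  "heigvals dims H = rev (sort (map (fst (heig dims H)) [0..<tdim dims]))"

definition sym_gauge :: "nat \<Rightarrow> (real list \<Rightarrow> real) \<Rightarrow> bool" where
  "sym_gauge r \<rho> \<longleftrightarrow>
     (\<forall>x. length x = r \<longrightarrow> \<rho> x \<ge> 0 \<and> (\<rho> x = 0 \<longleftrightarrow> (\<forall>i<r. x ! i = 0))) \<and>
     (\<forall>a x. length x = r \<longrightarrow> \<rho> (map (\<lambda>y. a * y) x) = \<bar>a\<bar> * \<rho> x) \<and>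
     (\<forall>x y. length x = r \<longrightarrow> length y = r \<longrightarrow> \<rho> (map2 (+) x y) \<le> \<rho> x + \<rho> y) \<and>
     (\<forall>x p. length x = r \<longrightarrow> p permutes {..<r} \<longrightarrow> \<rho> (map (\<lambda>i. x ! p i) [0..<r]) = \<rho> x) \<and>
     (\<forall>x. length x = r \<longrightarrow> \<rho> (map abs x) = \<rho> x)"

definition unorm :: "nat list \<Rightarrow> (real list \<Rightarrow> real) \<Rightarrow> tensor \<Rightarrow> real" where
  "unorm dims \<rho> H = \<rho> (heigvals dims (tabs dims H))"

definition beta0 :: "real \<Rightarrow> real" where
  "beta0 t = pi / (2 * (cosh (pi * t) + 1))"

end

theory Submission
  imports Defs "HOL-Complex_Analysis.Complex_Analysis" "HOL-Probability.Sinc_Integral"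
    "HOL-Real_Asymp.Real_Asymp" "Jordan_Normal_Form.Spectral_Radius"
begin

text \<open>Let \<open>H\<close> be the sum of the \<open>log C_i\<close> and \<open>A(z)\<close> the product of the \<open>C_i^z\<close>, an entire function
  with \<open>A(0) = I\<close> and \<open>A'(0) = H\<close>. For orthonormal eigenvectors \<open>V_1, ..., V_k\<close> of \<open>H\<close> the minor
  \<open>F(z) = det <V_a, A(z) V_b>\<close> satisfies \<open>F(0) = 1\<close>, \<open>F'(0)\<close> is the sum of the \<open>k\<close> eigenvalues,
  \<open>|F(it)| \<le> 1\<close> because \<open>A(it)\<close> is unitary, and \<open>|F(1 + it)|\<close> is at most the product of the \<open>k\<close>
  largest singular values of \<open>A(1 + it)\<close>. A boundary derivative form of the Stein-Hirschman
  interpolation theorem bounds \<open>Re F'(0)\<close> by the \<open>beta0\<close>-average of \<open>log |F(1 + it)|\<close>; the density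
  \<open>beta0\<close> is the normal derivative at 0 of the harmonic measure of the strip. Hence the eigenvalues
  of \<open>H\<close> are majorized by the averaged logarithms of the singular values, with equality of the full
  sums because the determinant is multiplicative. The functions \<open>x \<mapsto> \<rho>(g(exp x))\<close> and
  \<open>x \<mapsto> log \<rho>(f(exp x))\<close> are convex and symmetric, and a subgradient at the eigenvalue vector
  combines Jensen's inequality with the majorization.\<close>

section \<open>Boundary derivatives of bounded functions on a strip\<close>

text \<open>Differentiating at the boundary point 0 replaces the usual route through interpolation
  at 1/m followed by the Lie product formula: the first-order term of the noncommuting product is
  already the sum of the logarithms, so no limit of products is taken. Minors play the part of
  antisymmetric tensor powers, in which a product of k singular values becomes a single operator
  norm. The integrals need three supports. The powers of the \<open>C_i\<close> with exponent 1 + it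
  distort lengths within bounds that do not depend on t, so the logarithms of the singular values
  are bounded uniformly in t. Eigenvalues in decreasing order depend continuously on the tensor,
  which gives measurability although eigenvectors may jump. And since \<open>heig\<close> is an
  arbitrary choice of eigenbasis, each function of a tensor must first be shown independent of it.
  Finally, positive definiteness makes the Hermitian rank equal to the full dimension, so the gauge
  sees all eigenvalues.\<close>

text \<open>The boundary enters only through interior sequences because \<open>g\<close> need not
  extend to the closed strip. If the bound failed at \<open>z1\<close>, the superlevel set
  \<open>T\<close> could neither approach an edge nor leave a bounded part of the strip; it would be
  compact, so |g| would have an interior maximum and \<open>g\<close> would be constant, against
  \<open>decay\<close>.\<close>

lemma strip_max_principle:
  fixes g :: "complex \<Rightarrow> complex"
  assumes hol: "g holomorphic_on {z. 0 < Re z \<and> Re z < 1}"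
    and bdry: "\<And>z0 X e. Re z0 = 0 \<or> Re z0 = 1 \<Longrightarrow> (\<And>n::nat. 0 < Re (X n) \<and> Re (X n) < 1) \<Longrightarrow>
       X \<longlonglongrightarrow> z0 \<Longrightarrow> e > 0 \<Longrightarrow> eventually (\<lambda>n. norm (g (X n)) \<le> 1 + e) sequentially"
    and decay: "\<And>z. 0 < Re z \<Longrightarrow> Re z < 1 \<Longrightarrow> \<bar>Im z\<bar> > R \<Longrightarrow> norm (g z) \<le> 1"
    and z1: "0 < Re z1" "Re z1 < 1"
  shows "norm (g z1) \<le> 1"
proof (rule ccontr)
  assume "\<not> ?thesis"
  then have gt: "norm (g z1) > 1" by simp
  define S where "S = {z. 0 < Re z \<and> Re z < 1}"
  have openS: "open S" unfolding S_def
    by (intro open_Collect_conj open_Collect_less continuous_intros)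
  have convS: "convex S"
  proof -
    have "S = {z. Re z > 0} \<inter> {z. Re z < 1}" by (auto simp: S_def)
    then show ?thesis
      by (simp add: convex_Int convex_halfspace_Re_gt convex_halfspace_Re_lt)
  qed
  have contS: "continuous_on S g" using hol holomorphic_on_imp_continuous_on S_def by blast
  define T where "T = {z\<in>S. norm (g z) \<ge> norm (g z1)}"
  have z1T: "z1 \<in> T" using z1 by (auto simp: T_def S_def)
  have "T \<subseteq> {z. \<bar>Re z\<bar> \<le> 1 \<and> \<bar>Im z\<bar> \<le> R}"
    using decay gt by (force simp: T_def S_def)
  then have "bounded T"
    unfolding bounded_iff
    by (intro exI[of _ "1 + R"]) (smt (verit) cmod_le mem_Collect_eq subsetD)
  moreover have "closed T"
    unfolding closed_sequential_limits
  proof (intro allI impI, elim conjE)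
    fix X l assume XT: "\<forall>n. X n \<in> T" and lim: "X \<longlonglongrightarrow> l"
    have XS: "\<And>n. 0 < Re (X n) \<and> Re (X n) < 1" using XT by (auto simp: T_def S_def)
    have reslim: "(\<lambda>n. Re (X n)) \<longlonglongrightarrow> Re l" by (intro tendsto_intros lim)
    have l0: "Re l \<ge> 0" by (rule LIMSEQ_le_const[OF reslim]) (use XS less_imp_le in blast)
    have l1: "Re l \<le> 1" by (rule LIMSEQ_le_const2[OF reslim]) (use XS less_imp_le in blast)
    have "\<not> (Re l = 0 \<or> Re l = 1)"
    proof
      assume "Re l = 0 \<or> Re l = 1"
      from bdry[OF this XS lim, of "(norm (g z1) - 1)/2"] gt
      have "eventually (\<lambda>n. norm (g (X n)) \<le> 1 + (norm (g z1) - 1)/2) sequentially" by auto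
      then obtain n where "norm (g (X n)) \<le> 1 + (norm (g z1) - 1)/2"
        by (meson eventually_sequentially order_refl)
      moreover have "norm (g (X n)) \<ge> norm (g z1)" using XT by (auto simp: T_def)
      ultimately show False using gt by (auto simp: field_simps)
    qed
    then have lS: "l \<in> S" using l0 l1 by (auto simp: S_def)
    have "(\<lambda>n. g (X n)) \<longlonglongrightarrow> g l"
      using contS openS lS lim continuous_on_eq_continuous_at isCont_tendsto_compose by blast
    then have "(\<lambda>n. norm (g (X n))) \<longlonglongrightarrow> norm (g l)" by (intro tendsto_norm)
    then have "norm (g l) \<ge> norm (g z1)"
      by (rule LIMSEQ_le_const) (use XT in \<open>auto simp: T_def\<close>)
    then show "l \<in> T" using lS by (auto simp: T_def)
  qed
  ultimately have "compact T" by (simp add: compact_eq_bounded_closed)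
  moreover have "continuous_on T (\<lambda>z. norm (g z))"
    by (intro continuous_on_norm continuous_on_subset[OF contS]) (auto simp: T_def)
  ultimately obtain zm where zm: "zm \<in> T" "\<And>z. z \<in> T \<Longrightarrow> norm (g z) \<le> norm (g zm)"
    using continuous_attains_sup[of T "\<lambda>z. norm (g z)"] z1T by auto
  have "g constant_on S"
  proof (rule maximum_modulus_principle[of g S S zm])
    show "cmod (g z) \<le> cmod (g zm)" if "z \<in> S" for z
      using zm that by (cases "z \<in> T") (auto simp: T_def)
  qed (use hol openS convS zm convex_connected in \<open>auto simp: S_def T_def\<close>)
  then obtain c where c: "\<And>z. z \<in> S \<Longrightarrow> g z = c" unfolding constant_on_def by auto
  have "Complex (1/2) (\<bar>R\<bar> + 1) \<in> S" by (auto simp: S_def)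
  with c have "norm c \<le> 1" using decay[of "Complex (1/2) (\<bar>R\<bar> + 1)"] by auto
  with c[of z1] gt z1 show False by (auto simp: S_def)
qed

text \<open>The factor exp (d (z^2 - 1)) has modulus at most exp (- d (Im z)^2) in the strip: it
  does not spoil the edge bounds and forces decay at both ends. Letting d tend to 0 removes
  it.\<close>

lemma strip_phragmen_lindelof:
  fixes g :: "complex \<Rightarrow> complex"
  assumes hol: "g holomorphic_on {z. 0 < Re z \<and> Re z < 1}"
    and bdry: "\<And>z0 X e. Re z0 = 0 \<or> Re z0 = 1 \<Longrightarrow> (\<And>n::nat. 0 < Re (X n) \<and> Re (X n) < 1) \<Longrightarrow>
       X \<longlonglongrightarrow> z0 \<Longrightarrow> e > 0 \<Longrightarrow> eventually (\<lambda>n. norm (g (X n)) \<le> 1 + e) sequentially"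
    and bd: "\<And>z. 0 < Re z \<Longrightarrow> Re z < 1 \<Longrightarrow> norm (g z) \<le> K"
    and z1: "0 < Re z1" "Re z1 < 1"
  shows "norm (g z1) \<le> 1"
proof -
  have norm_exp: "norm (exp (of_real d * (z^2 - 1))) = exp (d * ((Re z)^2 - (Im z)^2 - 1))" for d z
    by (simp add: norm_exp_eq_Re power2_eq_square)
  have le: "norm (g z1 * exp (of_real d * (z1^2 - 1))) \<le> 1" if d: "d > 0" for d
  \<comment> \<open>Above this height |K| <= d (Im z)^2 <= exp (d (Im z)^2), which the factor
    compensates.\<close>
  proof (rule strip_max_principle[where R = "sqrt (\<bar>K\<bar> / d)" and g = "\<lambda>z. g z * exp (of_real d * (z^2 - 1))"])
    show "(\<lambda>z. g z * exp (of_real d * (z^2 - 1))) holomorphic_on {z. 0 < Re z \<and> Re z < 1}"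
      by (intro holomorphic_intros hol)
    have le1: "norm (exp (of_real d * (z^2 - 1))) \<le> exp (- d * (Im z)^2)" if "0 < Re z" "Re z < 1" for z
    proof -
      have "(Re z)^2 \<le> 1" using that by (simp add: power_le_one)
      then have "d * (Re z)^2 \<le> d * 1" using d by (intro mult_left_mono) auto
      then show ?thesis unfolding norm_exp by (simp add: algebra_simps)
    qed
    show "eventually (\<lambda>n. norm (g (X n) * exp (of_real d * ((X n)^2 - 1))) \<le> 1 + e) sequentially"
      if "Re z0 = 0 \<or> Re z0 = 1" and X: "\<And>n::nat. 0 < Re (X n) \<and> Re (X n) < 1" and "X \<longlonglongrightarrow> z0" "e > 0" for z0 X e
      using bdry[OF that]
    proof (rule eventually_mono)
      fix n assume a: "norm (g (X n)) \<le> 1 + e"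
      have "norm (exp (of_real d * ((X n)^2 - 1))) \<le> 1"
        using le1[of "X n"] X[of n] d by (smt (verit) exp_le_one_iff mult_nonneg_nonneg mult_minus_left zero_le_power2)
      then have "norm (g (X n)) * norm (exp (of_real d * ((X n)^2 - 1))) \<le> (1 + e) * 1"
        by (intro mult_mono a) (use \<open>e > 0\<close> in auto)
      then show "norm (g (X n) * exp (of_real d * ((X n)^2 - 1))) \<le> 1 + e" by (simp add: norm_mult)
    qed
    show "norm (g z * exp (of_real d * (z^2 - 1))) \<le> 1"
      if z: "0 < Re z" "Re z < 1" and im: "sqrt (\<bar>K\<bar> / d) < \<bar>Im z\<bar>" for z
    proof -
      have "\<bar>K\<bar> / d < (Im z)^2"
        using im by (metis real_sqrt_abs real_sqrt_less_iff)
      then have "\<bar>K\<bar> \<le> d * (Im z)^2" using d by (simp add: field_simps)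
      also have "\<dots> \<le> exp (d * (Im z)^2)" using exp_ge_add_one_self[of "d * (Im z)^2"] by linarith
      finally have K: "K \<le> exp (d * (Im z)^2)" by linarith
      have "norm (g z) * norm (exp (of_real d * (z^2 - 1))) \<le> exp (d * (Im z)^2) * exp (- d * (Im z)^2)"
        by (intro mult_mono le1 z order_trans[OF bd[OF z] K]) auto
      then show ?thesis by (simp add: norm_mult flip: exp_add)
    qed
  qed (use z1 in auto)
  have "((\<lambda>d. norm (g z1 * exp (of_real d * (z1^2 - 1)))) \<longlongrightarrow> norm (g z1 * exp (of_real 0 * (z1^2 - 1)))) (at_right 0)"
    by (intro tendsto_intros)
  moreover have "eventually (\<lambda>d. norm (g z1 * exp (of_real d * (z1^2 - 1))) \<le> 1) (at_right (0::real))"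
    using le eventually_at_right_less[of "0::real"] by (auto elim: eventually_mono)
  ultimately have "norm (g z1 * exp (of_real 0 * (z1^2 - 1))) \<le> 1"
    by (rule tendsto_upperbound) simp
  then show ?thesis by simp
qed

section \<open>The density \<open>beta0\<close>\<close>

text \<open>With s = exp (- pi t) this is pi s / (1 + s)^2: the derivative in t of the logistic
  function 1 / (1 + s), and the density 1 / (1 + s)^2 ds carried over to t.\<close>

lemma beta0_eq: "beta0 t = pi * exp (- pi * t) / (1 + exp (- pi * t))^2"
proof -
  define x where "x = exp (- pi * t)"
  have x: "x > 0" by (simp add: x_def)
  have x': "exp (- (pi * t)) = x" by (simp add: x_def)
  have "exp (pi * t) = 1 / x" unfolding x_def by (simp add: exp_minus field_simps)
  then have "cosh (pi * t) + 1 = (1 + x)^2 / (2 * x)"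
    using x by (simp add: cosh_field_def x' field_simps power2_eq_square)
  then show ?thesis using x by (simp add: beta0_def x')
qed

lemma beta0_pos: "beta0 t > 0"
  unfolding beta0_eq by (intro divide_pos_pos mult_pos_pos zero_less_power add_pos_pos) auto

lemma beta0_integral: "integrable lborel beta0" "(LINT t|lborel. beta0 t) = 1"
proof -
  let ?F = "\<lambda>t::real. 1 / (1 + exp (- pi * t))"
  have d: "(?F has_real_derivative beta0 x) (at x)" for x
  proof -
    have "1 + exp (- pi * x) \<noteq> 0" by (smt (verit) exp_gt_zero)
    then show ?thesis unfolding beta0_eq
      by (auto intro!: derivative_eq_intros simp: field_simps power2_eq_square)
  qed
  have c: "isCont beta0 x" for x
  proof -
    have "1 + exp (- pi * x) \<noteq> 0" by (smt (verit) exp_gt_zero)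
    then show ?thesis unfolding beta0_eq[abs_def] by (intro continuous_intros) auto
  qed
  have "(?F \<longlongrightarrow> 0) at_bot" "(?F \<longlongrightarrow> 1) at_top" by real_asymp+
  then have lim: "((?F \<circ> real_of_ereal) \<longlongrightarrow> 0) (at_right (-\<infinity>))" "((?F \<circ> real_of_ereal) \<longlongrightarrow> 1) (at_left \<infinity>)"
    by (simp_all add: ereal_tendsto_simps)
  have nn: "AE x in lborel. -\<infinity> < ereal x \<longrightarrow> ereal x < \<infinity> \<longrightarrow> 0 \<le> beta0 x"
    using beta0_pos by (auto intro: less_imp_le)
  have i: "set_integrable lborel (einterval (-\<infinity>) \<infinity>) beta0"
    by (rule interval_integral_FTC_nonneg(1)[OF _ d c nn lim]) auto
  have e: "interval_lebesgue_integral lborel (-\<infinity>) \<infinity> beta0 = 1 - 0"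
    by (rule interval_integral_FTC_nonneg(2)[OF _ d c nn lim]) auto
  show "integrable lborel beta0" using i by (simp add: set_integrable_def einterval_def)
  show "(LINT t|lborel. beta0 t) = 1"
    using e by (simp add: interval_lebesgue_integral_def einterval_def set_lebesgue_integral_def)
qed

section \<open>The Herglotz integral of bounded boundary data\<close>

text \<open>Division by 1 + s carries w + s to a point of the segment from w to 1. This segment
  misses 0 because w is off the slit, and its distance from 0 serves as c.\<close>

lemma slit_plane_lower_bound:
  fixes w :: complex
  assumes "w \<notin> \<real>\<^sub>\<le>\<^sub>0"
  shows "\<exists>c>0. \<forall>s\<ge>0. c * (1 + s) \<le> norm (w + of_real s)"
proof -
  have n0: "0 \<notin> closed_segment w 1"
  proof
    assume "0 \<in> closed_segment w 1"
    then obtain u where u: "0 \<le> u" "u \<le> 1" "0 = (1 - u) *\<^sub>R w + u *\<^sub>R 1"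
      by (auto simp: in_segment)
    have "u \<noteq> 1" using u by auto
    have "w * (1 - of_real u) = - of_real u"
      using u(3) by (simp add: scaleR_conv_of_real algebra_simps eq_neg_iff_add_eq_0)
    moreover have "1 - complex_of_real u \<noteq> 0" using \<open>u \<noteq> 1\<close> by (metis eq_iff_diff_eq_0 of_real_1 of_real_eq_iff)
    ultimately have "w = - of_real u / (1 - of_real u)"
      by (metis nonzero_eq_divide_eq)
    then have "w = of_real (- u / (1 - u))" by simp
    moreover have "- u / (1 - u) \<le> 0" using u \<open>u \<noteq> 1\<close> by (simp add: divide_nonpos_pos)
    ultimately show False using assms by (metis nonpos_Reals_of_real_iff)
  qed
  define c where "c = setdist {0} (closed_segment w 1)"
  have "c > 0" unfolding c_def
    using n0 by (simp add: setdist_gt_0_compact_closed compact_imp_closed)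
  moreover have "c * (1 + s) \<le> norm (w + of_real s)" if "s \<ge> 0" for s
  proof -
    have "(w + of_real s) / of_real (1 + s) \<in> closed_segment w 1"
    proof -
      have eq: "(w + of_real s) / of_real (1 + s) = (1 - s / (1 + s)) *\<^sub>R w + (s / (1 + s)) *\<^sub>R 1"
      proof -
        have "1 - s / (1 + s) = 1 / (1 + s)" using that by (simp add: field_simps)
        then show ?thesis by (simp add: scaleR_conv_of_real add_divide_distrib)
      qed
      show ?thesis unfolding eq in_segment
        using that by (intro exI[of _ "s / (1 + s)"]) auto
    qed
    then have "c \<le> norm ((w + of_real s) / of_real (1 + s))"
      unfolding c_def using setdist_le_dist[of 0 "{0}" _ "closed_segment w 1"] by force
    then show ?thesis using that by (simp add: norm_divide field_simps del: of_real_add)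
  qed
  ultimately show ?thesis by blast
qed

lemma integrable_inverse_square: "integrable lborel (\<lambda>x::real. inverse (1 + x^2))"
  using integrable_inverse_1_plus_square by (simp add: set_integrable_def einterval_def)

lemma integral_inverse_square: "(LINT x|lborel. inverse (1 + x^2)) = pi"
  using LBINT_inverse_1_plus_square
  by (simp add: interval_lebesgue_integral_def einterval_def set_lebesgue_integral_def)

text \<open>For bounded data on s > 0 this is the analytic function on the upper half-plane whose
  real part is the Poisson integral of x -> v (- x) on the real axis. The subtracted term makes the
  kernel integrable; it contributes only to the imaginary part and gives the value 0 at w = 1, the
  image of the boundary point 0 of the strip.\<close>

definition herglotz :: "(real \<Rightarrow> real) \<Rightarrow> complex \<Rightarrow> complex" where
  "herglotz v w = (\<i> / pi) * (LINT s|lborel. of_real (v s) * (1 / (w + of_real s) - 1 / (1 + of_real s)))"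

text \<open>\<open>zero\<close> confines the poles w = - s to the negative axis, so the integral is
  holomorphic on the whole slit plane and in particular near w = 1.\<close>

locale bounded_boundary =
  fixes v :: "real \<Rightarrow> real" and M :: real
  assumes meas[measurable]: "v \<in> borel_measurable borel"
    and bnd: "\<And>s. \<bar>v s\<bar> \<le> M"
    and zero: "\<And>s. s \<le> 0 \<Longrightarrow> v s = 0"
begin

lemma M_nonneg: "M \<ge> 0"
  using bnd[of 0] by linarith

lemma dominated:
  assumes "C \<ge> 0" "\<And>s. s \<ge> 0 \<Longrightarrow> norm (k s) \<le> C / (1 + s)^2"
  shows "norm (of_real (v s) * (k s :: complex)) \<le> M * C * inverse (1 + s^2)"
proof (cases "s \<le> 0")
  case True
  then show ?thesis using zero[OF True] M_nonneg assms by simp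
next
  case False
  have "norm (of_real (v s) * k s) \<le> M * (C / (1 + s)^2)"
    unfolding norm_mult using bnd[of s] assms False by (intro mult_mono) (auto intro: M_nonneg)
  also have "\<dots> \<le> M * (C / (1 + s^2))"
    using False assms M_nonneg
    by (intro mult_left_mono divide_left_mono) (auto simp: power2_eq_square algebra_simps add_pos_pos)
  finally show ?thesis by (simp add: divide_inverse mult_ac)
qed

lemma integrable_dominated:
  assumes "C \<ge> 0" "\<And>s. s \<ge> 0 \<Longrightarrow> norm (k s) \<le> C / (1 + s)^2"
    and [measurable]: "k \<in> borel_measurable borel"
  shows "integrable lborel (\<lambda>s. of_real (v s) * (k s :: complex))"
proof (rule Bochner_Integration.integrable_bound)
  show "integrable lborel (\<lambda>s. M * C * inverse (1 + s^2))"
    by (intro integrable_mult_right integrable_inverse_square)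
  show "AE s in lborel. norm (of_real (v s) * k s) \<le> norm (M * C * inverse (1 + s^2))"
  proof (rule AE_I2)
    fix s
    have "norm (of_real (v s) * k s) \<le> M * C * inverse (1 + s^2)" by (rule dominated) (use assms in auto)
    also have "\<dots> \<le> norm (M * C * inverse (1 + s^2))" by simp
    finally show "norm (of_real (v s) * k s) \<le> norm (M * C * inverse (1 + s^2))" .
  qed
qed auto

lemma kernel_diff:
  fixes w :: complex
  assumes c: "c > 0" "\<And>s::real. s \<ge> 0 \<Longrightarrow> c * (1 + s) \<le> norm (w + of_real s)" and s: "s \<ge> 0"
  shows "1 / (w + of_real s) - 1 / (1 + of_real s) = (1 - w) / ((w + of_real s) * (1 + of_real s))"
    "norm (1 / (w + of_real s) - 1 / (1 + of_real s)) \<le> (norm (1 - w) / c) / (1 + s)^2"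
proof -
  have n: "norm (1 + complex_of_real s) = 1 + s" using s
    by (metis abs_of_nonneg add_nonneg_nonneg norm_of_real of_real_1 of_real_add zero_le_one)
  have pos: "0 < c * (1 + s)" using c s by simp
  have "w + of_real s \<noteq> 0"
    using c(2)[OF s] pos by (metis norm_zero not_le)
  moreover have "1 + complex_of_real s \<noteq> 0"
    using n s by (metis norm_zero add_nonneg_eq_0_iff zero_le_one zero_neq_one)
  ultimately have nz: "w + of_real s \<noteq> 0" "1 + complex_of_real s \<noteq> 0" by auto
  then show eq: "1 / (w + of_real s) - 1 / (1 + of_real s) = (1 - w) / ((w + of_real s) * (1 + of_real s))"
    by (simp add: diff_frac_eq)
  have "norm (1 / (w + of_real s) - 1 / (1 + of_real s)) = norm (1 - w) / (norm (w + of_real s) * (1 + s))"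
    unfolding eq norm_divide norm_mult n ..
  also have "\<dots> \<le> norm (1 - w) / ((c * (1 + s)) * (1 + s))"
    using c s pos nz by (intro divide_left_mono mult_right_mono mult_pos_pos) (auto intro: less_le_trans)
  finally show "norm (1 / (w + of_real s) - 1 / (1 + of_real s)) \<le> (norm (1 - w) / c) / (1 + s)^2"
    by (simp add: power2_eq_square mult_ac)
qed

lemma integrable_kernel:
  assumes "w \<notin> \<real>\<^sub>\<le>\<^sub>0"
  shows "integrable lborel (\<lambda>s. of_real (v s) * (1 / (w + of_real s) - 1 / (1 + complex_of_real s)))"
proof -
  obtain c where c: "c > 0" "\<And>s::real. s \<ge> 0 \<Longrightarrow> c * (1 + s) \<le> norm (w + of_real s)"
    using slit_plane_lower_bound[OF assms] by auto
  show ?thesis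
    by (rule integrable_dominated[where C = "norm (1 - w) / c"])
       (use c kernel_diff(2)[OF c] in auto)
qed

text \<open>Differentiation under the integral sign, by dominated convergence along sequences
  tending to w.\<close>

lemma herglotz_derivative:
  assumes w: "w \<notin> \<real>\<^sub>\<le>\<^sub>0"
  shows "(herglotz v has_field_derivative
     (\<i> / pi) * (LINT s|lborel. of_real (v s) * (- 1 / (w + of_real s)^2))) (at w)"
proof -
  obtain c where c: "c > 0" "\<And>s::real. s \<ge> 0 \<Longrightarrow> c * (1 + s) \<le> norm (w + of_real s)"
    using slit_plane_lower_bound[OF w] by auto
  \<comment> \<open>Moving w by at most c / 2 <= (c / 2) (1 + s) costs at most half of the lower
    bound, uniformly in s.\<close>
  have near: "(c/2) * (1 + s) \<le> norm (w' + of_real s)" if "dist w' w \<le> c / 2" "s \<ge> 0" for w' and s :: real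
  proof -
    have "norm (w + of_real s) \<le> norm (w' + of_real s) + norm (w - w')"
      by (metis add_diff_cancel_right norm_triangle_sub)
    moreover have "norm (w - w') \<le> (c / 2) * 1"
      using that by (simp add: dist_norm norm_minus_commute)
    moreover have "(c / 2) * 1 \<le> (c / 2) * (1 + s)"
      using that c(1) by (intro mult_left_mono) auto
    ultimately show ?thesis using c(2)[of s] that by (simp add: algebra_simps)
  qed
  have ev: "eventually (\<lambda>n. dist (X n) w \<le> c/2) sequentially" if "X \<longlonglongrightarrow> w" for X :: "nat \<Rightarrow> complex"
    using tendstoD[OF that, of "c/2"] c(1) by (auto elim!: eventually_mono)
  have "((\<lambda>w'. (herglotz v w' - herglotz v w) / (w' - w)) \<longlongrightarrow>
     (\<i> / pi) * (LINT s|lborel. of_real (v s) * (- 1 / (w + of_real s)^2))) (at w)"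
    unfolding tendsto_at_iff_sequentially comp_def
  proof (intro allI impI)
    fix X :: "nat \<Rightarrow> complex" assume X: "\<forall>i. X i \<in> UNIV - {w}" "X \<longlonglongrightarrow> w"
    from ev[OF X(2)] obtain N where N: "\<And>n. n \<ge> N \<Longrightarrow> dist (X n) w \<le> c/2"
      by (auto simp: eventually_sequentially)
    \<comment> \<open>Discarding finitely many terms puts the whole sequence into the ball where
      \<open>near\<close> applies.\<close>
    define Y where "Y n = X (n + N)" for n
    have Y: "Y n \<noteq> w" "dist (Y n) w \<le> c/2" for n using X N by (auto simp: Y_def)
    have limY: "Y \<longlonglongrightarrow> w" unfolding Y_def using X(2) by (rule LIMSEQ_ignore_initial_segment)
    have nonpos: "Y n \<notin> \<real>\<^sub>\<le>\<^sub>0" for n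
    proof
      assume "Y n \<in> \<real>\<^sub>\<le>\<^sub>0"
      then obtain s where "s \<le> 0" "Y n = of_real s" by (metis nonpos_Reals_cases)
      then have "(c/2) * (1 + - s) \<le> 0" using near[OF Y(2)[of n], of "-s"] by simp
      moreover have "(c/2) * (1 + - s) > 0" using c(1) \<open>s \<le> 0\<close> by (intro mult_pos_pos) auto
      ultimately show False by simp
    qed
    have quot: "(herglotz v (Y n) - herglotz v w) / (Y n - w) =
       (\<i> / pi) * (LINT s|lborel. of_real (v s) * (- 1 / ((Y n + of_real s) * (w + of_real s))))" for n
    proof -
      have "(LINT s|lborel. of_real (v s) * (1 / (Y n + of_real s) - 1 / (1 + of_real s))) -
          (LINT s|lborel. of_real (v s) * (1 / (w + of_real s) - 1 / (1 + complex_of_real s)))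
         = (LINT s|lborel. of_real (v s) * (1 / (Y n + of_real s) - 1 / (1 + of_real s)) -
             of_real (v s) * (1 / (w + of_real s) - 1 / (1 + complex_of_real s)))"
        by (intro Bochner_Integration.integral_diff[symmetric] integrable_kernel nonpos w)
      also have "\<dots> = (LINT s|lborel. (of_real (v s) * (- 1 / ((Y n + of_real s) * (w + of_real s)))) * (Y n - w))"
      proof (rule Bochner_Integration.integral_cong[OF refl])
        fix s :: real
        show "of_real (v s) * (1 / (Y n + of_real s) - 1 / (1 + of_real s)) -
             of_real (v s) * (1 / (w + of_real s) - 1 / (1 + complex_of_real s)) =
            (of_real (v s) * (- 1 / ((Y n + of_real s) * (w + of_real s)))) * (Y n - w)"
        proof (cases "s \<le> 0")
          case False
          then have "0 < (c/2) * (1 + s)" "0 < c * (1 + s)" using c(1) by auto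
          then have nz: "Y n + of_real s \<noteq> 0" "w + of_real s \<noteq> 0"
            using near[OF Y(2)[of n], of s] c(2)[of s] False by (metis norm_zero not_le linorder_linear)+
          have eq: "(w - y) / x = (- 1 / x) * (y - w)" for x y
            by (simp add: divide_inverse algebra_simps)
          have "1 / (Y n + of_real s) - 1 / (w + of_real s) = (w - Y n) / ((Y n + of_real s) * (w + of_real s))"
            using diff_frac_eq[OF nz, of 1 1] by simp
          then have "1 / (Y n + of_real s) - 1 / (w + of_real s) = (- 1 / ((Y n + of_real s) * (w + of_real s))) * (Y n - w)"
            unfolding eq .
          then show ?thesis unfolding mult.assoc by (simp flip: right_diff_distrib)
        qed (simp add: zero)
      qed
      also have "\<dots> = (LINT s|lborel. of_real (v s) * (- 1 / ((Y n + of_real s) * (w + of_real s)))) * (Y n - w)"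
        by (simp only: integral_mult_left_zero)
      finally show ?thesis using Y(1)[of n] by (simp add: herglotz_def divide_simps flip: right_diff_distrib)
    qed
    have "(\<lambda>n. LINT s|lborel. of_real (v s) * (- 1 / ((Y n + of_real s) * (w + complex_of_real s)))) \<longlonglongrightarrow>
          (LINT s|lborel. of_real (v s) * (- 1 / (w + of_real s)^2))"
    proof (rule integral_dominated_convergence[where w = "\<lambda>s. M * (1 / (c/2 * c)) * inverse (1 + s^2)"])
      show "integrable lborel (\<lambda>s. M * (1 / (c/2 * c)) * inverse (1 + s^2))"
        by (intro integrable_mult_right integrable_inverse_square)
      show "AE s in lborel. (\<lambda>n. of_real (v s) * (- 1 / ((Y n + of_real s) * (w + complex_of_real s))))
              \<longlonglongrightarrow> of_real (v s) * (- 1 / (w + of_real s)^2)"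
      proof (rule AE_I2)
        fix s :: real
        show "(\<lambda>n. of_real (v s) * (- 1 / ((Y n + of_real s) * (w + complex_of_real s))))
              \<longlonglongrightarrow> of_real (v s) * (- 1 / (w + of_real s)^2)"
        proof (cases "s \<le> 0")
          case False
          then have "0 < c * (1 + s)" using c(1) by auto
          then have "w + of_real s \<noteq> 0" using c(2)[of s] False by (metis norm_zero not_le linorder_linear)
          then show ?thesis unfolding power2_eq_square by (intro tendsto_intros limY) auto
        qed (simp add: zero)
      qed
      show "AE s in lborel. norm (of_real (v s) * (- 1 / ((Y n + of_real s) * (w + complex_of_real s))))
          \<le> M * (1 / (c/2 * c)) * inverse (1 + s^2)" for n
      proof (rule AE_I2, rule dominated)
        show "norm (- 1 / ((Y n + of_real s) * (w + complex_of_real s))) \<le> 1 / (c/2 * c) / (1 + s)^2" if s: "s \<ge> 0" for s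
        proof -
          have pos: "0 < (c/2) * (1 + s)" "0 < c * (1 + s)" using c(1) s by auto
          have "((c/2) * (1 + s)) * (c * (1 + s)) \<le> norm (Y n + of_real s) * norm (w + complex_of_real s)"
            using near[OF Y(2)[of n], of s] c(2)[of s] s pos by (intro mult_mono) auto
          then have "1 / (norm (Y n + of_real s) * norm (w + complex_of_real s)) \<le> 1 / (((c/2) * (1 + s)) * (c * (1 + s)))"
            by (intro frac_le mult_pos_pos[OF pos]) auto
          then show ?thesis by (simp add: norm_divide norm_mult power2_eq_square mult_ac)
        qed
      qed (use c in auto)
    qed auto
    then have "(\<lambda>n. (herglotz v (Y n) - herglotz v w) / (Y n - w)) \<longlonglongrightarrow>
        (\<i> / pi) * (LINT s|lborel. of_real (v s) * (- 1 / (w + of_real s)^2))"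
      unfolding quot by (intro tendsto_intros)
    then show "(\<lambda>n. (herglotz v (X n) - herglotz v w) / (X n - w)) \<longlonglongrightarrow>
        (\<i> / pi) * (LINT s|lborel. of_real (v s) * (- 1 / (w + of_real s)^2))"
      unfolding Y_def by (rule LIMSEQ_offset)
  qed
  then show ?thesis by (simp add: has_field_derivative_iff)
qed

text \<open>The substitution s = Im w * \<tau> - Re w turns the Poisson kernel at w into the fixed
  weight 1 / (1 + \<tau>^2). The bound by \<open>M\<close> and the boundary limit then follow with
  one majorant for all w.\<close>

lemma Re_herglotz:
  assumes "Im w > 0"
  shows "Re (herglotz v w) = (1 / pi) * (LINT \<tau>|lborel. v (Im w * \<tau> - Re w) * inverse (1 + \<tau>^2))"
proof -
  have w: "w \<notin> \<real>\<^sub>\<le>\<^sub>0" using assms by (auto simp: complex_nonpos_Reals_iff)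
  let ?J = "LINT s|lborel. of_real (v s) * (1 / (w + of_real s) - 1 / (1 + complex_of_real s))"
  have "Re (herglotz v w) = - (1 / pi) * Im ?J"
    by (simp add: herglotz_def)
  also have "Im ?J = (LINT s|lborel. Im (of_real (v s) * (1 / (w + of_real s) - 1 / (1 + complex_of_real s))))"
    using integral_Im[OF integrable_kernel[OF w]] by simp
  also have "\<dots> = (LINT s|lborel. - (v s * (Im w / ((Re w + s)^2 + (Im w)^2))))"
    by (intro Bochner_Integration.integral_cong) (auto simp: Im_divide power2_eq_square)
  also have "\<dots> = - (LINT s|lborel. v s * (Im w / ((Re w + s)^2 + (Im w)^2)))" by simp
  also have "(LINT s|lborel. v s * (Im w / ((Re w + s)^2 + (Im w)^2))) =
     \<bar>Im w\<bar> *\<^sub>R (LINT \<tau>|lborel. v (- Re w + Im w * \<tau>) * (Im w / ((Re w + (- Re w + Im w * \<tau>))^2 + (Im w)^2)))"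
    using assms by (intro lborel_integral_real_affine) auto
  also have "\<dots> = (LINT \<tau>|lborel. Im w * (v (- Re w + Im w * \<tau>) * (Im w / ((Re w + (- Re w + Im w * \<tau>))^2 + (Im w)^2))))"
    using assms by (simp only: real_scaleR_def integral_mult_right_zero abs_of_pos)
  also have "\<dots> = (LINT \<tau>|lborel. v (Im w * \<tau> - Re w) * inverse (1 + \<tau>^2))"
  proof (rule Bochner_Integration.integral_cong[OF refl])
    fix \<tau>
    have "(Im w * \<tau>)^2 + (Im w)^2 = (Im w)^2 * (1 + \<tau>^2)" by (simp add: power2_eq_square algebra_simps)
    moreover have "1 + \<tau>^2 \<noteq> 0" by (smt (verit) zero_le_power2)
    ultimately show "Im w * (v (- Re w + Im w * \<tau>) * (Im w / ((Re w + (- Re w + Im w * \<tau>))^2 + (Im w)^2))) = v (Im w * \<tau> - Re w) * inverse (1 + \<tau>^2)"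
      using assms by (simp add: divide_simps) (simp add: power2_eq_square)
  qed
  finally show ?thesis by simp
qed

lemma Re_herglotz_dominated: "norm (v r * inverse (1 + \<tau>^2)) \<le> M * inverse (1 + \<tau>^2)"
  unfolding norm_mult using bnd[of r] by (intro mult_mono) auto

lemma Re_herglotz_bound:
  assumes "Im w > 0"
  shows "\<bar>Re (herglotz v w)\<bar> \<le> M"
proof -
  have "\<bar>LINT \<tau>|lborel. v (Im w * \<tau> - Re w) * inverse (1 + \<tau>^2)\<bar> \<le> (LINT \<tau>|lborel. M * inverse (1 + \<tau>^2))"
    unfolding real_norm_def[symmetric]
  proof (rule Bochner_Integration.integral_norm_bound_integral)
    show "integrable lborel (\<lambda>\<tau>. v (Im w * \<tau> - Re w) * inverse (1 + \<tau>^2))"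
    proof (rule Bochner_Integration.integrable_bound)
      show "integrable lborel (\<lambda>s. M * inverse (1 + s^2))"
        by (intro integrable_mult_right integrable_inverse_square)
      show "AE \<tau> in lborel. norm (v (Im w * \<tau> - Re w) * inverse (1 + \<tau>^2)) \<le> norm (M * inverse (1 + \<tau>^2))"
        using Re_herglotz_dominated by (intro AE_I2) (smt (verit) real_norm_def)
    qed auto
  qed (use Re_herglotz_dominated in \<open>auto intro!: integrable_mult_right integrable_inverse_square\<close>)
  also have "\<dots> = M * pi" by (simp add: integral_inverse_square)
  finally show ?thesis unfolding Re_herglotz[OF assms] by (simp add: abs_mult field_simps)
qed

lemma Re_herglotz_boundary:
  assumes X: "\<And>n::nat. Im (X n) > 0" "X \<longlonglongrightarrow> of_real x0" and cont: "isCont v (- x0)"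
  shows "(\<lambda>n. Re (herglotz v (X n))) \<longlonglongrightarrow> v (- x0)"
proof -
  have "(\<lambda>n. LINT \<tau>|lborel. v (Im (X n) * \<tau> - Re (X n)) * inverse (1 + \<tau>^2)) \<longlonglongrightarrow>
        (LINT \<tau>|lborel. v (- x0) * inverse (1 + \<tau>^2))"
  proof (rule integral_dominated_convergence[where w = "\<lambda>s. M * inverse (1 + s^2)"])
    show "AE \<tau> in lborel. (\<lambda>n. v (Im (X n) * \<tau> - Re (X n)) * inverse (1 + \<tau>^2)) \<longlonglongrightarrow> v (- x0) * inverse (1 + \<tau>^2)"
    proof (rule AE_I2)
      fix \<tau>
      have "(\<lambda>n. Im (X n) * \<tau> - Re (X n)) \<longlonglongrightarrow> Im (of_real x0) * \<tau> - Re (of_real x0)"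
        by (intro tendsto_intros X)
      then have "(\<lambda>n. Im (X n) * \<tau> - Re (X n)) \<longlonglongrightarrow> - x0" by simp
      then show "(\<lambda>n. v (Im (X n) * \<tau> - Re (X n)) * inverse (1 + \<tau>^2)) \<longlonglongrightarrow> v (- x0) * inverse (1 + \<tau>^2)"
        by (intro tendsto_intros isCont_tendsto_compose[OF cont])
    qed
  qed (auto intro: integrable_mult_right integrable_inverse_square Re_herglotz_dominated[unfolded real_norm_def])
  then have "(\<lambda>n. (1 / pi) * (LINT \<tau>|lborel. v (Im (X n) * \<tau> - Re (X n)) * inverse (1 + \<tau>^2))) \<longlonglongrightarrow>
        (1 / pi) * (LINT \<tau>|lborel. v (- x0) * inverse (1 + \<tau>^2))"
    by (rule tendsto_mult_left)
  then show ?thesis using X(1) by (simp add: Re_herglotz integral_inverse_square)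
qed

end

section \<open>Transfer from the half-plane to the strip\<close>

text \<open>The point 1 + it of the right edge goes to exp (i pi (1 + it)) = - s with s = exp (- pi
  t), whence the form of \<open>v\<close>. The weight 1 / (1 + s)^2 is, up to sign, the derivative
  of the Herglotz kernel at w = 1.\<close>

lemma integral_beta0_substitution:
  assumes u[measurable]: "u \<in> borel_measurable borel" and bd: "\<And>t. \<bar>u t\<bar> \<le> (M::real)"
  defines "v \<equiv> \<lambda>s. if s > 0 then u (- ln s / pi) else 0"
  shows "(LINT s|lborel. v s / (1 + s)^2) = (LINT t|lborel. u t * beta0 t)"
proof -
  let ?f = "\<lambda>s. v s / (1 + s)^2" and ?g = "\<lambda>t. exp (- pi * t)"
  have M: "M \<ge> 0" using bd[of 0] by linarith
  have vm[measurable]: "v \<in> borel_measurable borel" unfolding v_def by measurable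
  have img: "range ?g = {0<..}"
  proof safe
    fix x :: real assume "x > 0"
    then have "x = exp (- pi * (- ln x / pi))" by simp
    then show "x \<in> range ?g" by blast
  qed auto
  have deriv: "(?g has_real_derivative (- pi * exp (- pi * t))) (at t within UNIV)" for t
    by (auto intro!: derivative_eq_intros)
  have inj: "inj_on ?g UNIV" by (auto simp: inj_on_def)
  have eq: "\<bar>- pi * exp (- pi * t)\<bar> * ?f (?g t) = u t * beta0 t" for t
    by (simp add: v_def beta0_eq abs_mult)
  have iu: "integrable lborel (\<lambda>t. u t * beta0 t)"
  proof (rule Bochner_Integration.integrable_bound)
    show "integrable lborel (\<lambda>t. M * beta0 t)" by (intro integrable_mult_right beta0_integral)
    show "(\<lambda>t. u t * beta0 t) \<in> borel_measurable lborel"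
      by (intro borel_measurable_times borel_measurable_integrable[OF beta0_integral(1)]) simp
    show "AE t in lborel. norm (u t * beta0 t) \<le> norm (M * beta0 t)"
      using bd beta0_pos M by (intro AE_I2) (auto simp: abs_mult intro!: mult_right_mono)
  qed
  have ai: "(\<lambda>t. u t * beta0 t) absolutely_integrable_on UNIV"
    using iu by (simp add: set_integrable_def integrable_completion)
  from has_absolute_integral_change_of_variables_1'[of UNIV ?g "\<lambda>t. - pi * exp (- pi * t)" ?f "integral UNIV (\<lambda>t. u t * beta0 t)", OF _ deriv inj, unfolded eq img]
  have "?f absolutely_integrable_on {0<..}" "integral {0<..} ?f = integral UNIV (\<lambda>t. u t * beta0 t)"
    using ai by auto
  moreover have "(\<lambda>s. indicator {0<..} s *\<^sub>R ?f s) = ?f" by (auto simp: v_def indicator_def)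
  moreover have "(LINT s|lebesgue. indicator {0<..} s *\<^sub>R ?f s) = integral {0<..} ?f"
    using set_lebesgue_integral_eq_integral(2)[OF calculation(1)] by (simp add: set_lebesgue_integral_def)
  ultimately have "(LINT s|lebesgue. ?f s) = integral UNIV (\<lambda>t. u t * beta0 t)" by simp
  also have "\<dots> = (LINT t|lborel. u t * beta0 t)"
    using integral_lborel[OF iu] .
  finally show ?thesis by (simp add: integral_completion)
qed

text \<open>The substitution \<open>w = exp (i pi z)\<close> maps the strip to the upper half-plane, its left edge to
  the positive and its right edge to the negative axis.  With the Poisson integral \<open>Re (herglotz v w)\<close> of
  the data \<open>0\<close> and \<open>u\<close> on the two edges, \<open>F * exp (- herglotz v w)\<close> is bounded by 1 in the strip and
  equal to 1 at the boundary point 0, and \<open>herglotz v w\<close> continues holomorphically across the left edge.\<close>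

lemma strip_derivative_bound:
  fixes F :: "complex \<Rightarrow> complex" and u :: "real \<Rightarrow> real"
  assumes hol: "F holomorphic_on UNIV"
    and bdF: "\<And>z. 0 \<le> Re z \<Longrightarrow> Re z \<le> 1 \<Longrightarrow> norm (F z) \<le> K"
    and left: "\<And>t. norm (F (\<i> * of_real t)) \<le> 1"
    and right: "\<And>t. norm (F (1 + \<i> * of_real t)) \<le> exp (u t)"
    and cont: "continuous_on UNIV u" and bdu: "\<And>t. \<bar>u t\<bar> \<le> M"
    and F0: "F 0 = 1" and deriv: "(F has_field_derivative D) (at 0)"
  shows "Re D \<le> (LINT t|lborel. u t * beta0 t)"
proof -
  define v where "v s = (if s > 0 then u (- ln s / pi) else 0)" for s
  have um[measurable]: "u \<in> borel_measurable borel" using cont by (rule borel_measurable_continuous_onI)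
  have M: "M \<ge> 0" using bdu[of 0] by linarith
  interpret bounded_boundary v M
  proof
    have "v = (\<lambda>s. if s > 0 then u (- ln s / pi) else 0)" by (simp add: fun_eq_iff v_def)
    then show "v \<in> borel_measurable borel" by simp
    show "\<bar>v s\<bar> \<le> M" for s using bdu M by (simp add: v_def)
    show "v s = 0" if "s \<le> 0" for s using that by (simp add: v_def)
  qed
  \<comment> \<open>At s = 0 the data may jump. This is the image of the end Im z -> +infinity of
    the strip, which no sequence converging to a finite boundary point approaches; accordingly
    \<open>x0\<close> is nonzero below.\<close>
  have cv: "isCont v s" if "s \<noteq> 0" for s
  proof (cases "s > 0")
    case True
    have "isCont (\<lambda>s. - ln s / pi) s"
      using True by (intro continuous_intros) auto
    moreover have "isCont u (- ln s / pi)" using cont by (simp add: continuous_on_eq_continuous_at)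
    ultimately have "isCont (\<lambda>s. u (- ln s / pi)) s" by (rule isCont_o2)
    moreover have "eventually (\<lambda>s. v s = u (- ln s / pi)) (nhds s)"
      using eventually_nhds_in_open[of "{0<..}" s] True by (auto simp: v_def elim!: eventually_mono)
    ultimately show ?thesis using isCont_cong[where f = v and g = "\<lambda>s. u (- ln s / pi)" and x = s] by blast
  next
    case False
    then have "eventually (\<lambda>s. v s = 0) (nhds s)"
      using eventually_nhds_in_open[of "{..<0}" s] that by (auto simp: v_def elim!: eventually_mono)
    then show ?thesis using isCont_cong[where f = v and g = "\<lambda>s. 0" and x = s] by simp
  qed
  define W where "W z = exp (\<i> * of_real pi * z)" for z
  have W: "W z = of_real (exp (- pi * Im z)) * cis (pi * Re z)" for z
    unfolding W_def by (subst exp_eq_polar) simp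
  have ImW: "Im (W z) > 0" if "0 < Re z" "Re z < 1" for z
    using that by (simp add: W sin_gt_zero)
  have Wslit: "W z \<notin> \<real>\<^sub>\<le>\<^sub>0" if "-1 < Re z" "Re z < 1" for z
  proof
    assume a: "W z \<in> \<real>\<^sub>\<le>\<^sub>0"
    then have "Im (W z) = 0" "Re (W z) \<le> 0"
      using complex_nonpos_Reals_iff[of "W z"] by blast+
    then have sc: "sin (pi * Re z) = 0" "exp (- pi * Im z) * cos (pi * Re z) \<le> 0"
      unfolding W by simp_all
    have "pi * (-1) < pi * Re z" "pi * Re z < pi * 1"
      using that by (intro mult_strict_left_mono pi_gt_zero; simp)+
    then have "pi * Re z = 0" using sin_eq_0_pi[of "pi * Re z"] sc(1) by linarith
    then have "cos (pi * Re z) = 1" by (metis cos_zero)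
    then have "exp (- pi * Im z) \<le> 0" using sc(2) by (metis mult_1_right)
    then show False using exp_gt_zero[of "- pi * Im z"] by linarith
  qed
  define g where "g z = F z * exp (- herglotz v (W z))" for z
  have pd: "herglotz v field_differentiable (at w)" if "w \<notin> \<real>\<^sub>\<le>\<^sub>0" for w
    using herglotz_derivative[OF that] by (auto simp: field_differentiable_def)
  have hp: "herglotz v holomorphic_on (- \<real>\<^sub>\<le>\<^sub>0)"
    by (rule holomorphic_onI) (auto intro!: field_differentiable_at_within pd)
  have le1: "norm (g z) \<le> 1" if z: "0 < Re z" "Re z < 1" for z
  proof (rule strip_phragmen_lindelof[of g "\<bar>K\<bar> * exp M", OF _ _ _ z])
    have "(\<lambda>z. herglotz v (W z)) holomorphic_on {z. 0 < Re z \<and> Re z < 1}"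
      by (rule holomorphic_on_compose_gen[OF _ hp, unfolded comp_def])
         (use Wslit in \<open>auto simp: W_def intro!: holomorphic_intros\<close>)
    then show "g holomorphic_on {z. 0 < Re z \<and> Re z < 1}"
      unfolding g_def by (intro holomorphic_intros holomorphic_on_subset[OF hol]) auto
    show "norm (g z) \<le> \<bar>K\<bar> * exp M" if "0 < Re z" "Re z < 1" for z
      unfolding g_def norm_mult
      using bdF[of z] that Re_herglotz_bound[OF ImW[OF that]]
      by (intro mult_mono) auto
    fix z0 X and e :: real
    assume z0: "Re z0 = 0 \<or> Re z0 = 1" and X: "\<And>n::nat. 0 < Re (X n) \<and> Re (X n) < 1"
      and lim: "X \<longlonglongrightarrow> z0" and e: "e > 0"
    define x0 where "x0 = exp (- pi * Im z0) * (if Re z0 = 0 then 1 else - 1)"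
    have "x0 \<noteq> 0" by (auto simp: x0_def)
    have "W z0 = of_real x0" using z0 by (auto simp: W x0_def)
    moreover have "(\<lambda>n. W (X n)) \<longlonglongrightarrow> W z0"
      unfolding W_def by (intro tendsto_intros lim)
    ultimately have limW: "(\<lambda>n. W (X n)) \<longlonglongrightarrow> of_real x0" by simp
    have "(\<lambda>n. Re (herglotz v (W (X n)))) \<longlonglongrightarrow> v (- x0)"
      using X ImW limW \<open>x0 \<noteq> 0\<close> by (intro Re_herglotz_boundary cv) auto
    then have "(\<lambda>n. norm (F (X n)) * exp (- Re (herglotz v (W (X n))))) \<longlonglongrightarrow> norm (F z0) * exp (- v (- x0))"
      using hol lim by (intro tendsto_intros isCont_tendsto_compose[OF _ lim])
        (auto simp: continuous_on_eq_continuous_at dest!: holomorphic_on_imp_continuous_on)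
    then have lim2: "(\<lambda>n. norm (g (X n))) \<longlonglongrightarrow> norm (F z0) * exp (- v (- x0))"
      by (simp add: g_def norm_mult)
    have "norm (F z0) * exp (- v (- x0)) \<le> 1"
    proof (cases "Re z0 = 0")
      case True
      then have "z0 = \<i> * of_real (Im z0)" by (simp add: complex_eq_iff)
      from arg_cong[OF this, of "\<lambda>z. norm (F z)"] left[of "Im z0"] have "norm (F z0) \<le> 1" by linarith
      then show ?thesis using True by (simp add: x0_def v_def)
    next
      case False
      then have "z0 = 1 + \<i> * of_real (Im z0)" using z0 by (simp add: complex_eq_iff)
      from arg_cong[OF this, of "\<lambda>z. norm (F z)"] right[of "Im z0"]
      have "norm (F z0) \<le> exp (u (Im z0))" by linarith
      moreover have "v (- x0) = u (Im z0)" using False by (simp add: x0_def v_def)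
      ultimately have "norm (F z0) * exp (- v (- x0)) \<le> exp (u (Im z0)) * exp (- u (Im z0))"
        by (intro mult_mono) auto
      then show ?thesis by (simp flip: exp_add)
    qed
    then have "norm (F z0) * exp (- v (- x0)) < 1 + e" using e by linarith
    from order_tendstoD(2)[OF lim2 this]
    show "eventually (\<lambda>n. norm (g (X n)) \<le> 1 + e) sequentially"
      by (auto elim: eventually_mono)
  qed
  have W0: "W 0 = 1" by (simp add: W_def)
  have "herglotz v 1 = 0" by (simp add: herglotz_def)
  define P where "P = (LINT s|lborel. v s / (1 + s)^2)"
  have p1: "(\<i> / pi) * (LINT s|lborel. of_real (v s) * (- 1 / (1 + of_real s)^2)) = - (\<i> / pi) * of_real P"
  proof -
    have "(LINT s|lborel. of_real (v s) * (- 1 / (1 + complex_of_real s)^2)) = (LINT s|lborel. complex_of_real (- (v s / (1 + s)^2)))"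
      by (intro Bochner_Integration.integral_cong) auto
    also have "\<dots> = of_real (- P)" unfolding integral_complex_of_real P_def by simp
    finally show ?thesis by simp
  qed
  have dp: "(herglotz v has_field_derivative (- (\<i> / pi) * of_real P)) (at (W 0))"
    using herglotz_derivative[of 1] unfolding W0 p1 by simp
  have dW: "(W has_field_derivative (\<i> * of_real pi)) (at 0)"
    unfolding W_def by (auto intro!: derivative_eq_intros)
  \<comment> \<open>The factor i pi coming from \<open>W\<close> turns - (i / pi) P into the real
    number P.\<close>
  have dpW: "((\<lambda>z. herglotz v (W z)) has_field_derivative (- (\<i> / pi) * of_real P) * (\<i> * of_real pi)) (at 0)"
    by (rule DERIV_chain2[OF dp dW])
  have "g = (\<lambda>z. F z * exp (- herglotz v (W z)))" by (simp add: fun_eq_iff g_def)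
  moreover have "\<i> * (complex_of_real P * \<i>) = - of_real P" by (simp add: mult.left_commute[of \<i>])
  ultimately have "(g has_field_derivative (D - of_real P)) (at 0)"
    using DERIV_mult[OF deriv DERIV_chain2[OF DERIV_exp DERIV_minus[OF dpW]]]
    by (simp add: W0 \<open>herglotz v 1 = 0\<close> F0)
  then have "((\<lambda>x. g (of_real x)) has_vector_derivative (D - of_real P)) (at 0)"
    by (intro has_vector_derivative_real_field) simp
  then have "((\<lambda>x. Re (g (of_real x))) has_vector_derivative Re (D - of_real P)) (at 0)"
    by (rule bounded_linear.has_vector_derivative[OF bounded_linear_Re])
  then have gd: "((\<lambda>x. Re (g (of_real x))) has_real_derivative (Re D - P)) (at 0)"
    by (simp add: has_real_derivative_iff_has_vector_derivative)
  \<comment> \<open>Along the real segment entering the strip Re g <= |g| <= 1 = g 0, so the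
    derivative of Re g at 0 cannot be positive.\<close>
  have "Re D - P \<le> 0"
  proof (rule ccontr)
    assume "\<not> Re D - P \<le> 0"
    then obtain d where d: "d > 0" "\<And>h. h > 0 \<Longrightarrow> h < d \<Longrightarrow> Re (g (of_real 0)) < Re (g (of_real (0 + h)))"
      using DERIV_pos_inc_right[OF gd] by auto
    define h where "h = min (d / 2) (1 / 2)"
    have h: "h > 0" "h < d" "h < 1" using d(1) by (auto simp: h_def)
    have "g 0 = 1" by (simp add: g_def F0 W0 \<open>herglotz v 1 = 0\<close>)
    then have "1 < Re (g (of_real h))" using d(2)[OF h(1,2)] by simp
    moreover have "norm (g (of_real h)) \<le> 1" using le1[of "of_real h"] h by simp
    ultimately show False using complex_Re_le_cmod[of "g (of_real h)"] by linarith
  qed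
  moreover have "P = (LINT t|lborel. u t * beta0 t)"
    unfolding P_def v_def by (rule integral_beta0_substitution[OF um bdu])
  ultimately show ?thesis by simp
qed

section \<open>Minors and the Cauchy-Binet formula\<close>

text \<open>The Leibniz sum over plain functions makes holomorphy, derivatives and size estimates
  termwise; the algebraic laws are imported through \<open>kdet_eq_det\<close>.\<close>

definition kdet :: "nat \<Rightarrow> (nat \<Rightarrow> nat \<Rightarrow> complex) \<Rightarrow> complex" where
  "kdet k M = (\<Sum>p | p permutes {0..<k}. of_int (sign p) * (\<Prod>i\<in>{0..<k}. M i (p i)))"

lemma kdet_eq_det: "kdet k M = Determinant.det (Matrix.mat k k (\<lambda>(i,j). M i j))"
proof -
  have "Determinant.det (Matrix.mat k k (\<lambda>(i,j). M i j)) =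
    (\<Sum>p | p permutes {0..<k}. of_int (sign p) * (\<Prod>i = 0..<k. Matrix.mat k k (\<lambda>(i,j). M i j) $$ (i, p i)))"
    by (rule det_def') auto
  also have "\<dots> = kdet k M" unfolding kdet_def
    by (intro sum.cong prod.cong arg_cong2[where f = "(*)"] refl) (auto simp: permutes_in_image)
  finally show ?thesis ..
qed

lemma kdet_cong: "(\<And>i j. i < k \<Longrightarrow> j < k \<Longrightarrow> M i j = N i j) \<Longrightarrow> kdet k M = kdet k N"
  unfolding kdet_def by (intro sum.cong prod.cong arg_cong2[where f = "(*)"] refl) (auto simp: permutes_in_image)

lemma kdet_rows_scale: "kdet k (\<lambda>i j. c i * M i j) = (\<Prod>i\<in>{0..<k}. c i) * kdet k M"
  by (simp add: kdet_def prod.distrib sum_distrib_left mult_ac)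

lemma kdet_transpose: "kdet k (\<lambda>i j. M j i) = kdet k M"
proof -
  have "Matrix.mat k k (\<lambda>(i,j). M j i) = transpose_mat (Matrix.mat k k (\<lambda>(i,j). M i j))" by auto
  then show ?thesis by (simp add: kdet_eq_det det_transpose[of _ k])
qed

lemma kdet_cnj: "kdet k (\<lambda>i j. cnj (M i j)) = cnj (kdet k M)"
  by (simp add: kdet_def)

lemma kdet_identical_rows:
  assumes "i < k" "j < k" "i \<noteq> j" "\<And>l. M i l = M j l"
  shows "kdet k M = 0"
  unfolding kdet_eq_det by (rule det_identical_rows[of _ k i j]) (use assms in auto)

lemma kdet_permute_rows:
  assumes "p permutes {0..<k}"
  shows "kdet k (\<lambda>i j. M (p i) j) = of_int (sign p) * kdet k M"
proof -
  have "Matrix.mat k k (\<lambda>(i,j). M (p i) j) = Matrix.mat k k (\<lambda>(i,j). Matrix.mat k k (\<lambda>(i,j). M i j) $$ (p i, j))"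
    using assms by (intro eq_matI) (auto simp: permutes_in_image)
  then show ?thesis using det_permute_rows[OF _ assms, of "Matrix.mat k k (\<lambda>(i,j). M i j)"]
    by (simp add: kdet_eq_det)
qed

lemma kdet_mult: "kdet k (\<lambda>i j. \<Sum>l<k. A i l * B l j) = kdet k A * kdet k B"
proof -
  have "Matrix.mat k k (\<lambda>(i,j). \<Sum>l<k. A i l * B l j) = Matrix.mat k k (\<lambda>(i,j). A i j) * Matrix.mat k k (\<lambda>(i,j). B i j)"
    by (intro eq_matI) (auto simp: scalar_prod_def lessThan_atLeast0)
  then show ?thesis by (simp add: kdet_eq_det det_mult[of _ k])
qed

lemma kdet_id: "kdet k (\<lambda>i j. if i = j then 1 else 0) = 1"
proof -
  have "Matrix.mat k k (\<lambda>(i,j). if i = j then 1 else 0) = (1\<^sub>m k :: complex mat)" by (intro eq_matI) auto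
  then show ?thesis by (simp add: kdet_eq_det)
qed

text \<open>The sum runs over all maps \<open>J\<close> instead of k-subsets: maps that are not
  injective give 0 and every subset is met k! times, which accounts for \<open>fact k\<close> and
  avoids any choice of ordering.\<close>

lemma cauchy_binet:
  fixes d :: nat
  shows
  "fact k * kdet k (\<lambda>a b. \<Sum>j<d. x a j * y j b) =
   (\<Sum>J\<in>{0..<k} \<rightarrow>\<^sub>E {..<d}. kdet k (\<lambda>a b. x a (J b)) * kdet k (\<lambda>a b. y (J a) b))"
proof -
  let ?P = "{p. p permutes {0..<k}}" and ?E = "{0..<k} \<rightarrow>\<^sub>E {..<d}"
  have fin: "finite ?E" "finite ?P" by (auto intro!: finite_PiE finite_permutations)
  have expand: "kdet k (\<lambda>a b. \<Sum>j<d. x a j * y j b) =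
     (\<Sum>J\<in>?E. (\<Prod>a\<in>{0..<k}. x a (J a)) * kdet k (\<lambda>a b. y (J a) b))"
  proof -
    have "kdet k (\<lambda>a b. \<Sum>j<d. x a j * y j b) =
      (\<Sum>p\<in>?P. of_int (sign p) * (\<Sum>J\<in>?E. \<Prod>a\<in>{0..<k}. x a (J a) * y (J a) (p a)))"
      unfolding kdet_def by (subst prod_sum_PiE) auto
    also have "\<dots> = (\<Sum>J\<in>?E. \<Sum>p\<in>?P. of_int (sign p) * (\<Prod>a\<in>{0..<k}. x a (J a) * y (J a) (p a)))"
      by (simp add: sum_distrib_left sum.swap[of _ ?P])
    also have "\<dots> = (\<Sum>J\<in>?E. (\<Prod>a\<in>{0..<k}. x a (J a)) * kdet k (\<lambda>a b. y (J a) b))"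
      by (simp add: kdet_def prod.distrib sum_distrib_left mult_ac)
    finally show ?thesis .
  qed
  \<comment> \<open>Composing \<open>J\<close> with p multiplies the determinant in y by sign p;
    adding up these k! equal expressions over p rebuilds the determinant in x.\<close>
  have perm: "(\<Sum>J\<in>?E. (\<Prod>a\<in>{0..<k}. x a (J a)) * kdet k (\<lambda>a b. y (J a) b)) =
     (\<Sum>J\<in>?E. of_int (sign p) * (\<Prod>a\<in>{0..<k}. x a (J (p a))) * kdet k (\<lambda>a b. y (J a) b))"
    if p: "p \<in> ?P" for p
  proof -
    have pp: "p permutes {0..<k}" using p by simp
    have "bij_betw (\<lambda>J. J \<circ> p) ?E ?E"
    proof (rule bij_betwI[where g = "\<lambda>J. J \<circ> inv_into UNIV p"])
      have comp: "J \<circ> q \<in> ?E" if "J \<in> ?E" "q permutes {0..<k}" for J q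
        using that by (auto simp: PiE_iff permutes_in_image extensional_def permutes_not_in)
      show "(\<lambda>J. J \<circ> p) \<in> ?E \<rightarrow> ?E" "(\<lambda>J. J \<circ> inv_into UNIV p) \<in> ?E \<rightarrow> ?E"
        using comp pp permutes_inv[OF pp] by blast+
    qed (auto simp: comp_assoc permutes_inv_o[OF pp])
    then have "(\<Sum>J\<in>?E. (\<Prod>a\<in>{0..<k}. x a (J a)) * kdet k (\<lambda>a b. y (J a) b)) =
      (\<Sum>J\<in>?E. (\<Prod>a\<in>{0..<k}. x a ((J \<circ> p) a)) * kdet k (\<lambda>a b. y ((J \<circ> p) a) b))"
      by (intro sum.reindex_bij_betw[symmetric, where h = "\<lambda>J. J \<circ> p"])
    also have "\<dots> = (\<Sum>J\<in>?E. of_int (sign p) * (\<Prod>a\<in>{0..<k}. x a (J (p a))) * kdet k (\<lambda>a b. y (J a) b))"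
    proof (rule sum.cong[OF refl])
      fix J
      have "kdet k (\<lambda>a b. y ((J \<circ> p) a) b) = of_int (sign p) * kdet k (\<lambda>a b. y (J a) b)"
        using kdet_permute_rows[OF pp, of "\<lambda>a b. y (J a) b"] by simp
      then show "(\<Prod>a\<in>{0..<k}. x a ((J \<circ> p) a)) * kdet k (\<lambda>a b. y ((J \<circ> p) a) b) =
        of_int (sign p) * (\<Prod>a\<in>{0..<k}. x a (J (p a))) * kdet k (\<lambda>a b. y (J a) b)"
        by simp
    qed
    finally show ?thesis .
  qed
  have "fact k * kdet k (\<lambda>a b. \<Sum>j<d. x a j * y j b) =
     (\<Sum>p\<in>?P. \<Sum>J\<in>?E. (\<Prod>a\<in>{0..<k}. x a (J a)) * kdet k (\<lambda>a b. y (J a) b))"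
    unfolding expand by (simp add: card_permutations[OF refl])
  also have "\<dots> = (\<Sum>p\<in>?P. \<Sum>J\<in>?E. of_int (sign p) * (\<Prod>a\<in>{0..<k}. x a (J (p a))) * kdet k (\<lambda>a b. y (J a) b))"
    by (rule sum.cong[OF refl perm])
  also have "\<dots> = (\<Sum>J\<in>?E. \<Sum>p\<in>?P. of_int (sign p) * (\<Prod>a\<in>{0..<k}. x a (J (p a))) * kdet k (\<lambda>a b. y (J a) b))"
    by (rule sum.swap)
  also have "\<dots> = (\<Sum>J\<in>?E. kdet k (\<lambda>a b. x a (J b)) * kdet k (\<lambda>a b. y (J a) b))"
    by (simp add: kdet_def sum_distrib_right)
  finally show ?thesis .
qed

text \<open>A permutation other than the identity moves at least two indices, so its product at
  \<open>z0\<close> still contains a zero factor after one factor has been differentiated. Only the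
  diagonal survives.\<close>

lemma kdet_derivative_at_id:
  assumes d: "\<And>i j. i < k \<Longrightarrow> j < k \<Longrightarrow> ((\<lambda>z. M z i j) has_field_derivative D i j) (at z0)"
    and id: "\<And>i j. i < k \<Longrightarrow> j < k \<Longrightarrow> M z0 i j = (if i = j then 1 else 0)"
  shows "((\<lambda>z. kdet k (M z)) has_field_derivative (\<Sum>i<k. D i i)) (at z0)"
proof -
  let ?P = "{p. p permutes {0..<k}}"
  define T where "T p = (\<Sum>i\<in>{0..<k}. D i (p i) * (\<Prod>j\<in>{0..<k}-{i}. M z0 j (p j)))" for p
  have fin: "finite ?P" by (auto intro: finite_permutations)
  have "((\<lambda>z. kdet k (M z)) has_field_derivative (\<Sum>p\<in>?P. of_int (sign p) * T p)) (at z0)"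
    unfolding kdet_def
  proof (intro DERIV_sum DERIV_cmult)
    fix p assume "p \<in> ?P"
    then have "\<And>i. i \<in> {0..<k} \<Longrightarrow> ((\<lambda>z. M z i (p i)) has_field_derivative D i (p i)) (at z0)"
      using d permutes_in_image by fastforce
    then show "((\<lambda>z. \<Prod>i\<in>{0..<k}. M z i (p i)) has_field_derivative T p) (at z0)"
      unfolding T_def by (rule has_field_derivative_prod)
  qed
  moreover have "T p = 0" if p: "p \<in> ?P" "p \<noteq> id" for p
    unfolding T_def
  proof (intro sum.neutral ballI)
    fix i assume i: "i \<in> {0..<k}"
    from p(2) obtain a where a: "p a \<noteq> a" by (auto simp: fun_eq_iff)
    have pp: "p permutes {0..<k}" using p by simp
    have ak: "a \<in> {0..<k}" using a pp by (metis permutes_not_in)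
    have pak: "p a \<in> {0..<k}" using ak pp by (metis permutes_in_image)
    have "p (p a) \<noteq> p a" using a pp by (metis permutes_def)
    then obtain b where b: "b \<in> {0..<k} - {i}" "p b \<noteq> b"
      using a ak pak by (cases "a = i") auto
    then have "M z0 b (p b) = 0" using id pp permutes_in_image by fastforce
    then have "(\<Prod>j\<in>{0..<k}-{i}. M z0 j (p j)) = 0" using b by (intro prod_zero) auto
    then show "D i (p i) * (\<Prod>j\<in>{0..<k}-{i}. M z0 j (p j)) = 0" by simp
  qed
  then have "(\<Sum>p\<in>?P. of_int (sign p) * T p) = (\<Sum>p\<in>{id}. of_int (sign p) * T p)"
    using fin by (intro sum.mono_neutral_right) (auto simp: permutes_id)
  moreover have "T id = (\<Sum>i<k. D i i)"
    unfolding T_def by (intro sum.cong) (auto simp: id intro!: prod.neutral)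
  ultimately show ?thesis by simp
qed

lemma kdet_holomorphic:
  assumes "\<And>i j. i < k \<Longrightarrow> j < k \<Longrightarrow> (\<lambda>z. M z i j) holomorphic_on S"
  shows "(\<lambda>z. kdet k (M z)) holomorphic_on S"
  unfolding kdet_def
proof (intro holomorphic_intros)
  fix p i assume "p \<in> {p. p permutes {0..<k}}" "i \<in> {0..<k}"
  then show "(\<lambda>z. M z i (p i)) holomorphic_on S"
    using assms permutes_in_image by fastforce
qed

lemma kdet_bound:
  assumes "\<And>i j. i < k \<Longrightarrow> j < k \<Longrightarrow> norm (M i j) \<le> C"
  shows "norm (kdet k M) \<le> fact k * C ^ k"
proof -
  let ?P = "{p. p permutes {0..<k}}"
  have "norm (kdet k M) \<le> (\<Sum>p\<in>?P. norm (of_int (sign p) * (\<Prod>i\<in>{0..<k}. M i (p i))))"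
    unfolding kdet_def by (rule norm_sum)
  also have "\<dots> \<le> (\<Sum>p\<in>?P. C ^ k)"
  proof (rule sum_mono)
    fix p assume p: "p \<in> ?P"
    have "norm (of_int (sign p) * (\<Prod>i\<in>{0..<k}. M i (p i))) = (\<Prod>i\<in>{0..<k}. norm (M i (p i)))"
      by (simp add: norm_mult sign_def prod_norm)
    also have "\<dots> \<le> (\<Prod>i\<in>{0..<k}. C)"
    proof (intro prod_mono conjI)
      fix i assume "i \<in> {0..<k}"
      then show "norm (M i (p i)) \<le> C" using p assms permutes_in_image by fastforce
    qed auto
    finally show "norm (of_int (sign p) * (\<Prod>i\<in>{0..<k}. M i (p i))) \<le> C ^ k" by simp
  qed
  also have "\<dots> = fact k * C ^ k" by (simp add: card_permutations[OF refl])
  finally show ?thesis .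
qed

section \<open>Majorization and symmetric gauge functions\<close>

text \<open>Summation by parts. Since the total of e is 0, the last boundary term disappears and c
  may have any sign.\<close>

lemma abel_sum_nonneg:
  fixes c e :: "nat \<Rightarrow> real"
  assumes dec: "\<And>i j. i < j \<Longrightarrow> j < d \<Longrightarrow> c j \<le> c i"
    and part: "\<And>k. k \<le> d \<Longrightarrow> (\<Sum>j<k. e j) \<ge> 0" and tot: "(\<Sum>j<d. e j) = 0"
  shows "(\<Sum>j<d. c j * e j) \<ge> 0"
proof -
  have *: "(\<Sum>j<Suc k. c j * e j) \<ge> c k * (\<Sum>j<Suc k. e j)" if "k < d" for k
    using that
  proof (induction k)
    case (Suc k)
    have "c (Suc k) * (\<Sum>j<Suc k. e j) \<le> c k * (\<Sum>j<Suc k. e j)"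
      using Suc.prems by (intro mult_right_mono dec part) auto
    also have "\<dots> \<le> (\<Sum>j<Suc k. c j * e j)" using Suc by simp
    finally show ?case by (simp add: algebra_simps)
  qed simp
  show ?thesis
  proof (cases d)
    case (Suc k)
    then show ?thesis using *[of k] tot by simp
  qed simp
qed

text \<open>Let e be the indicator of the first k indices minus w. Its partial sums are nonnegative:
  up to k because w <= 1, beyond k because the weights still to come are nonnegative. Abel summation
  finishes.\<close>

lemma weighted_sum_le_top_sum:
  fixes lam w :: "nat \<Rightarrow> real"
  assumes dec: "\<And>i j. i < j \<Longrightarrow> j < d \<Longrightarrow> lam j \<le> lam i"
    and w: "\<And>j. j < d \<Longrightarrow> 0 \<le> w j" "\<And>j. j < d \<Longrightarrow> w j \<le> 1" "(\<Sum>j<d. w j) = real k" and k: "k \<le> d"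
  shows "(\<Sum>j<d. lam j * w j) \<le> (\<Sum>j<k. lam j)"
proof -
  define e where "e j = (if j < k then 1 else 0) - w j" for j
  have ind: "(\<Sum>j<m. (if j < k then 1 else 0)) = real (min m k)" for m
    by (induction m) auto
  have sum_e: "(\<Sum>j<m. e j) = real (min m k) - (\<Sum>j<m. w j)" for m
    by (simp add: e_def sum_subtractf ind)
  have "(\<Sum>j<d. lam j * e j) \<ge> 0"
  proof (rule abel_sum_nonneg[OF dec])
    fix m assume m: "m \<le> d"
    show "(\<Sum>j<m. e j) \<ge> 0"
    proof (cases "m \<le> k")
      case True
      have "(\<Sum>j<m. w j) \<le> (\<Sum>j<m. 1)" using m w by (intro sum_mono) auto
      then show ?thesis using True by (simp add: sum_e)
    next
      case False
      have "(\<Sum>j<m. w j) \<le> (\<Sum>j<d. w j)" using m w by (intro sum_mono2) auto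
      then show ?thesis using False w by (simp add: sum_e)
    qed
  next
    show "(\<Sum>j<d. e j) = 0" using w k by (simp add: sum_e)
  qed
  moreover have "(\<Sum>j<d. lam j * e j) = (\<Sum>j<k. lam j) - (\<Sum>j<d. lam j * w j)"
  proof -
    have "(\<Sum>j<d. lam j * e j) = (\<Sum>j<d. if j < k then lam j else 0) - (\<Sum>j<d. lam j * w j)"
      unfolding sum_subtractf[symmetric] by (intro sum.cong) (auto simp: e_def algebra_simps)
    also have "(\<Sum>j<d. if j < k then lam j else 0) = (\<Sum>j<k. lam j)"
      using k by (intro sum.mono_neutral_cong_right) auto
    finally show ?thesis .
  qed
  ultimately show ?thesis by simp
qed

lemma sorting_permutation:
  fixes p :: "nat \<Rightarrow> real"
  obtains \<pi> where "\<pi> permutes {..<d}" "\<And>j. j < d \<Longrightarrow> p (\<pi> j) = rev (sort (map p [0..<d])) ! j"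
    "\<And>i j. i < j \<Longrightarrow> j < d \<Longrightarrow> p (\<pi> j) \<le> p (\<pi> i)"
proof -
  let ?s = "rev (sort (map p [0..<d]))"
  have "mset ?s = mset (map p [0..<d])" by simp
  then obtain \<pi> where \<pi>: "\<pi> permutes {..<length (map p [0..<d])}" "permute_list \<pi> (map p [0..<d]) = ?s"
    by (rule mset_eq_permutation)
  have perm: "\<pi> permutes {..<d}" using \<pi>(1) by simp
  have nth: "p (\<pi> j) = ?s ! j" if "j < d" for j
  proof -
    have "\<pi> j < d" using perm that permutes_in_image by fastforce
    then show ?thesis using that \<pi>(2)[symmetric] by (simp add: permute_list_def)
  qed
  have "p (\<pi> j) \<le> p (\<pi> i)" if "i < j" "j < d" for i j
    using that sorted_nth_mono[of "sort (map p [0..<d])" "d - Suc j" "d - Suc i"]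
    by (simp add: nth rev_nth)
  then show ?thesis using that perm nth by blast
qed

text \<open>Vectors are functions on all of nat; the dimension enters only through maps \<Psi> that
  depend on the first d coordinates, and so can stay a variable.\<close>

definition fun_convex :: "((nat \<Rightarrow> real) \<Rightarrow> real) \<Rightarrow> bool" where
  "fun_convex \<Psi> \<longleftrightarrow> (\<forall>x y \<theta>. 0 \<le> \<theta> \<longrightarrow> \<theta> \<le> 1 \<longrightarrow>
      \<Psi> (\<lambda>i. (1 - \<theta>) * x i + \<theta> * y i) \<le> (1 - \<theta>) * \<Psi> x + \<theta> * \<Psi> y)"

text \<open>A subgradient, extended from one coordinate to the next as in the Hahn-Banach theorem.\<close>

lemma fun_convex_subgradient:
  assumes conv: "fun_convex \<Psi>"
  shows "\<exists>p. \<forall>x. (\<forall>i\<ge>m. x i = a i) \<longrightarrow> \<Psi> x \<ge> \<Psi> a + (\<Sum>i<m. p i * (x i - a i))"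
proof (induction m)
  case 0
  have "x = a" if "\<forall>i\<ge>0. x i = a i" for x using that by auto
  then show ?case by auto
next
  case (Suc m)
  then obtain p where p: "\<And>x. (\<forall>i\<ge>m. x i = a i) \<Longrightarrow> \<Psi> x \<ge> \<Psi> a + (\<Sum>i<m. p i * (x i - a i))" by blast
  define L where "L x = \<Psi> a + (\<Sum>i<m. p i * (x i - a i))" for x
  define dom where "dom x \<longleftrightarrow> (\<forall>i\<ge>Suc m. x i = a i)" for x
  \<comment> \<open>The point z of the segment from y to x with m-th coordinate a m lies where the
    induction hypothesis applies. It forces every slope from the left below every slope from the
    right, so the supremum of the left slopes extends the subgradient.\<close>
  have cross: "(L y - \<Psi> y) / (a m - y m) \<le> (\<Psi> x - L x) / (x m - a m)"
    if y: "dom y" "y m < a m" and x: "dom x" "x m > a m" for x y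
  proof -
    define s t where "s = x m - a m" and "t = a m - y m"
    have st: "s > 0" "t > 0" using x y by (auto simp: s_def t_def)
    define \<theta> where "\<theta> = t / (s + t)"
    have \<theta>: "0 \<le> \<theta>" "\<theta> \<le> 1" "1 - \<theta> = s / (s + t)" using st by (auto simp: \<theta>_def field_simps)
    define z where "z i = (1 - \<theta>) * y i + \<theta> * x i" for i
    have "z i = a i" if "i \<ge> m" for i
    proof (cases "i = m")
      case True
      have "s * y m + t * x m = a m * (s + t)" by (simp add: s_def t_def algebra_simps)
      moreover have "z m = (s * y m + t * x m) / (s + t)"
        unfolding z_def \<theta>(3) unfolding \<theta>_def by (simp add: add_divide_distrib)
      ultimately show ?thesis using st True by simp
    next
      case False
      then have "y i = a i" "x i = a i" using that x y by (auto simp: dom_def)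
      then show ?thesis by (simp add: z_def algebra_simps)
    qed
    then have "L z \<le> \<Psi> z" using p by (auto simp: L_def)
    also have "\<dots> \<le> (1 - \<theta>) * \<Psi> y + \<theta> * \<Psi> x"
      using conv \<theta> unfolding fun_convex_def z_def[abs_def] by blast
    finally have 1: "L z \<le> (1 - \<theta>) * \<Psi> y + \<theta> * \<Psi> x" .
    have "p i * (z i - a i) = (1 - \<theta>) * (p i * (y i - a i)) + \<theta> * (p i * (x i - a i))" for i
      by (simp add: z_def algebra_simps)
    then have "L z = (1 - \<theta>) * L y + \<theta> * L x"
      by (simp add: L_def sum.distrib flip: sum_distrib_left) (simp add: algebra_simps)
    with 1 have "(1 - \<theta>) * (L y - \<Psi> y) \<le> \<theta> * (\<Psi> x - L x)" by (simp add: algebra_simps)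
    then have "s * (L y - \<Psi> y) \<le> t * (\<Psi> x - L x)"
      unfolding \<theta>(3) using st by (simp add: \<theta>_def divide_le_cancel)
    then show ?thesis using st unfolding s_def[symmetric] t_def[symmetric] by (simp add: field_simps)
  qed
  define Lo where "Lo = {(L y - \<Psi> y) / (a m - y m) | y. dom y \<and> y m < a m}"
  define c where "c = Sup Lo"
  let ?x1 = "a(m := a m + 1)"
  have x1: "dom ?x1" "?x1 m > a m" by (auto simp: dom_def)
  have "dom (a(m := a m - 1)) \<and> (a(m := a m - 1)) m < a m" by (auto simp: dom_def)
  then have ne: "Lo \<noteq> {}" unfolding Lo_def by blast
  have bdd: "bdd_above Lo"
    unfolding bdd_above_def Lo_def using cross[OF _ _ x1] by blast
  have low: "(L y - \<Psi> y) / (a m - y m) \<le> c" if "dom y" "y m < a m" for y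
    unfolding c_def by (rule cSup_upper[OF _ bdd]) (use that in \<open>auto simp: Lo_def\<close>)
  have up: "c \<le> (\<Psi> x - L x) / (x m - a m)" if "dom x" "x m > a m" for x
    unfolding c_def by (rule cSup_least[OF ne]) (use that cross in \<open>auto simp: Lo_def\<close>)
  show ?case
  proof (intro exI[of _ "p(m := c)"] allI impI)
    fix x assume "\<forall>i\<ge>Suc m. x i = a i"
    then have x: "dom x" by (simp add: dom_def)
    have "L x + c * (x m - a m) \<le> \<Psi> x"
    proof -
      consider "x m = a m" | "x m > a m" | "x m < a m" by linarith
      then show ?thesis
      proof cases
        case 1
        then have "\<forall>i\<ge>m. x i = a i" using x unfolding dom_def by (metis Suc_leI le_neq_implies_less)
        then show ?thesis using p 1 by (simp add: L_def)
      next
        case 2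
        then show ?thesis using up[OF x 2] by (simp add: field_simps)
      next
        case 3
        then show ?thesis using low[OF x 3] by (simp add: field_simps)
      qed
    qed
    moreover have "(\<Sum>i<m. (p(m := c)) i * (x i - a i)) = (\<Sum>i<m. p i * (x i - a i))"
      by (intro sum.cong) auto
    ultimately show "\<Psi> a + (\<Sum>i<Suc m. (p(m := c)) i * (x i - a i)) \<le> \<Psi> x"
      by (simp add: L_def)
  qed
qed

text \<open>The subgradient p dictates the order: sorted by \<pi> it is decreasing, and Abel
  summation pairs it with the averages of b minus the permuted a, whose partial sums are
  nonnegative. Since \<pi> comes from p and not from the size of a, \<open>maj\<close> has to bound
  every selection of k coordinates of a; symmetry of \<Psi> lets b t be rearranged to match.\<close>

lemma majorization_jensen:
  fixes \<Psi> :: "(nat \<Rightarrow> real) \<Rightarrow> real" and b :: "'s \<Rightarrow> nat \<Rightarrow> real" and \<beta> :: "'s \<Rightarrow> real"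
  assumes conv: "fun_convex \<Psi>"
    and local: "\<And>x y. (\<And>i. i < d \<Longrightarrow> x i = y i) \<Longrightarrow> \<Psi> x = \<Psi> y"
    and sym: "\<And>x p. p permutes {..<d} \<Longrightarrow> \<Psi> (\<lambda>i. x (p i)) = \<Psi> x"
    and \<beta>: "integrable M \<beta>" "\<And>t. \<beta> t \<ge> 0" "(LINT t|M. \<beta> t) = 1"
    and ib: "\<And>j. j < d \<Longrightarrow> integrable M (\<lambda>t. b t j * \<beta> t)"
    and i\<Psi>: "integrable M (\<lambda>t. \<Psi> (b t) * \<beta> t)"
    and maj: "\<And>\<kappa> k. k \<le> d \<Longrightarrow> inj_on \<kappa> {..<k} \<Longrightarrow> \<kappa> ` {..<k} \<subseteq> {..<d} \<Longrightarrow>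
        (\<Sum>i<k. a (\<kappa> i)) \<le> (LINT t|M. (\<Sum>j<k. b t j) * \<beta> t)"
    and tot: "(\<Sum>i<d. a i) = (LINT t|M. (\<Sum>j<d. b t j) * \<beta> t)"
  shows "\<Psi> a \<le> (LINT t|M. \<Psi> (b t) * \<beta> t)"
proof -
  obtain p where p: "\<And>x. (\<forall>i\<ge>d. x i = a i) \<Longrightarrow> \<Psi> x \<ge> \<Psi> a + (\<Sum>i<d. p i * (x i - a i))"
    using fun_convex_subgradient[OF conv, of d a] by blast
  obtain \<pi> where \<pi>: "\<pi> permutes {..<d}" and dec: "\<And>i j. i < j \<Longrightarrow> j < d \<Longrightarrow> p (\<pi> j) \<le> p (\<pi> i)"
    by (rule sorting_permutation[of d p]) blast
  define B where "B j = (LINT t|M. b t j * \<beta> t)" for j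
  have B_sum: "(LINT t|M. (\<Sum>j<k. b t j) * \<beta> t) = (\<Sum>j<k. B j)" if "k \<le> d" for k
    unfolding B_def sum_distrib_right using that ib by (intro Bochner_Integration.integral_sum) auto
  have point: "\<Psi> (b t) \<ge> \<Psi> a + (\<Sum>j<d. p (\<pi> j) * (b t j - a (\<pi> j)))" for t
  proof -
    \<comment> \<open>Beyond d the entries of a are used, because the subgradient inequality holds
      for vectors agreeing with a there.\<close>
    define x where "x i = (if i < d then b t (inv_into UNIV \<pi> i) else a i)" for i
    have "\<Psi> (b t) = \<Psi> (\<lambda>i. b t (inv_into UNIV \<pi> i))" using sym[OF permutes_inv[OF \<pi>]] by simp
    also have "\<dots> = \<Psi> x" by (rule local) (simp add: x_def)
    also have "\<dots> \<ge> \<Psi> a + (\<Sum>i<d. p i * (x i - a i))" by (rule p) (simp add: x_def)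
    also have "(\<Sum>i<d. p i * (x i - a i)) = (\<Sum>i<d. p (\<pi> i) * (x (\<pi> i) - a (\<pi> i)))"
      by (rule sum.permute[OF \<pi>, unfolded comp_def])
    also have "\<dots> = (\<Sum>j<d. p (\<pi> j) * (b t j - a (\<pi> j)))"
    proof (rule sum.cong[OF refl])
      fix j assume "j \<in> {..<d}"
      then have "\<pi> j < d" using \<pi> permutes_in_image by fastforce
      then show "p (\<pi> j) * (x (\<pi> j) - a (\<pi> j)) = p (\<pi> j) * (b t j - a (\<pi> j))"
        by (simp add: x_def permutes_inverses(2)[OF \<pi>])
    qed
    finally show ?thesis .
  qed
  have "(\<Sum>j<d. p (\<pi> j) * (B j - a (\<pi> j))) \<ge> 0"
  proof (rule abel_sum_nonneg[OF dec])
    fix k assume k: "k \<le> d"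
    have "inj_on \<pi> {..<k}" using \<pi> permutes_inj inj_on_subset by blast
    moreover have "\<pi> ` {..<k} \<subseteq> {..<d}" using k permutes_image[OF \<pi>] by fastforce
    ultimately have "(\<Sum>i<k. a (\<pi> i)) \<le> (\<Sum>j<k. B j)" using maj[OF k, of \<pi>] B_sum[OF k] by simp
    then show "(\<Sum>j<k. B j - a (\<pi> j)) \<ge> 0" by (simp add: sum_subtractf)
  next
    have "(\<Sum>i<d. a (\<pi> i)) = (\<Sum>i<d. a i)"
      using sum.permute[OF \<pi>, of a] by (simp add: comp_def)
    then show "(\<Sum>j<d. B j - a (\<pi> j)) = 0" using tot B_sum[of d] by (simp add: sum_subtractf)
  qed
  moreover have "(LINT t|M. (\<Psi> a + (\<Sum>j<d. p (\<pi> j) * (b t j - a (\<pi> j)))) * \<beta> t)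
      = \<Psi> a + (\<Sum>j<d. p (\<pi> j) * (B j - a (\<pi> j)))"
    and int: "integrable M (\<lambda>t. (\<Psi> a + (\<Sum>j<d. p (\<pi> j) * (b t j - a (\<pi> j)))) * \<beta> t)"
  proof -
    have eq: "(\<Psi> a + (\<Sum>j<d. p (\<pi> j) * (b t j - a (\<pi> j)))) * \<beta> t =
       \<Psi> a * \<beta> t + (\<Sum>j<d. p (\<pi> j) * (b t j * \<beta> t) - p (\<pi> j) * a (\<pi> j) * \<beta> t)" for t
      by (simp add: distrib_right sum_distrib_right right_diff_distrib left_diff_distrib mult.assoc)
    have i1: "integrable M (\<lambda>t. \<Psi> a * \<beta> t)" using \<beta> by simp
    have i2: "integrable M (\<lambda>t. p (\<pi> j) * (b t j * \<beta> t))" if "j < d" for j using ib[OF that] by simp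
    have i3: "integrable M (\<lambda>t. p (\<pi> j) * a (\<pi> j) * \<beta> t)" for j using \<beta> by simp
    show "integrable M (\<lambda>t. (\<Psi> a + (\<Sum>j<d. p (\<pi> j) * (b t j - a (\<pi> j)))) * \<beta> t)"
      unfolding eq by (intro Bochner_Integration.integrable_add Bochner_Integration.integrable_sum Bochner_Integration.integrable_diff i1 i2 i3) auto
    have "(LINT t|M. (\<Psi> a + (\<Sum>j<d. p (\<pi> j) * (b t j - a (\<pi> j)))) * \<beta> t) =
       (LINT t|M. \<Psi> a * \<beta> t) + (LINT t|M. (\<Sum>j<d. p (\<pi> j) * (b t j * \<beta> t) - p (\<pi> j) * a (\<pi> j) * \<beta> t))"
      unfolding eq
      by (intro Bochner_Integration.integral_add Bochner_Integration.integrable_sum Bochner_Integration.integrable_diff i1 i2 i3) auto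
    also have "(LINT t|M. (\<Sum>j<d. p (\<pi> j) * (b t j * \<beta> t) - p (\<pi> j) * a (\<pi> j) * \<beta> t)) =
       (\<Sum>j<d. (LINT t|M. p (\<pi> j) * (b t j * \<beta> t) - p (\<pi> j) * a (\<pi> j) * \<beta> t))"
      by (intro Bochner_Integration.integral_sum Bochner_Integration.integrable_diff i2 i3) auto
    also have "\<dots> = (\<Sum>j<d. p (\<pi> j) * (B j - a (\<pi> j)))"
    proof (rule sum.cong[OF refl])
      fix j assume "j \<in> {..<d}"
      then have "(LINT t|M. p (\<pi> j) * (b t j * \<beta> t) - p (\<pi> j) * a (\<pi> j) * \<beta> t) =
         (LINT t|M. p (\<pi> j) * (b t j * \<beta> t)) - (LINT t|M. p (\<pi> j) * a (\<pi> j) * \<beta> t)"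
        by (intro Bochner_Integration.integral_diff i2 i3) auto
      then show "(LINT t|M. p (\<pi> j) * (b t j * \<beta> t) - p (\<pi> j) * a (\<pi> j) * \<beta> t) = p (\<pi> j) * (B j - a (\<pi> j))"
        by (simp add: B_def \<beta>(3) right_diff_distrib)
    qed
    finally show "(LINT t|M. (\<Psi> a + (\<Sum>j<d. p (\<pi> j) * (b t j - a (\<pi> j)))) * \<beta> t)
      = \<Psi> a + (\<Sum>j<d. p (\<pi> j) * (B j - a (\<pi> j)))" by (simp add: \<beta>(3))
  qed
  moreover have "(LINT t|M. (\<Psi> a + (\<Sum>j<d. p (\<pi> j) * (b t j - a (\<pi> j)))) * \<beta> t) \<le> (LINT t|M. \<Psi> (b t) * \<beta> t)"
    by (rule integral_mono[OF int i\<Psi>]) (intro mult_right_mono point \<beta>)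
  ultimately show ?thesis by linarith
qed


section \<open>Symmetric gauge functions\<close>

locale symmetric_gauge =
  fixes d :: nat and \<rho> :: "real list \<Rightarrow> real"
  assumes sg: "sym_gauge d \<rho>"
begin

definition gauge_of :: "(nat \<Rightarrow> real) \<Rightarrow> real" where
  "gauge_of x = \<rho> (map x [0..<d])"

lemma gauge_of_cong: "(\<And>i. i < d \<Longrightarrow> x i = y i) \<Longrightarrow> gauge_of x = gauge_of y"
  unfolding gauge_of_def by (intro arg_cong[where f = \<rho>] map_cong) auto

lemma gauge_of_nonneg: "gauge_of x \<ge> 0"
  using sg unfolding sym_gauge_def gauge_of_def by simp

lemma gauge_of_pos: "i < d \<Longrightarrow> x i \<noteq> 0 \<Longrightarrow> gauge_of x > 0"
proof -
  assume i: "i < d" "x i \<noteq> 0"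
  have "gauge_of x \<noteq> 0" using sg i unfolding sym_gauge_def gauge_of_def by (force simp: nth_append)
  then show ?thesis using gauge_of_nonneg[of x] by simp
qed

lemma gauge_of_scale: "gauge_of (\<lambda>i. c * x i) = \<bar>c\<bar> * gauge_of x"
proof -
  have "\<forall>a xs. length xs = d \<longrightarrow> \<rho> (map (\<lambda>y. a * y) xs) = \<bar>a\<bar> * \<rho> xs"
    using sg unfolding sym_gauge_def by blast
  from this[rule_format, of "map x [0..<d]" c] show ?thesis by (simp add: gauge_of_def comp_def)
qed

lemma gauge_of_triangle: "gauge_of (\<lambda>i. x i + y i) \<le> gauge_of x + gauge_of y"
proof -
  have "\<forall>x y. length x = d \<longrightarrow> length y = d \<longrightarrow> \<rho> (map2 (+) x y) \<le> \<rho> x + \<rho> y"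
    using sg unfolding sym_gauge_def by blast
  from this[rule_format, of "map x [0..<d]" "map y [0..<d]"] show ?thesis
    by (simp add: gauge_of_def zip_map_map map_zip_map map_zip_map2 zip_same_conv_map comp_def)
qed

lemma gauge_of_abs: "gauge_of (\<lambda>i. \<bar>x i\<bar>) = gauge_of x"
proof -
  have "\<forall>x. length x = d \<longrightarrow> \<rho> (map abs x) = \<rho> x"
    using sg unfolding sym_gauge_def by blast
  from this[rule_format, of "map x [0..<d]"] show ?thesis by (simp add: gauge_of_def comp_def)
qed

lemma gauge_of_permute:
  assumes "p permutes {..<d}"
  shows "gauge_of (\<lambda>i. x (p i)) = gauge_of x"
proof -
  have "\<forall>x p. length x = d \<longrightarrow> p permutes {..<d} \<longrightarrow> \<rho> (map (\<lambda>i. x ! p i) [0..<d]) = \<rho> x"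
    using sg unfolding sym_gauge_def by blast
  from this[rule_format, OF _ assms, of "map x [0..<d]"]
  have "\<rho> (map (\<lambda>i. map x [0..<d] ! p i) [0..<d]) = gauge_of x" by (simp add: gauge_of_def)
  moreover have "map (\<lambda>i. map x [0..<d] ! p i) [0..<d] = map (\<lambda>i. x (p i)) [0..<d]"
  proof (rule map_cong[OF refl])
    fix i assume "i \<in> set [0..<d]"
    then have "p i < d" using assms permutes_in_image by fastforce
    then show "map x [0..<d] ! p i = x (p i)" by simp
  qed
  ultimately show ?thesis by (simp add: gauge_of_def)
qed

text \<open>The shrunk vector is the convex combination, with weights (1 + c) / 2 and (1 - c) / 2,
  of x and of x with its m-th sign reversed, and both have the same gauge.\<close>

lemma gauge_of_shrink:
  assumes "0 \<le> c" "c \<le> 1"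
  shows "gauge_of (x(m := c * x m)) \<le> gauge_of x"
proof -
  have neg: "gauge_of (x(m := - x m)) = gauge_of x"
  proof -
    have "gauge_of (\<lambda>i. \<bar>(x(m := - x m)) i\<bar>) = gauge_of (\<lambda>i. \<bar>x i\<bar>)" by (rule gauge_of_cong) auto
    then show ?thesis unfolding gauge_of_abs .
  qed
  have "x(m := c * x m) = (\<lambda>i. ((1 + c) / 2) * x i + ((1 - c) / 2) * (x(m := - x m)) i)"
    by (auto simp: fun_eq_iff field_simps)
  then have "gauge_of (x(m := c * x m)) = gauge_of (\<lambda>i. ((1 + c) / 2) * x i + ((1 - c) / 2) * (x(m := - x m)) i)"
    by (rule arg_cong)
  also have "\<dots> \<le> ((1 + c) / 2) * gauge_of x + ((1 - c) / 2) * gauge_of (x(m := - x m))"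
    using gauge_of_triangle[of "\<lambda>i. ((1 + c) / 2) * x i" "\<lambda>i. ((1 - c) / 2) * (x(m := - x m)) i"]
    unfolding gauge_of_scale using assms by (simp add: fun_upd_def)
  also have "\<dots> = ((1 + c) / 2) * gauge_of x + ((1 - c) / 2) * gauge_of x" unfolding neg ..
  also have "\<dots> = gauge_of x" by (simp add: field_simps)
  finally show ?thesis .
qed

text \<open>The vector y is turned into x one coordinate at a time, each step shrinking one
  coordinate by the factor x m / y m.\<close>

lemma gauge_of_mono:
  assumes xy: "\<And>i. i < d \<Longrightarrow> 0 \<le> x i" "\<And>i. i < d \<Longrightarrow> x i \<le> y i"
  shows "gauge_of x \<le> gauge_of y"
proof -
  have "gauge_of (\<lambda>i. if i < m then x i else y i) \<le> gauge_of y" if "m \<le> d" for m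
    using that
  proof (induction m)
    case (Suc m)
    let ?f = "\<lambda>i. if i < m then x i else y i"
    \<comment> \<open>If y m = 0 then also x m = 0, and the factor 0 serves.\<close>
    define c where "c = (if y m = 0 then 0 else x m / y m)"
    have m: "0 \<le> x m" "x m \<le> y m" using xy Suc.prems by auto
    then have c: "0 \<le> c" "c \<le> 1" "c * y m = x m" by (auto simp: c_def divide_le_eq_1)
    have "(\<lambda>i. if i < Suc m then x i else y i) = ?f(m := c * ?f m)"
      using c(3) by (auto simp: fun_eq_iff less_Suc_eq)
    then show ?case using gauge_of_shrink[OF c(1,2), of ?f m] Suc by simp
  qed simp
  from this[of d] show ?thesis using gauge_of_cong[of x "\<lambda>i. if i < d then x i else y i"] by simp
qed

text \<open>Expansion in unit vectors. It bounds variations of the gauge by those of the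
  coordinates, whence continuity in \<open>gauge_of_tendsto\<close>.\<close>

lemma gauge_of_le_sum: "gauge_of x \<le> (\<Sum>i<d. \<bar>x i\<bar> * gauge_of (\<lambda>j. if j = i then 1 else 0))"
proof -
  have "gauge_of (\<lambda>j. if j < m then x j else 0) \<le> (\<Sum>i<m. \<bar>x i\<bar> * gauge_of (\<lambda>j. if j = i then 1 else 0))" for m
  proof (induction m)
    case 0
    then show ?case using gauge_of_scale[of 0 "\<lambda>_. 0"] by simp
  next
    case (Suc m)
    have "(\<lambda>j. if j < Suc m then x j else 0) =
       (\<lambda>j. (if j < m then x j else 0) + x m * (if j = m then 1 else 0))"
      by (auto simp: fun_eq_iff less_Suc_eq)
    then have "gauge_of (\<lambda>j. if j < Suc m then x j else 0) \<le> gauge_of (\<lambda>j. if j < m then x j else 0) + \<bar>x m\<bar> * gauge_of (\<lambda>j. if j = m then 1 else 0)"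
      using gauge_of_triangle[of "\<lambda>j. if j < m then x j else 0" "\<lambda>j. x m * (if j = m then 1 else 0)"]
      by (simp add: gauge_of_scale)
    then show ?case using Suc by simp
  qed
  from this[of d] show ?thesis using gauge_of_cong[of x "\<lambda>i. if i < d then x i else 0"] by simp
qed

lemma gauge_of_tendsto:
  assumes lim: "\<And>i. i < d \<Longrightarrow> ((\<lambda>t. x t i) \<longlongrightarrow> l i) F"
  shows "((\<lambda>t. gauge_of (x t)) \<longlongrightarrow> gauge_of l) F"
proof -
  have diff: "\<bar>gauge_of y - gauge_of z\<bar> \<le> gauge_of (\<lambda>i. y i - z i)" for y z
  proof -
    have "gauge_of (\<lambda>i. z i - y i) = gauge_of (\<lambda>i. y i - z i)"
      using gauge_of_scale[of "-1" "\<lambda>i. y i - z i"] by simp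
    then show ?thesis using gauge_of_triangle[of "\<lambda>i. y i - z i" z] gauge_of_triangle[of "\<lambda>i. z i - y i" y] by simp
  qed
  let ?S = "\<lambda>t. \<Sum>i<d. \<bar>x t i - l i\<bar> * gauge_of (\<lambda>j. if j = i then 1 else 0)"
  have "(?S \<longlongrightarrow> (\<Sum>i<d. \<bar>l i - l i\<bar> * gauge_of (\<lambda>j. if j = i then 1 else 0))) F"
    by (intro tendsto_intros lim) auto
  then have "(?S \<longlongrightarrow> 0) F" by simp
  then have "((\<lambda>t. gauge_of (x t) - gauge_of l) \<longlongrightarrow> 0) F"
    by (rule Lim_null_comparison[rotated]) (use diff gauge_of_le_sum order_trans in \<open>fastforce intro!: always_eventually\<close>)
  then show ?thesis by (simp add: LIM_zero_iff)
qed

text \<open>Nonnegativity of \<phi> is what allows monotonicity of the gauge to be applied to the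
  coordinatewise convexity inequality.\<close>

lemma gauge_convex:
  assumes conv: "convex_on UNIV \<phi>" and nn: "\<And>x. \<phi> x \<ge> 0"
  shows "fun_convex (\<lambda>x. gauge_of (\<lambda>i. \<phi> (x i)))"
  unfolding fun_convex_def
proof (intro allI impI)
  fix x y :: "nat \<Rightarrow> real" and \<theta> :: real assume \<theta>: "0 \<le> \<theta>" "\<theta> \<le> 1"
  have "gauge_of (\<lambda>i. \<phi> ((1 - \<theta>) * x i + \<theta> * y i)) \<le> gauge_of (\<lambda>i. (1 - \<theta>) * \<phi> (x i) + \<theta> * \<phi> (y i))"
    using convex_onD[OF conv \<theta>] nn by (intro gauge_of_mono) auto
  also have "\<dots> \<le> gauge_of (\<lambda>i. (1 - \<theta>) * \<phi> (x i)) + gauge_of (\<lambda>i. \<theta> * \<phi> (y i))"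
    by (rule gauge_of_triangle)
  also have "\<dots> = (1 - \<theta>) * gauge_of (\<lambda>i. \<phi> (x i)) + \<theta> * gauge_of (\<lambda>i. \<phi> (y i))"
    using \<theta> by (simp add: gauge_of_scale)
  finally show "gauge_of (\<lambda>i. \<phi> ((1 - \<theta>) * x i + \<theta> * y i)) \<le> (1 - \<theta>) * gauge_of (\<lambda>i. \<phi> (x i)) + \<theta> * gauge_of (\<lambda>i. \<phi> (y i))" .
qed

text \<open>Hoelder's inequality for the gauge: after normalising both arguments to gauge 1 it is the
  convexity of the exponential function.\<close>

lemma gauge_log_convex:
  assumes conv: "convex_on UNIV \<phi>" and d: "d > 0"
  shows "fun_convex (\<lambda>x. ln (gauge_of (\<lambda>i. exp (\<phi> (x i)))))"
  unfolding fun_convex_def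
proof (intro allI impI)
  fix x y :: "nat \<Rightarrow> real" and \<theta> :: real assume \<theta>: "0 \<le> \<theta>" "\<theta> \<le> 1"
  have pos: "gauge_of (\<lambda>i. exp (\<phi> (x i))) > 0" for x by (rule gauge_of_pos[OF d]) simp
  let ?A = "gauge_of (\<lambda>i. exp (\<phi> (x i)))" and ?B = "gauge_of (\<lambda>i. exp (\<phi> (y i)))"
  \<comment> \<open>The weighted geometric mean of the two gauges, that is, the claimed bound before
    taking logarithms.\<close>
  define K where "K = exp ((1 - \<theta>) * ln ?A + \<theta> * ln ?B)"
  have pt: "exp (\<phi> ((1 - \<theta>) * x i + \<theta> * y i)) \<le>
     K * ((1 - \<theta>) / ?A * exp (\<phi> (x i)) + \<theta> / ?B * exp (\<phi> (y i)))" for i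
  proof -
    have "exp (\<phi> ((1 - \<theta>) * x i + \<theta> * y i)) \<le> exp ((1 - \<theta>) * \<phi> (x i) + \<theta> * \<phi> (y i))"
      using convex_onD[OF conv \<theta>] by simp
    also have "\<dots> = K * exp ((1 - \<theta>) * (\<phi> (x i) - ln ?A) + \<theta> * (\<phi> (y i) - ln ?B))"
      by (simp add: K_def algebra_simps flip: exp_add)
    also have "\<dots> \<le> K * ((1 - \<theta>) * exp (\<phi> (x i) - ln ?A) + \<theta> * exp (\<phi> (y i) - ln ?B))"
      using convex_onD[OF exp_convex \<theta>, of "\<phi> (x i) - ln ?A" "\<phi> (y i) - ln ?B"]
      by (intro mult_left_mono) (auto simp: K_def)
    finally show ?thesis using pos[of x] pos[of y] by (simp add: exp_diff)
  qed
  have "gauge_of (\<lambda>i. exp (\<phi> ((1 - \<theta>) * x i + \<theta> * y i))) \<le>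
      gauge_of (\<lambda>i. K * ((1 - \<theta>) / ?A * exp (\<phi> (x i)) + \<theta> / ?B * exp (\<phi> (y i))))"
    by (intro gauge_of_mono pt) auto
  also have "\<dots> = K * gauge_of (\<lambda>i. (1 - \<theta>) / ?A * exp (\<phi> (x i)) + \<theta> / ?B * exp (\<phi> (y i)))"
    unfolding gauge_of_scale by (simp add: K_def)
  also have "\<dots> \<le> K * (gauge_of (\<lambda>i. (1 - \<theta>) / ?A * exp (\<phi> (x i))) + gauge_of (\<lambda>i. \<theta> / ?B * exp (\<phi> (y i))))"
    by (intro mult_left_mono gauge_of_triangle) (simp add: K_def)
  also have "\<dots> = K" unfolding gauge_of_scale using pos[of x] pos[of y] \<theta> by simp
  finally have "ln (gauge_of (\<lambda>i. exp (\<phi> ((1 - \<theta>) * x i + \<theta> * y i)))) \<le> ln K"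
    using pos by (intro ln_mono) (auto simp: K_def)
  then show "ln (gauge_of (\<lambda>i. exp (\<phi> ((1 - \<theta>) * x i + \<theta> * y i)))) \<le> (1 - \<theta>) * ln ?A + \<theta> * ln ?B"
    by (simp add: K_def)
qed

end

section \<open>Spectral calculus of Hermitian tensors\<close>

lemma tidx_Cons: "tidx (m # ms) = (\<lambda>(i, is). i # is) ` ({..<m} \<times> tidx ms)"
proof (intro Set.set_eqI iffI)
  fix x assume "x \<in> tidx (m # ms)"
  then obtain i "is" where x: "x = i # is" and l: "length is = length ms"
    and lt: "\<And>k. k < Suc (length ms) \<Longrightarrow> (i # is) ! k < (m # ms) ! k"
    by (auto simp: tidx_def length_Suc_conv)
  have "i < m" using lt[of 0] by simp
  moreover have "is \<in> tidx ms" using l lt[of "Suc _"] by (auto simp: tidx_def)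
  ultimately show "x \<in> (\<lambda>(i, is). i # is) ` ({..<m} \<times> tidx ms)" using x by auto
next
  fix x assume "x \<in> (\<lambda>(i, is). i # is) ` ({..<m} \<times> tidx ms)"
  then show "x \<in> tidx (m # ms)" by (auto simp: tidx_def nth_Cons split: nat.splits)
qed

lemma finite_tidx: "finite (tidx dims)"
  by (induction dims) (auto simp: tidx_Cons tidx_def[of "[]"])

lemma card_tidx: "card (tidx dims) = tdim dims"
proof (induction dims)
  case (Cons m ms)
  have "inj_on (\<lambda>(i, is). i # is) ({..<m} \<times> tidx ms)" by (auto simp: inj_on_def)
  then show ?case using Cons by (simp add: tidx_Cons card_image tdim_def card_cartesian_product)
qed (simp add: tidx_def tdim_def)

lemma tdim_pos: "\<forall>k<length dims. dims ! k > 0 \<Longrightarrow> tdim dims > 0"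
  unfolding tdim_def by (metis in_set_conv_nth neq0_conv prod_list_zero_iff)

lemma tinner_cnj: "cnj (tinner dims X Y) = tinner dims Y X"
  by (simp add: tinner_def mult.commute)

lemma tinner_sum_right:
  "tinner dims X (\<lambda>i. \<Sum>a\<in>A. c a * Y a i) = (\<Sum>a\<in>A. c a * tinner dims X (Y a))"
  unfolding tinner_def sum_distrib_left by (subst sum.swap) (simp add: mult_ac)

lemma tinner_scale_right: "tinner dims X (\<lambda>i. c * Y i) = c * tinner dims X Y"
  by (simp add: tinner_def sum_distrib_left mult_ac)

lemma tinner_scale_left: "tinner dims (\<lambda>i. c * X i) Y = cnj c * tinner dims X Y"
  by (simp add: tinner_def sum_distrib_left mult_ac)

lemma tinner_self: "tinner dims X X = of_real (\<Sum>i\<in>tidx dims. (norm (X i))^2)"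
  unfolding tinner_def of_real_sum by (intro sum.cong refl) (metis complex_norm_square mult.commute)

lemma sum_delta_mult:
  fixes f :: "'a \<Rightarrow> complex"
  assumes "finite S" "i \<in> S"
  shows "(\<Sum>j\<in>S. (if i = j then 1 else 0) * f j) = f i"
proof -
  have "(\<Sum>j\<in>S. (if i = j then 1 else 0) * f j) = (\<Sum>j\<in>S. if i = j then f j else 0)"
    by (intro sum.cong) auto
  then show ?thesis using assms by simp
qed

definition tapp :: "nat list \<Rightarrow> tensor \<Rightarrow> otensor \<Rightarrow> otensor" where
  "tapp dims A X = (\<lambda>i. if i \<in> tidx dims then \<Sum>j\<in>tidx dims. A i j * X j else 0)"

lemma is_otensor_tapp: "is_otensor dims (tapp dims A X)"
  by (simp add: is_otensor_def tapp_def)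

lemma tapp_einstein: "tapp dims (einstein dims A B) X = tapp dims A (tapp dims B X)"
proof
  fix i
  have "(\<Sum>k\<in>tidx dims. (\<Sum>j\<in>tidx dims. A i j * B j k) * X k) =
      (\<Sum>j\<in>tidx dims. A i j * (\<Sum>k\<in>tidx dims. B j k * X k))"
    unfolding sum_distrib_left sum_distrib_right by (subst sum.swap) (simp add: mult_ac)
  then show "tapp dims (einstein dims A B) X i = tapp dims A (tapp dims B X) i"
    by (simp add: tapp_def einstein_def)
qed

lemma tinner_tapp: "tinner dims X (tapp dims A Y) = tinner dims (tapp dims (tct A) X) Y"
proof -
  have "(\<Sum>i\<in>tidx dims. cnj (X i) * (\<Sum>j\<in>tidx dims. A i j * Y j)) =
     (\<Sum>j\<in>tidx dims. (\<Sum>i\<in>tidx dims. A i j * cnj (X i)) * Y j)"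
    unfolding sum_distrib_left sum_distrib_right by (subst sum.swap) (simp add: mult_ac)
  then show ?thesis by (simp add: tinner_def tapp_def tct_def)
qed

lemma tapp_sum: "tapp dims A (\<lambda>i. \<Sum>a\<in>T. c a * Y a i) = (\<lambda>i. \<Sum>a\<in>T. c a * tapp dims A (Y a) i)"
proof
  fix i
  have "(\<Sum>j\<in>tidx dims. A i j * (\<Sum>a\<in>T. c a * Y a j)) = (\<Sum>a\<in>T. c a * (\<Sum>j\<in>tidx dims. A i j * Y a j))"
    unfolding sum_distrib_left by (subst sum.swap) (simp add: mult_ac)
  then show "tapp dims A (\<lambda>i. \<Sum>a\<in>T. c a * Y a i) i = (\<Sum>a\<in>T. c a * tapp dims A (Y a) i)"
    by (simp add: tapp_def)
qed

lemma tapp_scale: "tapp dims A (\<lambda>i. c * Y i) = (\<lambda>i. c * tapp dims A Y i)"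
  by (auto simp: tapp_def fun_eq_iff sum_distrib_left mult_ac)

lemma tct_tct [simp]: "tct (tct A) = A"
  by (simp add: tct_def)

lemma is_tensor_einstein: "is_tensor dims (einstein dims A B)"
  by (auto simp: is_tensor_def einstein_def)

lemma is_tensor_tid: "is_tensor dims (tid dims)"
  by (auto simp: is_tensor_def tid_def)

lemma tct_einstein: "tct (einstein dims A B) = einstein dims (tct B) (tct A)"
  by (auto simp: tct_def einstein_def fun_eq_iff mult.commute)

lemma tapp_tid: "is_otensor dims X \<Longrightarrow> tapp dims (tid dims) X = X"
  by (auto simp: tapp_def tid_def is_otensor_def fun_eq_iff sum_delta_mult finite_tidx)

section \<open>Orthonormal systems and diagonal tensors\<close>

definition ortho :: "nat list \<Rightarrow> nat \<Rightarrow> (nat \<Rightarrow> otensor) \<Rightarrow> bool" where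
  "ortho dims k U \<longleftrightarrow> (\<forall>a<k. is_otensor dims (U a)) \<and>
     (\<forall>a<k. \<forall>b<k. tinner dims (U a) (U b) = (if a = b then 1 else 0))"

text \<open>Complex coefficients let one calculus cover Hermitian tensors, their functions and their
  complex powers alike.\<close>

definition tdiag :: "nat \<Rightarrow> (nat \<Rightarrow> complex) \<Rightarrow> (nat \<Rightarrow> otensor) \<Rightarrow> tensor" where
  "tdiag k c U = (\<lambda>i j. \<Sum>a<k. c a * touter (U a) (U a) i j)"

lemma herm_dec_iff: "herm_dec dims r H lam U \<longleftrightarrow> ortho dims r U \<and> H = tdiag r (\<lambda>a. of_real (lam a)) U"
  by (auto simp: herm_dec_def ortho_def tdiag_def)

lemma orthoD: "ortho dims k U \<Longrightarrow> a < k \<Longrightarrow> is_otensor dims (U a)"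
  "ortho dims k U \<Longrightarrow> a < k \<Longrightarrow> b < k \<Longrightarrow> tinner dims (U a) (U b) = (if a = b then 1 else 0)"
  by (auto simp: ortho_def)

lemma is_tensor_tdiag: "ortho dims k U \<Longrightarrow> is_tensor dims (tdiag k c U)"
  by (auto simp: is_tensor_def tdiag_def touter_def ortho_def is_otensor_def intro!: sum.neutral)

lemma tct_tdiag: "tct (tdiag k c U) = tdiag k (\<lambda>a. cnj (c a)) U"
  by (simp add: tct_def tdiag_def touter_def mult_ac)

lemma tdiag_cong: "(\<And>a. a < k \<Longrightarrow> c a = c' a) \<Longrightarrow> tdiag k c U = tdiag k c' U"
  unfolding tdiag_def by (intro ext sum.cong) auto

lemma tapp_tdiag:
  assumes "ortho dims k U"
  shows "tapp dims (tdiag k c U) X = (\<lambda>i. \<Sum>a<k. (c a * tinner dims (U a) X) * U a i)"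
proof
  fix i
  show "tapp dims (tdiag k c U) X i = (\<Sum>a<k. (c a * tinner dims (U a) X) * U a i)"
  proof (cases "i \<in> tidx dims")
    case True
    have "(\<Sum>j\<in>tidx dims. (\<Sum>a<k. c a * (U a i * cnj (U a j))) * X j) =
      (\<Sum>a<k. c a * (\<Sum>j\<in>tidx dims. cnj (U a j) * X j) * U a i)"
      unfolding sum_distrib_left sum_distrib_right by (subst sum.swap) (simp add: mult_ac)
    then show ?thesis using True by (simp add: tapp_def tdiag_def touter_def tinner_def)
  next
    case False
    then show ?thesis using assms by (auto simp: tapp_def ortho_def is_otensor_def)
  qed
qed

text \<open>\<open>tdefect\<close> is the orthogonal projection onto the complement of the system; its trace counts the
  missing basis vectors.\<close>

definition tdefect :: "nat \<Rightarrow> (nat \<Rightarrow> otensor) \<Rightarrow> tensor" where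
  "tdefect k U = (\<lambda>i j. (if i = j then 1 else 0) - (\<Sum>a<k. U a i * cnj (U a j)))"

lemma tdefect_cnj: "cnj (tdefect k U i j) = tdefect k U j i"
  by (auto simp: tdefect_def mult.commute)

lemma tdefect_kill:
  assumes "ortho dims k U" "a < k" "j \<in> tidx dims"
  shows "(\<Sum>i\<in>tidx dims. cnj (U a i) * tdefect k U i j) = 0"
proof -
  have "(\<Sum>i\<in>tidx dims. cnj (U a i) * tdefect k U i j) =
     (\<Sum>i\<in>tidx dims. cnj (U a i) * (if i = j then 1 else 0)) - (\<Sum>i\<in>tidx dims. \<Sum>b<k. (cnj (U a i) * U b i) * cnj (U b j))"
    by (simp add: tdefect_def right_diff_distrib sum_subtractf sum_distrib_left mult_ac)
  also have "(\<Sum>i\<in>tidx dims. \<Sum>b<k. (cnj (U a i) * U b i) * cnj (U b j)) = (\<Sum>b<k. tinner dims (U a) (U b) * cnj (U b j))"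
    by (subst sum.swap) (simp add: tinner_def sum_distrib_right)
  also have "\<dots> = (\<Sum>b<k. if b = a then cnj (U a j) else 0)"
    using assms by (intro sum.cong) (auto simp: orthoD)
  also have "\<dots> = cnj (U a j)" using assms by simp
  also have "(\<Sum>i\<in>tidx dims. cnj (U a i) * (if i = j then 1 else 0)) = cnj (U a j)"
    using assms by (simp add: finite_tidx if_distrib cong: if_cong)
  finally show ?thesis by simp
qed

lemma tdefect_idem:
  assumes "ortho dims k U" "i \<in> tidx dims" "l \<in> tidx dims"
  shows "(\<Sum>j\<in>tidx dims. tdefect k U i j * tdefect k U j l) = tdefect k U i l"
proof -
  have "(\<Sum>j\<in>tidx dims. tdefect k U i j * tdefect k U j l) =
     (\<Sum>j\<in>tidx dims. (if i = j then 1 else 0) * tdefect k U j l) -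
     (\<Sum>j\<in>tidx dims. \<Sum>a<k. U a i * (cnj (U a j) * tdefect k U j l))"
  proof -
    have "tdefect k U i j * x = (if i = j then 1 else 0) * x - (\<Sum>a<k. U a i * (cnj (U a j) * x))" for j x
      by (simp add: tdefect_def left_diff_distrib sum_distrib_right mult.assoc)
    then show ?thesis by (simp only: sum_subtractf)
  qed
  also have "(\<Sum>j\<in>tidx dims. \<Sum>a<k. U a i * (cnj (U a j) * tdefect k U j l)) =
     (\<Sum>a<k. U a i * (\<Sum>j\<in>tidx dims. cnj (U a j) * tdefect k U j l))"
    by (subst sum.swap) (simp add: sum_distrib_left)
  also have "\<dots> = 0" using assms by (simp add: tdefect_kill)
  also have "(\<Sum>j\<in>tidx dims. (if i = j then 1 else 0) * tdefect k U j l) = tdefect k U i l"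
    using assms by (simp only: sum_delta_mult finite_tidx)
  finally show ?thesis by simp
qed

lemma tdefect_trace:
  assumes "ortho dims k U"
  shows "(\<Sum>i\<in>tidx dims. tdefect k U i i) = of_nat (tdim dims) - of_nat k"
proof -
  have "(\<Sum>i\<in>tidx dims. tdefect k U i i) = of_nat (card (tidx dims)) - (\<Sum>a<k. tinner dims (U a) (U a))"
    unfolding tdefect_def tinner_def by (simp add: sum_subtractf sum.swap[of _ "{..<k}"] mult.commute)
  also have "(\<Sum>a<k. tinner dims (U a) (U a)) = (\<Sum>a<k. 1)"
    using assms by (intro sum.cong) (auto simp: orthoD)
  finally show ?thesis by (simp add: card_tidx)
qed

text \<open>The squared Hilbert-Schmidt norm of the projection \<open>tdefect\<close> equals its
  trace, which is 0 for a system of \<open>tdim dims\<close> vectors; so its entries on the index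
  set vanish.\<close>

lemma ortho_complete:
  assumes U: "ortho dims (tdim dims) U" and i: "i \<in> tidx dims" and j: "j \<in> tidx dims"
  shows "(\<Sum>a<tdim dims. U a i * cnj (U a j)) = (if i = j then 1 else 0)"
proof -
  let ?Q = "tdefect (tdim dims) U"
  have "of_real (\<Sum>i\<in>tidx dims. \<Sum>j\<in>tidx dims. (norm (?Q i j))^2) = (\<Sum>i\<in>tidx dims. \<Sum>j\<in>tidx dims. ?Q i j * ?Q j i)"
    unfolding of_real_sum by (intro sum.cong refl) (metis complex_norm_square tdefect_cnj)
  also have "\<dots> = (\<Sum>i\<in>tidx dims. ?Q i i)" by (intro sum.cong refl tdefect_idem[OF U])
  also have "\<dots> = 0" by (simp add: tdefect_trace[OF U])
  finally have "(\<Sum>i\<in>tidx dims. \<Sum>j\<in>tidx dims. (norm (?Q i j))^2) = 0" by (simp only: of_real_eq_0_iff)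
  then have "(\<Sum>j\<in>tidx dims. (norm (?Q i j))^2) = 0"
    using i by (subst (asm) sum_nonneg_eq_0_iff) (auto simp: finite_tidx intro: sum_nonneg)
  then have "(norm (?Q i j))^2 = 0"
    using j by (subst (asm) sum_nonneg_eq_0_iff) (auto simp: finite_tidx)
  then show ?thesis by (simp add: tdefect_def)
qed

text \<open>The defect has nonzero trace, hence a nonzero diagonal entry. The column through it is
  orthogonal to the system and has that entry as squared length, so it can be normalised.\<close>

lemma ortho_extend_one:
  assumes U: "ortho dims k U" and k: "k < tdim dims"
  shows "\<exists>w. ortho dims (Suc k) (U(k := w))"
proof -
  let ?Q = "tdefect k U"
  have "(\<Sum>i\<in>tidx dims. ?Q i i) \<noteq> 0" using tdefect_trace[OF U] k
    by (metis eq_iff_diff_eq_0 nat_neq_iff of_nat_eq_iff)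
  then obtain m where m: "m \<in> tidx dims" "?Q m m \<noteq> 0" by (meson sum.neutral)
  define w where "w i = (if i \<in> tidx dims then ?Q i m else 0)" for i
  have ww: "tinner dims w w = ?Q m m"
    unfolding tinner_def using tdefect_idem[OF U m(1) m(1)] by (simp add: w_def tdefect_cnj cong: sum.cong)
  have Uw: "tinner dims (U a) w = 0" if "a < k" for a
    unfolding tinner_def using tdefect_kill[OF U that m(1)] by (simp add: w_def cong: sum.cong)
  define r where "r = (\<Sum>i\<in>tidx dims. (norm (w i))^2)"
  have wr: "tinner dims w w = of_real r" by (simp add: tinner_self r_def)
  then have r: "r > 0" using ww m(2) by (metis less_eq_real_def of_real_0 r_def sum_nonneg zero_le_power2)
  define w' where "w' i = of_real (1 / sqrt r) * w i" for i
  have w'w': "tinner dims w' w' = 1"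
    unfolding w'_def[abs_def] tinner_scale_left tinner_scale_right wr using r
    by (simp flip: of_real_mult of_real_divide add: real_sqrt_mult_self)
  have Uw': "tinner dims (U a) w' = 0" if "a < k" for a
    unfolding w'_def[abs_def] tinner_scale_right using Uw[OF that] by simp
  have w'U: "tinner dims w' (U a) = 0" if "a < k" for a
    using Uw'[OF that] tinner_cnj[of dims "U a" w'] by simp
  have "ortho dims (Suc k) (U(k := w'))"
    using U w'w' Uw' w'U by (auto simp: ortho_def less_Suc_eq is_otensor_def w'_def w_def)
  then show ?thesis by blast
qed

lemma ortho_extend:
  assumes U: "ortho dims k U" and k: "k \<le> tdim dims"
  obtains W where "ortho dims (tdim dims) W" "\<And>a. a < k \<Longrightarrow> W a = U a"
proof -
  have "\<exists>W. ortho dims m W \<and> (\<forall>a<k. W a = U a)" if "k \<le> m" "m \<le> tdim dims" for m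
    using that
  proof (induction m rule: dec_induct)
    case base
    then show ?case using U by blast
  next
    case (step m)
    then obtain W where W: "ortho dims m W" "\<forall>a<k. W a = U a" by auto
    obtain w where "ortho dims (Suc m) (W(m := w))" using ortho_extend_one[OF W(1)] step by auto
    moreover have "\<forall>a<k. (W(m := w)) a = U a" using W(2) step(1) by auto
    ultimately show ?case by blast
  qed
  from this[of "tdim dims"] k that show ?thesis by auto
qed

lemma ortho_expansion:
  assumes U: "ortho dims (tdim dims) U" and X: "is_otensor dims X"
  shows "X = (\<lambda>i. \<Sum>a<tdim dims. tinner dims (U a) X * U a i)"
proof
  fix i
  show "X i = (\<Sum>a<tdim dims. tinner dims (U a) X * U a i)"
  proof (cases "i \<in> tidx dims")
    case True
    have "(\<Sum>a<tdim dims. tinner dims (U a) X * U a i) = (\<Sum>j\<in>tidx dims. (\<Sum>a<tdim dims. U a i * cnj (U a j)) * X j)"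
      unfolding tinner_def sum_distrib_right by (subst sum.swap) (simp add: mult_ac)
    also have "\<dots> = (\<Sum>j\<in>tidx dims. if i = j then X j else 0)"
      using True by (intro sum.cong) (auto simp: ortho_complete[OF U])
    finally show ?thesis using True by (simp add: finite_tidx)
  next
    case False
    then show ?thesis using U X by (auto simp: ortho_def is_otensor_def)
  qed
qed

lemma ortho_parseval:
  assumes U: "ortho dims (tdim dims) U"
  shows "tinner dims X Y = (\<Sum>a<tdim dims. tinner dims X (U a) * tinner dims (U a) Y)"
proof -
  have "(\<Sum>a<tdim dims. tinner dims X (U a) * tinner dims (U a) Y) =
    (\<Sum>a<tdim dims. \<Sum>i\<in>tidx dims. \<Sum>j\<in>tidx dims. cnj (X i) * (U a i * cnj (U a j)) * Y j)"
    unfolding tinner_def sum_product by (simp add: mult_ac)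
  also have "\<dots> = (\<Sum>i\<in>tidx dims. \<Sum>j\<in>tidx dims. cnj (X i) * (\<Sum>a<tdim dims. U a i * cnj (U a j)) * Y j)"
    unfolding sum_distrib_left sum_distrib_right
    by (subst sum.swap, intro sum.cong refl, subst sum.swap, rule refl)
  also have "\<dots> = (\<Sum>i\<in>tidx dims. \<Sum>j\<in>tidx dims. if i = j then cnj (X i) * Y j else 0)"
    by (intro sum.cong refl) (simp add: ortho_complete[OF U])
  also have "\<dots> = tinner dims X Y" by (simp add: tinner_def finite_tidx)
  finally show ?thesis ..
qed

text \<open>A tensor is determined by its action on an orthonormal basis. Identities between
  functions of tensors are reduced to this test on eigenvectors.\<close>

lemma tensor_eq_tdiag:
  assumes U: "ortho dims (tdim dims) U" and H: "is_tensor dims H"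
    and eig: "\<And>a. a < tdim dims \<Longrightarrow> tapp dims H (U a) = (\<lambda>i. c a * U a i)"
  shows "H = tdiag (tdim dims) c U"
proof (intro ext)
  fix i j
  show "H i j = tdiag (tdim dims) c U i j"
  proof (cases "i \<in> tidx dims \<and> j \<in> tidx dims")
    case True
    have "H i j = (\<Sum>l\<in>tidx dims. H i l * (if l = j then 1 else 0))"
      using True by (simp add: finite_tidx if_distrib cong: if_cong)
    also have "\<dots> = (\<Sum>l\<in>tidx dims. H i l * (\<Sum>a<tdim dims. U a l * cnj (U a j)))"
      using True by (intro sum.cong refl) (simp add: ortho_complete[OF U])
    also have "\<dots> = (\<Sum>a<tdim dims. (\<Sum>l\<in>tidx dims. H i l * U a l) * cnj (U a j))"
      unfolding sum_distrib_left sum_distrib_right by (subst sum.swap) (simp add: mult_ac)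
    also have "\<dots> = (\<Sum>a<tdim dims. tapp dims H (U a) i * cnj (U a j))"
      using True by (simp add: tapp_def)
    also have "\<dots> = tdiag (tdim dims) c U i j"
      unfolding tdiag_def touter_def by (intro sum.cong refl) (simp add: eig)
    finally show ?thesis .
  next
    case False
    then show ?thesis using H is_tensor_tdiag[OF U, of c] by (auto simp: is_tensor_def)
  qed
qed

lemma tapp_tdiag_eigen:
  assumes U: "ortho dims k U" and a: "a < k"
  shows "tapp dims (tdiag k c U) (U a) = (\<lambda>i. c a * U a i)"
proof
  fix i
  have "tapp dims (tdiag k c U) (U a) i = (\<Sum>b<k. if b = a then c a * U a i else 0)"
    unfolding tapp_tdiag[OF U] using a by (intro sum.cong refl) (auto simp: orthoD[OF U])
  then show "tapp dims (tdiag k c U) (U a) i = c a * U a i" using a by simp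
qed

lemma einstein_tdiag:
  assumes U: "ortho dims (tdim dims) U"
  shows "einstein dims (tdiag (tdim dims) c U) (tdiag (tdim dims) c' U) = tdiag (tdim dims) (\<lambda>a. c a * c' a) U"
  by (rule tensor_eq_tdiag[OF U is_tensor_einstein])
     (simp add: tapp_einstein tapp_tdiag_eigen[OF U] tapp_scale fun_eq_iff mult_ac)

lemma tid_eq_tdiag:
  assumes U: "ortho dims (tdim dims) U"
  shows "tid dims = tdiag (tdim dims) (\<lambda>_. 1) U"
  by (rule tensor_eq_tdiag[OF U is_tensor_tid]) (simp add: tapp_tid orthoD[OF U])

lemma trace_tdiag:
  assumes U: "ortho dims k U"
  shows "(\<Sum>i\<in>tidx dims. tdiag k c U i i) = (\<Sum>a<k. c a)"
proof -
  have "(\<Sum>i\<in>tidx dims. tdiag k c U i i) = (\<Sum>a<k. c a * tinner dims (U a) (U a))"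
    unfolding tdiag_def touter_def tinner_def sum_distrib_left by (subst sum.swap) (simp add: mult_ac)
  then show ?thesis by (simp add: orthoD[OF U])
qed

lemma complex_matrix_eigenvector:
  fixes M :: "nat \<Rightarrow> nat \<Rightarrow> complex"
  assumes "m > 0"
  shows "\<exists>y \<mu>. (\<exists>b<m. y b \<noteq> 0) \<and> (\<forall>a<m. (\<Sum>b<m. M a b * y b) = \<mu> * y a)"
proof -
  let ?A = "Matrix.mat m m (\<lambda>(a,b). M a b)"
  have A: "?A \<in> carrier_mat m m" by simp
  obtain \<mu> where "eigenvalue ?A \<mu>" using spectrum_non_empty[OF A assms] by (auto simp: spectrum_def)
  then obtain v where v: "v \<in> carrier_vec m" "v \<noteq> 0\<^sub>v m" "?A *\<^sub>v v = \<mu> \<cdot>\<^sub>v v"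
    by (auto simp: eigenvalue_def eigenvector_def)
  have "\<exists>b<m. vec_index v b \<noteq> 0"
  proof (rule ccontr)
    assume "\<not> ?thesis"
    then have "v = 0\<^sub>v m" using v(1) by (intro eq_vecI) auto
    then show False using v(2) by simp
  qed
  moreover have "(\<Sum>b<m. M a b * vec_index v b) = \<mu> * vec_index v a" if "a < m" for a
  proof -
    have "vec_index (?A *\<^sub>v v) a = (\<Sum>b<m. M a b * vec_index v b)"
      using that v(1) by (simp add: scalar_prod_def lessThan_atLeast0)
    then show ?thesis using v that by simp
  qed
  ultimately show ?thesis by blast
qed

lemma hermitian_tapp_inner:
  "hermitian dims H \<Longrightarrow> tinner dims X (tapp dims H Y) = tinner dims (tapp dims H X) Y"
  by (simp add: tinner_tapp hermitian_def)

text \<open>One more eigenvector: an eigenvector of the compression of \<open>H\<close> to the orthogonal complement of the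
  eigenvectors already found.\<close>

lemma hermitian_eigen_step:
  assumes H: "hermitian dims H" and U: "ortho dims k U" and k: "k < tdim dims"
    and eig: "\<And>a. a < k \<Longrightarrow> tapp dims H (U a) = (\<lambda>i. of_real (lam a) * U a i)"
  shows "\<exists>w l. ortho dims (Suc k) (U(k := w)) \<and> tapp dims H w = (\<lambda>i. of_real l * w i)"
proof -
  let ?d = "tdim dims"
  obtain W where W: "ortho dims ?d W" and WU: "\<And>a. a < k \<Longrightarrow> W a = U a"
    using ortho_extend[OF U less_imp_le[OF k]] by blast
  define m where "m = ?d - k"
  have m: "m > 0" "k + m = ?d" using k by (auto simp: m_def)
  obtain y \<mu> where y: "\<exists>b<m. y b \<noteq> 0"
    and ym: "\<And>a. a < m \<Longrightarrow> (\<Sum>b<m. tinner dims (W (k + a)) (tapp dims H (W (k + b))) * y b) = \<mu> * y a"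
    using complex_matrix_eigenvector[OF m(1), of "\<lambda>a b. tinner dims (W (k + a)) (tapp dims H (W (k + b)))"] by blast
  define v where "v i = (\<Sum>b<m. y b * W (k + b) i)" for i
  have v_ot: "is_otensor dims v"
    using W m by (auto simp: v_def is_otensor_def ortho_def intro!: sum.neutral)
  have Wv: "tinner dims (W c) v = (if c < k then 0 else y (c - k))" if "c < ?d" for c
  proof -
    have "tinner dims (W c) v = (\<Sum>b<m. y b * (if c = k + b then 1 else 0))"
      unfolding v_def[abs_def] tinner_sum_right using that m by (intro sum.cong refl) (simp add: orthoD[OF W])
    also have "\<dots> = (\<Sum>b<m. if b = c - k \<and> k \<le> c then y b else 0)" by (intro sum.cong refl) auto
    also have "\<dots> = (if c < k then 0 else y (c - k))" using that m by auto
    finally show ?thesis .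
  qed
  \<comment> \<open>Hermitian symmetry keeps the image of v orthogonal to the eigenvectors already
    found, so the eigenvector of the compression is one of \<open>H\<close> itself.\<close>
  have Hv: "tinner dims (W c) (tapp dims H v) = \<mu> * tinner dims (W c) v" if "c < ?d" for c
  proof (cases "c < k")
    case True
    have "tinner dims (W c) (tapp dims H v) = tinner dims (tapp dims H (W c)) v"
      by (rule hermitian_tapp_inner[OF H])
    also have "\<dots> = of_real (lam c) * tinner dims (W c) v"
      unfolding WU[OF True] eig[OF True] tinner_scale_left by simp
    finally show ?thesis using Wv[OF that] True by simp
  next
    case False
    define a where "a = c - k"
    have a: "c = k + a" "a < m" using False that m by (auto simp: a_def)
    have "tinner dims (W c) (tapp dims H v) = (\<Sum>b<m. y b * tinner dims (W c) (tapp dims H (W (k + b))))"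
      unfolding v_def[abs_def] tapp_sum tinner_sum_right ..
    also have "\<dots> = \<mu> * y a" using ym[OF a(2)] a(1) by (simp add: mult.commute)
    finally show ?thesis using Wv[OF that] a by simp
  qed
  have "tapp dims H v = (\<lambda>i. \<Sum>c<?d. tinner dims (W c) (tapp dims H v) * W c i)"
    by (rule ortho_expansion[OF W is_otensor_tapp])
  also have "\<dots> = (\<lambda>i. \<mu> * (\<Sum>c<?d. tinner dims (W c) v * W c i))"
    unfolding sum_distrib_left by (intro ext sum.cong refl) (simp add: Hv)
  also have "\<dots> = (\<lambda>i. \<mu> * v i)" using ortho_expansion[OF W v_ot] by (metis (no_types, lifting))
  finally have Hv': "tapp dims H v = (\<lambda>i. \<mu> * v i)" .
  have vU: "tinner dims (U a) v = 0" if "a < k" for a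
    using Wv[of a] WU[OF that] that k by simp
  define r where "r = (\<Sum>i\<in>tidx dims. (norm (v i))^2)"
  have vr: "tinner dims v v = of_real r" by (simp add: tinner_self r_def)
  have "r \<noteq> 0"
  proof
    assume "r = 0"
    then have "\<forall>i\<in>tidx dims. (norm (v i))^2 = 0"
      unfolding r_def by (subst (asm) sum_nonneg_eq_0_iff) (auto simp: finite_tidx)
    then have "tinner dims (W c) v = 0" for c by (simp add: tinner_def)
    moreover obtain b where "b < m" "y b \<noteq> 0" using y by blast
    ultimately show False using Wv[of "k + b"] m by simp
  qed
  moreover have "r \<ge> 0" unfolding r_def by (intro sum_nonneg) auto
  ultimately have r: "r > 0" by simp
  have "\<mu> * tinner dims v v = cnj \<mu> * tinner dims v v"
    using hermitian_tapp_inner[OF H, of v v] unfolding Hv' tinner_scale_right tinner_scale_left .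
  then have "\<mu> = cnj \<mu>" using vr r by simp
  then obtain l where l: "\<mu> = of_real l" by (metis Reals_cases Reals_cnj_iff)
  define w where "w i = of_real (1 / sqrt r) * v i" for i
  have ww: "tinner dims w w = 1"
    unfolding w_def[abs_def] tinner_scale_left tinner_scale_right vr using r
    by (simp flip: of_real_mult of_real_divide)
  have Uw: "tinner dims (U a) w = 0" if "a < k" for a
    unfolding w_def[abs_def] tinner_scale_right using vU[OF that] by simp
  have wU: "tinner dims w (U a) = 0" if "a < k" for a
    using Uw[OF that] tinner_cnj[of dims "U a" w] by simp
  have "is_otensor dims w" using v_ot by (simp add: is_otensor_def w_def)
  then have "ortho dims (Suc k) (U(k := w))"
    using U ww Uw wU by (auto simp: ortho_def less_Suc_eq)
  moreover have "tapp dims H w = (\<lambda>i. of_real l * w i)"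
    unfolding w_def[abs_def] tapp_scale Hv' l by (simp add: fun_eq_iff)
  ultimately show ?thesis by blast
qed

text \<open>\<open>heig\<close> is a choice, so its properties rest on the existence of a full
  decomposition. The sum of the logarithms and the Gram tensors do not come with one.\<close>

theorem hermitian_spectral:
  assumes H: "hermitian dims H"
  shows "\<exists>lam U. herm_dec dims (tdim dims) H lam U"
proof -
  have "\<exists>U lam. ortho dims k U \<and> (\<forall>a<k. tapp dims H (U a) = (\<lambda>i. of_real (lam a) * U a i))"
    if "k \<le> tdim dims" for k
    using that
  proof (induction k)
    case 0
    show ?case by (simp add: ortho_def)
  next
    case (Suc k)
    then obtain U lam where U: "ortho dims k U" and
      e: "\<forall>a<k. tapp dims H (U a) = (\<lambda>i. of_real (lam a) * U a i)" by auto
    have k: "k < tdim dims" using Suc.prems by simp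
    obtain w l where w: "ortho dims (Suc k) (U(k := w))" "tapp dims H w = (\<lambda>i. of_real l * w i)"
      using hermitian_eigen_step[OF H U k, of lam] e by blast
    have "\<forall>a<Suc k. tapp dims H ((U(k := w)) a) = (\<lambda>i. of_real ((lam(k := l)) a) * (U(k := w)) a i)"
      using e w(2) by (auto simp: less_Suc_eq)
    then show ?case using w(1) by blast
  qed
  then obtain U lam where U: "ortho dims (tdim dims) U"
    and e: "\<And>a. a < tdim dims \<Longrightarrow> tapp dims H (U a) = (\<lambda>i. of_real (lam a) * U a i)" by blast
  have "is_tensor dims H" using H by (simp add: hermitian_def)
  then have "H = tdiag (tdim dims) (\<lambda>a. of_real (lam a)) U" by (intro tensor_eq_tdiag[OF U] e)
  then show ?thesis using U by (auto simp: herm_dec_iff)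
qed

lemma herm_dec_hermitian: "herm_dec dims (tdim dims) H lam U \<Longrightarrow> hermitian dims H"
  by (auto simp: herm_dec_iff hermitian_def is_tensor_tdiag tct_tdiag)

lemma heig_dec:
  assumes "herm_dec dims (tdim dims) H lam U"
  shows "herm_dec dims (tdim dims) H (fst (heig dims H)) (snd (heig dims H))"
  unfolding heig_def by (rule someI[of _ "(lam, U)"]) (use assms in simp)

text \<open>Eigenvectors with different eigenvalues are orthogonal, so V b can have a nonzero
  product with U a only if mu b = lam a; both sides then act alike on U a. This frees
  \<open>tfun\<close> and \<open>tpow\<close> from the basis picked by \<open>heig\<close>.\<close>

lemma spectral_calculus_unique:
  fixes F :: "real \<Rightarrow> complex"
  assumes 1: "herm_dec dims (tdim dims) H lam U" and 2: "herm_dec dims (tdim dims) H mu V"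
  shows "tdiag (tdim dims) (\<lambda>a. F (mu a)) V = tdiag (tdim dims) (\<lambda>a. F (lam a)) U"
proof (rule tensor_eq_tdiag)
  let ?d = "tdim dims"
  show U: "ortho dims ?d U" using 1 by (simp add: herm_dec_iff)
  have V: "ortho dims ?d V" using 2 by (simp add: herm_dec_iff)
  have HU: "H = tdiag ?d (\<lambda>a. of_real (lam a)) U" using 1 by (simp add: herm_dec_iff)
  have HV: "H = tdiag ?d (\<lambda>a. of_real (mu a)) V" using 2 by (simp add: herm_dec_iff)
  show "is_tensor dims (tdiag ?d (\<lambda>a. F (mu a)) V)" by (rule is_tensor_tdiag[OF V])
  fix a assume a: "a < ?d"
  have eU: "tapp dims H (U a) = (\<lambda>i. of_real (lam a) * U a i)"
    unfolding HU by (rule tapp_tdiag_eigen[OF U a])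
  have ort: "F (mu b) * tinner dims (V b) (U a) = F (lam a) * tinner dims (V b) (U a)" if b: "b < ?d" for b
  proof -
    have eV: "tapp dims H (V b) = (\<lambda>i. of_real (mu b) * V b i)"
      unfolding HV by (rule tapp_tdiag_eigen[OF V b])
    have "of_real (lam a) * tinner dims (V b) (U a) = of_real (mu b) * tinner dims (V b) (U a)"
      using hermitian_tapp_inner[OF herm_dec_hermitian[OF 1], of "V b" "U a"]
      unfolding eU eV tinner_scale_right tinner_scale_left by simp
    then have "lam a = mu b \<or> tinner dims (V b) (U a) = 0" by auto
    then show ?thesis by auto
  qed
  have "tapp dims (tdiag ?d (\<lambda>a. F (mu a)) V) (U a) = (\<lambda>i. \<Sum>b<?d. (F (lam a) * tinner dims (V b) (U a)) * V b i)"
    unfolding tapp_tdiag[OF V] by (intro ext sum.cong refl) (simp add: ort)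
  also have "\<dots> = (\<lambda>i. F (lam a) * (\<Sum>b<?d. tinner dims (V b) (U a) * V b i))"
    by (simp add: sum_distrib_left mult.assoc)
  also have "\<dots> = (\<lambda>i. F (lam a) * U a i)"
    using ortho_expansion[OF V orthoD(1)[OF U a]] by (metis (no_types, lifting))
  finally show "tapp dims (tdiag ?d (\<lambda>a. F (mu a)) V) (U a) = (\<lambda>i. F (lam a) * U a i)" .
qed

lemma tfun_eq:
  assumes "herm_dec dims (tdim dims) H lam U"
  shows "tfun dims f H = tdiag (tdim dims) (\<lambda>a. of_real (f (lam a))) U"
  using spectral_calculus_unique[OF assms heig_dec[OF assms], of "\<lambda>x. of_real (f x)"]
  by (simp add: tfun_def tdiag_def)

lemma tpow_eq:
  assumes "herm_dec dims (tdim dims) H lam U"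
  shows "tpow dims H z = tdiag (tdim dims) (\<lambda>a. exp (z * of_real (ln (lam a)))) U"
  using spectral_calculus_unique[OF assms heig_dec[OF assms], of "\<lambda>x. exp (z * of_real (ln x))"]
  by (simp add: tpow_def tdiag_def)

lemma tfun_dec:
  assumes "herm_dec dims (tdim dims) H lam U"
  shows "herm_dec dims (tdim dims) (tfun dims f H) (\<lambda>a. f (lam a)) U"
  using assms by (simp add: tfun_eq[OF assms]) (simp add: herm_dec_iff)

text \<open>For the indicator function of x the spectral calculus yields the eigenprojection, whose
  trace is the multiplicity of x.\<close>

lemma spectrum_unique:
  assumes 1: "herm_dec dims (tdim dims) H lam U" and 2: "herm_dec dims (tdim dims) H mu V"
  shows "mset (map lam [0..<tdim dims]) = mset (map mu [0..<tdim dims])"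
proof (rule multiset_eqI)
  fix x
  let ?d = "tdim dims"
  have U: "ortho dims ?d U" and V: "ortho dims ?d V" using 1 2 by (auto simp: herm_dec_iff)
  have "(\<Sum>a<?d. if lam a = x then 1 else 0 :: complex) = (\<Sum>a<?d. if mu a = x then 1 else 0)"
    using arg_cong[OF spectral_calculus_unique[OF 1 2, of "\<lambda>y. if y = x then 1 else 0"],
        of "\<lambda>T. \<Sum>i\<in>tidx dims. T i i"]
    unfolding trace_tdiag[OF U] trace_tdiag[OF V] by (rule sym)
  then have "of_nat (\<Sum>a<?d. if lam a = x then 1 else 0) = (of_nat (\<Sum>a<?d. if mu a = x then 1 else 0) :: complex)"
    by (simp add: if_distrib cong: if_cong)
  then have e: "(\<Sum>a<?d. if lam a = x then 1 else 0 :: nat) = (\<Sum>a<?d. if mu a = x then 1 else 0)"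
    by (simp only: of_nat_eq_iff)
  have c: "count (mset (map f [0..<n])) x = (\<Sum>a<n. if f a = x then 1 else 0)" for f :: "nat \<Rightarrow> real" and n
    by (induction n) auto
  show "count (mset (map lam [0..<?d])) x = count (mset (map mu [0..<?d])) x"
    unfolding c by (rule e)
qed

lemma heigvals_eq:
  assumes "herm_dec dims (tdim dims) H lam U"
  shows "heigvals dims H = rev (sort (map lam [0..<tdim dims]))"
proof -
  have "mset (map (fst (heig dims H)) [0..<tdim dims]) = mset (map lam [0..<tdim dims])"
    by (rule spectrum_unique[OF heig_dec[OF assms] assms])
  then have "sort (map (fst (heig dims H)) [0..<tdim dims]) = sort (map lam [0..<tdim dims])"
    by (metis sorted_list_of_multiset_mset)
  then show ?thesis by (simp add: heigvals_def)
qed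

lemma ortho_permute:
  assumes U: "ortho dims k U" and p: "inj_on p {..<m}" "p ` {..<m} \<subseteq> {..<k}"
  shows "ortho dims m (\<lambda>a. U (p a))"
  using U p unfolding ortho_def inj_on_def by (fastforce simp: image_subset_iff)

lemma heigvals_dec:
  assumes H: "hermitian dims H"
  obtains U where "herm_dec dims (tdim dims) H (\<lambda>j. heigvals dims H ! j) U"
proof -
  let ?d = "tdim dims"
  obtain lam U where dec: "herm_dec dims ?d H lam U" using hermitian_spectral[OF H] by blast
  obtain \<pi> where \<pi>: "\<pi> permutes {..<?d}" "\<And>j. j < ?d \<Longrightarrow> lam (\<pi> j) = rev (sort (map lam [0..<?d])) ! j"
    by (rule sorting_permutation[of ?d lam]) blast
  have U: "ortho dims ?d U" using dec by (simp add: herm_dec_iff)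
  have "tdiag ?d (\<lambda>a. of_real (lam a)) U = tdiag ?d (\<lambda>a. of_real (lam (\<pi> a))) (\<lambda>a. U (\<pi> a))"
    unfolding tdiag_def by (intro ext) (rule sum.permute[OF \<pi>(1), unfolded comp_def])
  also have "\<dots> = tdiag ?d (\<lambda>j. of_real (heigvals dims H ! j)) (\<lambda>a. U (\<pi> a))"
    using \<pi>(2) by (intro tdiag_cong) (simp add: heigvals_eq[OF dec])
  finally have "H = tdiag ?d (\<lambda>j. of_real (heigvals dims H ! j)) (\<lambda>a. U (\<pi> a))"
    using dec by (simp add: herm_dec_iff)
  moreover have "ortho dims ?d (\<lambda>a. U (\<pi> a))"
    using permutes_inj_on[OF \<pi>(1)] permutes_image[OF \<pi>(1)] by (intro ortho_permute[OF U]) auto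
  ultimately show ?thesis using that by (auto simp: herm_dec_iff)
qed

lemma heigvals_decreasing: "i < j \<Longrightarrow> j < tdim dims \<Longrightarrow> heigvals dims H ! j \<le> heigvals dims H ! i"
  using sorted_nth_mono[of "sort (map (fst (heig dims H)) [0..<tdim dims])" "tdim dims - Suc j" "tdim dims - Suc i"]
  by (simp add: heigvals_def rev_nth)

lemma hermitian_gram: "is_tensor dims A \<Longrightarrow> hermitian dims (einstein dims (tct A) A)"
  by (simp add: hermitian_def is_tensor_einstein tct_einstein)

lemma tabs_dec:
  assumes "herm_dec dims (tdim dims) (einstein dims (tct A) A) lam U"
  shows "herm_dec dims (tdim dims) (tabs dims A) (\<lambda>a. sqrt (lam a)) U"
  unfolding tabs_def by (rule tfun_dec[OF assms])

text \<open>Since \<open>unorm\<close> takes the absolute value first, a nonnegative function of a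
  tensor has to be recognised as its own absolute value.\<close>

lemma tabs_nonneg:
  assumes dec: "herm_dec dims (tdim dims) H lam U" and nn: "\<And>a. a < tdim dims \<Longrightarrow> lam a \<ge> 0"
  shows "herm_dec dims (tdim dims) (tabs dims H) lam U"
proof -
  have U: "ortho dims (tdim dims) U" using dec by (simp add: herm_dec_iff)
  have H: "H = tdiag (tdim dims) (\<lambda>a. of_real (lam a)) U" using dec by (simp add: herm_dec_iff)
  have "einstein dims (tct H) H = tdiag (tdim dims) (\<lambda>a. of_real ((lam a)^2)) U"
    unfolding H tct_tdiag by (simp add: einstein_tdiag[OF U] power2_eq_square)
  then have "herm_dec dims (tdim dims) (einstein dims (tct H) H) (\<lambda>a. (lam a)^2) U"
    using U by (simp add: herm_dec_iff)
  from tabs_dec[OF this] show ?thesis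
    unfolding herm_dec_iff using nn tdiag_cong[of "tdim dims" "\<lambda>a. of_real (sqrt ((lam a)^2))" "\<lambda>a. of_real (lam a)" U]
    by simp
qed

lemma unorm_eq:
  assumes sg: "sym_gauge (tdim dims) \<rho>"
    and dec: "herm_dec dims (tdim dims) H lam U" and nn: "\<And>a. a < tdim dims \<Longrightarrow> lam a \<ge> 0"
  shows "unorm dims \<rho> H = symmetric_gauge.gauge_of (tdim dims) \<rho> lam"
proof -
  let ?d = "tdim dims"
  interpret symmetric_gauge ?d \<rho> by unfold_locales (rule sg)
  have hv: "heigvals dims (tabs dims H) = rev (sort (map lam [0..<?d]))"
    by (rule heigvals_eq[OF tabs_nonneg[OF dec nn]])
  obtain \<pi> where \<pi>: "\<pi> permutes {..<?d}" "\<And>j. j < ?d \<Longrightarrow> lam (\<pi> j) = rev (sort (map lam [0..<?d])) ! j"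
    by (rule sorting_permutation[of ?d lam]) blast
  have "rev (sort (map lam [0..<?d])) = map (\<lambda>j. lam (\<pi> j)) [0..<?d]"
    using \<pi>(2) by (intro nth_equalityI) auto
  then show ?thesis using gauge_of_permute[OF \<pi>(1), of lam] by (simp add: unorm_def hv gauge_of_def)
qed

section \<open>Singular values\<close>

lemma tinner_parseval_norm:
  assumes W: "ortho dims (tdim dims) W"
  shows "tinner dims X X = of_real (\<Sum>a<tdim dims. (norm (tinner dims (W a) X))^2)"
  unfolding ortho_parseval[OF W, of X X] of_real_sum
  by (intro sum.cong refl) (metis complex_norm_square mult.commute tinner_cnj)

lemma bessel_inequality:
  assumes x: "ortho dims k x" and k: "k \<le> tdim dims" and v: "tinner dims v v = 1"
  shows "(\<Sum>a<k. (norm (tinner dims v (x a)))^2) \<le> 1"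
proof -
  obtain W where W: "ortho dims (tdim dims) W" "\<And>a. a < k \<Longrightarrow> W a = x a"
    using ortho_extend[OF x k] by blast
  have "(\<Sum>a<k. (norm (tinner dims v (x a)))^2) = (\<Sum>a<k. (norm (tinner dims (W a) v))^2)"
    by (intro sum.cong refl) (metis W(2) complex_mod_cnj lessThan_iff tinner_cnj)
  also have "\<dots> \<le> (\<Sum>a<tdim dims. (norm (tinner dims (W a) v))^2)"
    using k by (intro sum_mono2) auto
  also have "complex_of_real (\<Sum>a<tdim dims. (norm (tinner dims (W a) v))^2) = 1"
    using tinner_parseval_norm[OF W(1), of v] v by simp
  then have "(\<Sum>a<tdim dims. (norm (tinner dims (W a) v))^2) = 1"
    by (simp only: of_real_eq_1_iff)
  finally show ?thesis by simp
qed

lemma herm_dec_eigen: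
  assumes "herm_dec dims k H lam U" "a < k"
  shows "tapp dims H (U a) = (\<lambda>i. of_real (lam a) * U a i)"
  using assms tapp_tdiag_eigen[of dims k U a "\<lambda>a. of_real (lam a)"] by (simp add: herm_dec_iff)

section \<open>Variational bounds and continuity of eigenvalues\<close>

text \<open>The quadratic form is a sum of the mu j with weights w j that measure how much of V j
  lies in the span of x. Bessel gives w j <= 1 and Parseval gives total weight k.\<close>

lemma ky_fan:
  assumes dec: "herm_dec dims (tdim dims) Y mu V"
    and dcr: "\<And>i j. i < j \<Longrightarrow> j < tdim dims \<Longrightarrow> mu j \<le> mu i"
    and x: "ortho dims k x" and k: "k \<le> tdim dims"
  shows "Re (\<Sum>a<k. tinner dims (x a) (tapp dims Y (x a))) \<le> (\<Sum>j<k. mu j)"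
proof -
  let ?d = "tdim dims"
  have V: "ortho dims ?d V" and Y: "Y = tdiag ?d (\<lambda>a. of_real (mu a)) V" using dec by (auto simp: herm_dec_iff)
  define w where "w j = (\<Sum>a<k. (norm (tinner dims (V j) (x a)))^2)" for j
  have quad: "tinner dims (x a) (tapp dims Y (x a)) = of_real (\<Sum>j<?d. mu j * (norm (tinner dims (V j) (x a)))^2)" for a
  proof -
    have "tinner dims (x a) (tapp dims Y (x a)) = (\<Sum>j<?d. (of_real (mu j) * tinner dims (V j) (x a)) * tinner dims (x a) (V j))"
      unfolding Y tapp_tdiag[OF V] tinner_sum_right ..
    also have "\<dots> = (\<Sum>j<?d. of_real (mu j * (norm (tinner dims (V j) (x a)))^2))"
      by (intro sum.cong refl) (simp add: complex_norm_square mult.assoc tinner_cnj flip: of_real_power)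
    finally show ?thesis by simp
  qed
  have "Re (\<Sum>a<k. tinner dims (x a) (tapp dims Y (x a))) = (\<Sum>a<k. \<Sum>j<?d. mu j * (norm (tinner dims (V j) (x a)))^2)"
    unfolding quad by simp
  also have "\<dots> = (\<Sum>j<?d. mu j * w j)"
    unfolding w_def sum_distrib_left by (rule sum.swap)
  also have "\<dots> \<le> (\<Sum>j<k. mu j)"
  proof (rule weighted_sum_le_top_sum[OF dcr])
    show "0 \<le> w j" for j by (auto simp: w_def intro: sum_nonneg)
    show "w j \<le> 1" if "j < ?d" for j
      unfolding w_def by (rule bessel_inequality[OF x k]) (use that in \<open>simp add: orthoD[OF V]\<close>)
    have "complex_of_real (\<Sum>j<?d. w j) = (\<Sum>a<k. tinner dims (x a) (x a))"
      unfolding w_def tinner_parseval_norm[OF V] by (subst sum.swap) simp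
    also have "\<dots> = of_real (real k)" by (simp add: orthoD[OF x])
    finally show "(\<Sum>j<?d. w j) = real k" by (simp only: of_real_eq_iff)
  qed (use k in auto)
  finally show ?thesis .
qed

lemma ortho_norm_le_1:
  assumes U: "ortho dims k U" and a: "a < k" and i: "i \<in> tidx dims"
  shows "norm (U a i) \<le> 1"
proof -
  have "complex_of_real (\<Sum>i\<in>tidx dims. (norm (U a i))^2) = 1"
    using orthoD(2)[OF U a a] by (simp add: tinner_self)
  then have "(\<Sum>i\<in>tidx dims. (norm (U a i))^2) = 1" by (simp only: of_real_eq_1_iff)
  moreover have "(norm (U a i))^2 \<le> (\<Sum>i\<in>tidx dims. (norm (U a i))^2)"
    using i by (intro member_le_sum) (auto simp: finite_tidx)
  ultimately show ?thesis by (simp add: abs_square_le_1)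
qed

text \<open>The leading eigenvectors of X serve as test system for Y in the Ky Fan bound. Their
  entries have modulus at most 1, so exchanging X for Y costs, per vector, at most the sum of the
  entry differences.\<close>

lemma top_sum_perturbation:
  assumes X: "hermitian dims X" and Y: "hermitian dims Y" and k: "k \<le> tdim dims"
  shows "(\<Sum>j<k. heigvals dims X ! j) - (\<Sum>j<k. heigvals dims Y ! j)
    \<le> real k * (\<Sum>i\<in>tidx dims. \<Sum>j\<in>tidx dims. norm (X i j - Y i j))"
proof -
  let ?d = "tdim dims" and ?E = "\<Sum>i\<in>tidx dims. \<Sum>j\<in>tidx dims. norm (X i j - Y i j)"
  obtain U where U: "herm_dec dims ?d X (\<lambda>j. heigvals dims X ! j) U" using heigvals_dec[OF X] .
  obtain V where V: "herm_dec dims ?d Y (\<lambda>j. heigvals dims Y ! j) V" using heigvals_dec[OF Y] .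
  have oU: "ortho dims ?d U" using U by (simp add: herm_dec_iff)
  have oUk: "ortho dims k U" using oU k by (auto simp: ortho_def)
  have eX: "tinner dims (U a) (tapp dims X (U a)) = of_real (heigvals dims X ! a)" if "a < k" for a
  proof -
    have "tapp dims X (U a) = (\<lambda>i. of_real (heigvals dims X ! a) * U a i)"
      by (rule herm_dec_eigen[OF U]) (use that k in simp)
    then show ?thesis using that k by (simp add: tinner_scale_right orthoD[OF oU])
  qed
  have diff: "Re (tinner dims (U a) (tapp dims X (U a))) - Re (tinner dims (U a) (tapp dims Y (U a))) \<le> ?E" if a: "a < k" for a
  proof -
    have "tinner dims (U a) (tapp dims X (U a)) - tinner dims (U a) (tapp dims Y (U a)) =
       (\<Sum>i\<in>tidx dims. \<Sum>j\<in>tidx dims. cnj (U a i) * ((X i j - Y i j) * U a j))"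
      by (simp add: tinner_def tapp_def sum_distrib_left right_diff_distrib left_diff_distrib sum_subtractf)
    moreover have "norm \<dots> \<le> ?E"
    proof (intro order_trans[OF norm_sum] sum_mono)
      fix i j assume ij: "i \<in> tidx dims" "j \<in> tidx dims"
      have "norm (cnj (U a i) * ((X i j - Y i j) * U a j)) \<le> 1 * (norm (X i j - Y i j) * 1)"
        unfolding norm_mult using ortho_norm_le_1[OF oUk a] ij by (intro mult_mono) auto
      then show "norm (cnj (U a i) * ((X i j - Y i j) * U a j)) \<le> norm (X i j - Y i j)" by simp
    qed
    ultimately have "norm (tinner dims (U a) (tapp dims X (U a)) - tinner dims (U a) (tapp dims Y (U a))) \<le> ?E"
      by simp
    with complex_Re_le_cmod[of "tinner dims (U a) (tapp dims X (U a)) - tinner dims (U a) (tapp dims Y (U a))"]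
    show ?thesis unfolding minus_complex.simps by linarith
  qed
  have "(\<Sum>j<k. heigvals dims X ! j) = (\<Sum>a<k. Re (tinner dims (U a) (tapp dims X (U a))))"
    by (intro sum.cong refl) (simp add: eX)
  also have "\<dots> \<le> (\<Sum>a<k. Re (tinner dims (U a) (tapp dims Y (U a))) + ?E)"
    by (intro sum_mono) (use diff in force)
  also have "\<dots> = Re (\<Sum>a<k. tinner dims (U a) (tapp dims Y (U a))) + real k * ?E"
    by (simp add: sum.distrib)
  also have "Re (\<Sum>a<k. tinner dims (U a) (tapp dims Y (U a))) \<le> (\<Sum>j<k. heigvals dims Y ! j)"
    by (rule ky_fan[OF V heigvals_decreasing oUk k])
  finally show ?thesis by simp
qed

text \<open>An ordered eigenvalue is the difference of two consecutive top sums, and these are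
  Lipschitz in the entries. No continuous choice of eigenvectors is involved.\<close>

lemma heigvals_continuous:
  fixes X :: "'t::topological_space \<Rightarrow> tensor"
  assumes H: "\<And>t. hermitian dims (X t)"
    and cont: "\<And>i j. i \<in> tidx dims \<Longrightarrow> j \<in> tidx dims \<Longrightarrow> continuous_on UNIV (\<lambda>t. X t i j)"
    and m: "m < tdim dims"
  shows "continuous_on UNIV (\<lambda>t. heigvals dims (X t) ! m)"
proof -
  define T where "T k t = (\<Sum>j<k. heigvals dims (X t) ! j)" for k t
  have T: "continuous_on UNIV (T k)" if k: "k \<le> tdim dims" for k
    unfolding continuous_on_def
  proof
    fix s
    let ?B = "\<lambda>t. real k * (\<Sum>i\<in>tidx dims. \<Sum>j\<in>tidx dims. norm (X t i j - X s i j))"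
    have sym: "?B t = real k * (\<Sum>i\<in>tidx dims. \<Sum>j\<in>tidx dims. norm (X s i j - X t i j))" for t
      by (simp add: norm_minus_commute)
    have "\<bar>T k t - T k s\<bar> \<le> ?B t" for t
      using top_sum_perturbation[OF H[of t] H[of s] k] top_sum_perturbation[OF H[of s] H[of t] k]
      unfolding T_def sym[symmetric] by linarith
    moreover have "(?B \<longlongrightarrow> real k * (\<Sum>i\<in>tidx dims. \<Sum>j\<in>tidx dims. norm (X s i j - X s i j))) (at s)"
      using cont by (intro tendsto_intros) (auto simp: continuous_on_def)
    ultimately have "((\<lambda>t. T k t - T k s) \<longlongrightarrow> 0) (at s)"
      by (intro Lim_null_comparison[of "\<lambda>t. T k t - T k s" ?B]) auto
    then show "(T k \<longlongrightarrow> T k s) (at s within UNIV)" by (simp add: LIM_zero_iff)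
  qed
  have eq: "(\<lambda>t. heigvals dims (X t) ! m) = (\<lambda>t. T (Suc m) t - T m t)"
    by (simp add: T_def)
  show ?thesis unfolding eq using m by (intro continuous_on_diff T) auto
qed

text \<open>Parseval's identity in the k-th exterior power: Cauchy-Binet for the Gram matrix of x,
  which is the identity, expanded over the basis u.\<close>

lemma ortho_det_sum:
  assumes x: "ortho dims k x" and u: "ortho dims (tdim dims) u"
  shows "(\<Sum>J\<in>{0..<k} \<rightarrow>\<^sub>E {..<tdim dims}. (norm (kdet k (\<lambda>a b. tinner dims (x a) (u (J b)))))^2) = fact k"
proof -
  let ?E = "{0..<k} \<rightarrow>\<^sub>E {..<tdim dims}"
  have "kdet k (\<lambda>a b. \<Sum>j<tdim dims. tinner dims (x a) (u j) * tinner dims (u j) (x b)) = kdet k (\<lambda>a b. if a = b then 1 else 0)"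
    by (intro kdet_cong) (simp add: orthoD[OF x] flip: ortho_parseval[OF u])
  then have "fact k = (\<Sum>J\<in>?E. kdet k (\<lambda>a b. tinner dims (x a) (u (J b))) * kdet k (\<lambda>a b. tinner dims (u (J a)) (x b)))"
    using cauchy_binet[where k = k and d = "tdim dims" and x = "\<lambda>a j. tinner dims (x a) (u j)" and y = "\<lambda>j b. tinner dims (u j) (x b)"]
    by (simp add: kdet_id)
  also have "\<dots> = (\<Sum>J\<in>?E. of_real ((norm (kdet k (\<lambda>a b. tinner dims (x a) (u (J b)))))^2))"
  proof (rule sum.cong[OF refl])
    fix J
    have "kdet k (\<lambda>a b. tinner dims (u (J a)) (x b)) = cnj (kdet k (\<lambda>a b. tinner dims (x a) (u (J b))))"
      using kdet_transpose[of k "\<lambda>a b. tinner dims (u (J a)) (x b)"]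
      by (simp add: tinner_cnj flip: kdet_cnj)
    then show "kdet k (\<lambda>a b. tinner dims (x a) (u (J b))) * kdet k (\<lambda>a b. tinner dims (u (J a)) (x b)) =
       of_real ((norm (kdet k (\<lambda>a b. tinner dims (x a) (u (J b)))))^2)"
      by (simp add: complex_norm_square flip: of_real_power)
  qed
  finally have "complex_of_real (\<Sum>J\<in>?E. (norm (kdet k (\<lambda>a b. tinner dims (x a) (u (J b)))))^2) = of_real (fact k)" by simp
  then show ?thesis by (simp only: of_real_eq_iff)
qed

text \<open>After taking logarithms this is the weighted sum bound for the indicator weights of the
  image of J.\<close>

lemma prod_le_top_prod:
  fixes s :: "nat \<Rightarrow> real"
  assumes pos: "\<And>j. j < d \<Longrightarrow> s j > 0" and dcr: "\<And>i j. i < j \<Longrightarrow> j < d \<Longrightarrow> s j \<le> s i"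
    and J: "inj_on J {0..<k}" "J ` {0..<k} \<subseteq> {..<d}"
  shows "(\<Prod>a\<in>{0..<k}. s (J a)) \<le> (\<Prod>j<k. s j)"
proof -
  have k: "k \<le> d" using card_inj_on_le[OF J(1), of "{..<d}"] J(2) by simp
  define w where "w j = (if j \<in> J ` {0..<k} then 1 else 0::real)" for j
  have "(\<Sum>j<d. ln (s j) * w j) \<le> (\<Sum>j<k. ln (s j))"
  proof (rule weighted_sum_le_top_sum)
    show "ln (s j) \<le> ln (s i)" if "i < j" "j < d" for i j
      using that pos dcr by (intro ln_mono) auto
    have "(\<Sum>j<d. w j) = real (card ({..<d} \<inter> J ` {0..<k}))"
      unfolding w_def by (simp flip: sum.inter_restrict)
    also have "{..<d} \<inter> J ` {0..<k} = J ` {0..<k}" using J(2) by auto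
    finally show "(\<Sum>j<d. w j) = real k" by (simp add: card_image[OF J(1)])
  qed (auto simp: w_def k)
  moreover have "(\<Sum>j<d. ln (s j) * w j) = (\<Sum>a\<in>{0..<k}. ln (s (J a)))"
  proof -
    have "(\<Sum>j<d. ln (s j) * w j) = (\<Sum>j\<in>J ` {0..<k}. ln (s j))"
      using J(2) by (intro sum.mono_neutral_cong_right) (auto simp: w_def)
    then show ?thesis by (simp add: sum.reindex[OF J(1)])
  qed
  moreover have "(\<Prod>a\<in>{0..<k}. s (J a)) = exp (\<Sum>a\<in>{0..<k}. ln (s (J a)))"
    using J(2) pos by (subst exp_sum) (auto intro!: prod.cong)
  moreover have "(\<Prod>j<k. s j) = exp (\<Sum>j<k. ln (s j))"
    using k pos by (subst exp_sum) (auto intro!: prod.cong)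
  ultimately show ?thesis by simp
qed

text \<open>The singular value decomposition and the Cauchy-Binet formula express the minor as an average of
  products of singular values.\<close>

lemma minor_le_singular_values:
  assumes dec: "herm_dec dims (tdim dims) (einstein dims (tct A) A) lam v"
    and pos: "\<And>j. j < tdim dims \<Longrightarrow> lam j > 0"
    and dcr: "\<And>i j. i < j \<Longrightarrow> j < tdim dims \<Longrightarrow> lam j \<le> lam i"
    and x: "ortho dims k x" and y: "ortho dims k y" and k: "k \<le> tdim dims"
  shows "norm (kdet k (\<lambda>a b. tinner dims (x a) (tapp dims A (y b)))) \<le> (\<Prod>j<k. sqrt (lam j))"
proof -
  let ?d = "tdim dims" and ?E = "{0..<k} \<rightarrow>\<^sub>E {..<tdim dims}"
  have v: "ortho dims ?d v" and G: "einstein dims (tct A) A = tdiag ?d (\<lambda>a. of_real (lam a)) v"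
    using dec by (auto simp: herm_dec_iff)
  define \<sigma> where "\<sigma> j = sqrt (lam j)" for j
  have \<sigma>: "\<sigma> j > 0" "\<sigma> j * \<sigma> j = lam j" if "j < ?d" for j using pos[OF that] by (auto simp: \<sigma>_def)
  \<comment> \<open>Left singular vectors; all \<open>lam j\<close> being positive, they form a full
    orthonormal basis.\<close>
  define u where "u j i = of_real (1 / \<sigma> j) * tapp dims A (v j) i" for j i
  have Av: "tinner dims (tapp dims A (v a)) (tapp dims A (v b)) = (if a = b then of_real (lam a) else 0)"
    if "a < ?d" "b < ?d" for a b
  proof -
    have "tinner dims (tapp dims A (v a)) (tapp dims A (v b)) = tinner dims (v a) (tapp dims (einstein dims (tct A) A) (v b))"
      unfolding tapp_einstein tinner_tapp[of dims "v a"] by simp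
    also have "\<dots> = of_real (lam b) * tinner dims (v a) (v b)"
      unfolding G tapp_tdiag_eigen[OF v that(2)] tinner_scale_right ..
    finally show ?thesis using that by (simp add: orthoD[OF v])
  qed
  have u: "ortho dims ?d u"
    unfolding ortho_def
  proof (intro conjI allI impI)
    fix a assume "a < ?d" then show "is_otensor dims (u a)"
      using is_otensor_tapp[of dims A "v a"] by (simp add: is_otensor_def u_def)
  next
    fix a b assume a: "a < ?d" and b: "b < ?d"
    have "tinner dims (u a) (u b) = of_real (1 / \<sigma> a) * (of_real (1 / \<sigma> b) * (if a = b then of_real (lam a) else 0))"
      unfolding u_def[abs_def] tinner_scale_left tinner_scale_right Av[OF a b] by simp
    then show "tinner dims (u a) (u b) = (if a = b then 1 else 0)"
      using \<sigma>[OF a] by (auto simp flip: of_real_mult of_real_divide)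
  qed
  have Au: "tapp dims A (v j) = (\<lambda>i. of_real (\<sigma> j) * u j i)" if "j < ?d" for j
    using \<sigma>(1)[OF that] by (simp add: u_def fun_eq_iff)
  have entry: "tinner dims (x a) (tapp dims A (y b)) =
     (\<Sum>j<?d. tinner dims (x a) (u j) * (of_real (\<sigma> j) * tinner dims (v j) (y b)))" if "b < k" for a b
  proof -
    have "tapp dims A (y b) = tapp dims A (\<lambda>i. \<Sum>j<?d. tinner dims (v j) (y b) * v j i)"
      using ortho_expansion[OF v orthoD(1)[OF y that]] by (rule arg_cong)
    also have "\<dots> = (\<lambda>i. \<Sum>j<?d. (tinner dims (v j) (y b) * of_real (\<sigma> j)) * u j i)"
      unfolding tapp_sum by (intro ext sum.cong refl) (simp add: Au mult.assoc)
    finally have e: "tapp dims A (y b) = (\<lambda>i. \<Sum>j<?d. (tinner dims (v j) (y b) * of_real (\<sigma> j)) * u j i)" .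
    show ?thesis unfolding e tinner_sum_right by (intro sum.cong refl) (simp add: mult_ac)
  qed
  define p where "p J = kdet k (\<lambda>a b. tinner dims (x a) (u (J b)))" for J
  define q where "q J = kdet k (\<lambda>a b. tinner dims (v (J a)) (y b))" for J
  define B where "B = (\<Prod>j<k. \<sigma> j)"
  have Bpos: "B \<ge> 0" unfolding B_def using \<sigma>(1) k by (intro prod_nonneg) (auto simp: less_imp_le)
  have "fact k * kdet k (\<lambda>a b. tinner dims (x a) (tapp dims A (y b))) =
     fact k * kdet k (\<lambda>a b. \<Sum>j<?d. tinner dims (x a) (u j) * (of_real (\<sigma> j) * tinner dims (v j) (y b)))"
    by (intro arg_cong2[where f = "(*)"] refl kdet_cong entry)
  also have "\<dots> = (\<Sum>J\<in>?E. p J * ((\<Prod>a\<in>{0..<k}. of_real (\<sigma> (J a))) * q J))"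
    unfolding cauchy_binet kdet_rows_scale p_def q_def ..
  finally have "norm (fact k * kdet k (\<lambda>a b. tinner dims (x a) (tapp dims A (y b)))) =
      norm (\<Sum>J\<in>?E. p J * ((\<Prod>a\<in>{0..<k}. of_real (\<sigma> (J a))) * q J))"
    by (rule arg_cong)
  then have "fact k * norm (kdet k (\<lambda>a b. tinner dims (x a) (tapp dims A (y b)))) =
      norm (\<Sum>J\<in>?E. p J * ((\<Prod>a\<in>{0..<k}. of_real (\<sigma> (J a))) * q J))"
    unfolding norm_mult norm_fact .
  also have "\<dots> \<le> (\<Sum>J\<in>?E. norm (p J * ((\<Prod>a\<in>{0..<k}. of_real (\<sigma> (J a))) * q J)))" by (rule norm_sum)
  \<comment> \<open>By |p| |q| <= (|p|^2 + |q|^2) / 2 the two minors decouple, and each sum of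
    squares is k!. For J not injective q J vanishes, so products of singular values are compared
    only over distinct indices.\<close>
  also have "\<dots> \<le> (\<Sum>J\<in>?E. B * (((norm (p J))^2 + (norm (q J))^2) / 2))"
  proof (rule sum_mono)
    fix J assume J: "J \<in> ?E"
    have Jd: "J a < ?d" if "a < k" for a using J that by (auto simp: PiE_iff)
    show "norm (p J * ((\<Prod>a\<in>{0..<k}. of_real (\<sigma> (J a))) * q J)) \<le> B * (((norm (p J))^2 + (norm (q J))^2) / 2)"
    proof (cases "inj_on J {0..<k}")
      case True
      have "(\<Prod>a\<in>{0..<k}. \<sigma> (J a)) \<le> B"
        unfolding B_def
        by (rule prod_le_top_prod[of ?d]) (use \<sigma> True Jd dcr in \<open>auto simp: \<sigma>_def\<close>)
      moreover have "norm (\<Prod>a\<in>{0..<k}. complex_of_real (\<sigma> (J a))) = (\<Prod>a\<in>{0..<k}. \<sigma> (J a))"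
        unfolding prod_norm[symmetric] using \<sigma>(1)[OF Jd] by (intro prod.cong) (auto simp: less_imp_le)
      ultimately have "norm (p J * ((\<Prod>a\<in>{0..<k}. of_real (\<sigma> (J a))) * q J)) \<le> norm (p J) * (B * norm (q J))"
        unfolding norm_mult by (intro mult_left_mono mult_right_mono) auto
      also have "\<dots> = B * (norm (p J) * norm (q J))" by simp
      also have "\<dots> \<le> B * (((norm (p J))^2 + (norm (q J))^2) / 2)"
        using sum_squares_bound[of "norm (p J)" "norm (q J)"] by (intro mult_left_mono Bpos) simp
      finally show ?thesis .
    next
      case False
      then obtain a b where ab: "a < k" "b < k" "a \<noteq> b" "J a = J b" by (auto simp: inj_on_def)
      have "q J = 0" unfolding q_def by (rule kdet_identical_rows[OF ab(1-3)]) (simp add: ab(4))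
      then show ?thesis using Bpos by simp
    qed
  qed
  also have "\<dots> = B * (((\<Sum>J\<in>?E. (norm (p J))^2) + (\<Sum>J\<in>?E. (norm (q J))^2)) / 2)"
    unfolding sum.distrib[symmetric] sum_divide_distrib sum_distrib_left ..
  also have "(\<Sum>J\<in>?E. (norm (p J))^2) = fact k" unfolding p_def by (rule ortho_det_sum[OF x u])
  also have "(\<Sum>J\<in>?E. (norm (q J))^2) = fact k"
  proof -
    have "norm (q J) = norm (kdet k (\<lambda>a b. tinner dims (y a) (v (J b))))" for J
    proof -
      have "q J = cnj (kdet k (\<lambda>a b. tinner dims (y b) (v (J a))))"
        by (simp add: q_def tinner_cnj flip: kdet_cnj)
      then show ?thesis using kdet_transpose[of k "\<lambda>a b. tinner dims (y a) (v (J b))"] by simp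
    qed
    then show ?thesis using ortho_det_sum[OF y v] by simp
  qed
  finally have "fact k * norm (kdet k (\<lambda>a b. tinner dims (x a) (tapp dims A (y b)))) \<le> fact k * B"
    by (simp add: mult.commute)
  then show ?thesis by (simp add: B_def \<sigma>_def)
qed

section \<open>Determinants of tensors\<close>

definition tdet :: "nat list \<Rightarrow> (nat \<Rightarrow> otensor) \<Rightarrow> tensor \<Rightarrow> complex" where
  "tdet dims W A = kdet (tdim dims) (\<lambda>a b. tinner dims (W a) (tapp dims A (W b)))"

context
  fixes dims W
  assumes W: "ortho dims (tdim dims) W"
begin

lemma tdet_einstein: "tdet dims W (einstein dims A B) = tdet dims W A * tdet dims W B"
proof -
  have "tinner dims (W a) (tapp dims (einstein dims A B) (W b)) =
     (\<Sum>l<tdim dims. tinner dims (W a) (tapp dims A (W l)) * tinner dims (W l) (tapp dims B (W b)))" for a b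
    unfolding tapp_einstein tinner_tapp[of dims "W a"] by (rule ortho_parseval[OF W])
  then show ?thesis by (simp add: tdet_def kdet_mult)
qed

lemma tdet_tct: "tdet dims W (tct A) = cnj (tdet dims W A)"
proof -
  have "tdet dims W (tct A) = kdet (tdim dims) (\<lambda>a b. cnj (tinner dims (W b) (tapp dims A (W a))))"
    unfolding tdet_def by (intro kdet_cong) (simp add: tinner_tapp tinner_cnj)
  then show ?thesis by (simp add: kdet_cnj tdet_def kdet_transpose[of _ "\<lambda>a b. tinner dims (W a) (tapp dims A (W b))"])
qed

text \<open>The two matrices of the change of basis are inverse to each other, so their determinants
  cancel. Hence factors with different eigenbases can all be evaluated in one basis W.\<close>

lemma tdet_tdiag:
  assumes U: "ortho dims (tdim dims) U"
  shows "tdet dims W (tdiag (tdim dims) c U) = (\<Prod>a<tdim dims. c a)"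
proof -
  let ?d = "tdim dims"
  let ?P = "\<lambda>a l. tinner dims (W a) (U l)" and ?Q = "\<lambda>l b. tinner dims (U l) (W b)"
  have "tinner dims (W a) (tapp dims (tdiag ?d c U) (W b)) = (\<Sum>l<?d. ?P a l * (c l * ?Q l b))" for a b
    unfolding tapp_tdiag[OF U] tinner_sum_right by (simp add: mult_ac)
  then have "tdet dims W (tdiag ?d c U) = kdet ?d ?P * (prod c {0..<?d} * kdet ?d ?Q)"
    by (simp add: tdet_def kdet_mult kdet_rows_scale)
  also have "kdet ?d ?P * (prod c {0..<?d} * kdet ?d ?Q) = prod c {0..<?d} * kdet ?d (\<lambda>a b. \<Sum>l<?d. ?P a l * ?Q l b)"
    by (simp add: kdet_mult)
  also have "kdet ?d (\<lambda>a b. \<Sum>l<?d. ?P a l * ?Q l b) = kdet ?d (\<lambda>a b. if a = b then 1 else 0)"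
    by (intro kdet_cong) (simp add: orthoD[OF W] flip: ortho_parseval[OF U])
  finally show ?thesis by (simp add: kdet_id lessThan_atLeast0)
qed

end

section \<open>Products of complex powers\<close>

lemma einstein_assoc: "einstein dims (einstein dims A B) E = einstein dims A (einstein dims B E)"
proof (intro ext)
  fix i k
  have "(\<Sum>l\<in>tidx dims. (\<Sum>j\<in>tidx dims. A i j * B j l) * E l k) =
      (\<Sum>j\<in>tidx dims. A i j * (\<Sum>l\<in>tidx dims. B j l * E l k))"
    unfolding sum_distrib_left sum_distrib_right by (subst sum.swap) (simp add: mult_ac)
  then show "einstein dims (einstein dims A B) E i k = einstein dims A (einstein dims B E) i k"
    by (simp add: einstein_def)
qed

lemma einstein_tid_left:
  assumes "is_tensor dims B"
  shows "einstein dims (tid dims) B = B"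
proof (intro ext)
  fix i k
  show "einstein dims (tid dims) B i k = B i k"
  proof (cases "i \<in> tidx dims \<and> k \<in> tidx dims")
    case True
    then have "einstein dims (tid dims) B i k = (\<Sum>j\<in>tidx dims. (if i = j then 1 else 0) * B j k)"
      unfolding einstein_def tid_def by (auto intro: sum.cong)
    then show ?thesis using True by (simp add: sum_delta_mult finite_tidx)
  next
    case False
    then show ?thesis using assms by (auto simp: einstein_def is_tensor_def)
  qed
qed

text \<open>With fewer than \<open>tdim dims\<close> terms some unit w would be orthogonal to all of
  them and be annihilated by H, whereas positive eigenvalues make H injective. Hence the gauge in
  the theorem acts on vectors of full length.\<close>

lemma pos_def_hrank:
  assumes "pos_def dims H"
  shows "hrank dims H = tdim dims"
  unfolding hrank_def
proof (rule Least_equality)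
  let ?d = "tdim dims"
  obtain lam U where dec: "herm_dec dims ?d H lam U" and pos: "\<forall>k<?d. lam k > 0"
    using assms by (auto simp: pos_def_def)
  then show "\<exists>lam U. herm_dec dims ?d H lam U" by blast
  fix r assume "\<exists>mu V. herm_dec dims r H mu V"
  then obtain mu V where "herm_dec dims r H mu V" by blast
  then have V: "ortho dims r V" and HV: "H = tdiag r (\<lambda>a. of_real (mu a)) V" by (auto simp: herm_dec_iff)
  show "?d \<le> r"
  proof (rule ccontr)
    assume "\<not> ?d \<le> r"
    then obtain w where w: "ortho dims (Suc r) (V(r := w))" using ortho_extend_one[OF V, of] by auto
    have ww: "tinner dims w w = 1" using orthoD(2)[OF w, of r r] by simp
    have Vw: "tinner dims (V a) w = 0" if "a < r" for a using orthoD(2)[OF w, of a r] that by simp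
    have U: "ortho dims ?d U" and HU: "H = tdiag ?d (\<lambda>a. of_real (lam a)) U" using dec by (auto simp: herm_dec_iff)
    have Hw: "tapp dims H w = (\<lambda>i. 0)" unfolding HV tapp_tdiag[OF V] by (simp add: Vw)
    have "tinner dims (U a) w = 0" if a: "a < ?d" for a
    proof -
      have "of_real (lam a) * tinner dims (U a) w = tinner dims (tapp dims H (U a)) w"
        unfolding herm_dec_eigen[OF dec a] tinner_scale_left by simp
      also have "\<dots> = tinner dims (U a) (tapp dims H w)"
        by (rule hermitian_tapp_inner[OF herm_dec_hermitian[OF dec], symmetric])
      also have "\<dots> = 0" unfolding Hw by (simp add: tinner_def)
      finally show ?thesis using pos a by force
    qed
    then have "tinner dims w w = 0" unfolding ortho_parseval[OF U, of w w] by simp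
    then show False using ww by simp
  qed
qed

locale positive_family =
  fixes dims :: "nat list" and C :: "nat \<Rightarrow> tensor" and I :: "nat set"
    and lam :: "nat \<Rightarrow> nat \<Rightarrow> real" and U :: "nat \<Rightarrow> nat \<Rightarrow> otensor"
  assumes dec: "l \<in> I \<Longrightarrow> herm_dec dims (tdim dims) (C l) (lam l) (U l)"
    and pos: "l \<in> I \<Longrightarrow> a < tdim dims \<Longrightarrow> lam l a > 0"
begin

text \<open>A list of indices permits induction on the number of factors; the list 1, ..., n gives
  \<open>tprod\<close>.\<close>

definition power_prod :: "nat list \<Rightarrow> complex \<Rightarrow> tensor" where
  "power_prod L z = foldr (\<lambda>l acc. einstein dims (tpow dims (C l) z) acc) L (tid dims)"

definition logsum :: "nat list \<Rightarrow> tensor" where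
  "logsum L = (\<lambda>i j. \<Sum>l\<leftarrow>L. tlog dims (C l) i j)"

lemma power_prod_simps: "power_prod [] z = tid dims" "power_prod (l # L) z = einstein dims (tpow dims (C l) z) (power_prod L z)"
  by (simp_all add: power_prod_def)

lemma is_tensor_P: "is_tensor dims (power_prod L z)"
  by (cases L) (simp_all add: power_prod_simps is_tensor_tid is_tensor_einstein)

lemma ortho_U: "l \<in> I \<Longrightarrow> ortho dims (tdim dims) (U l)"
  using dec by (auto simp: herm_dec_iff)

lemma tpow_C: "l \<in> I \<Longrightarrow> tpow dims (C l) z = tdiag (tdim dims) (\<lambda>a. exp (z * of_real (ln (lam l a)))) (U l)"
  by (rule tpow_eq[OF dec])

lemma tlog_C: "l \<in> I \<Longrightarrow> tlog dims (C l) = tdiag (tdim dims) (\<lambda>a. of_real (ln (lam l a))) (U l)"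
  unfolding tlog_def by (rule tfun_eq[OF dec])

lemma power_prod_holomorphic: "set L \<subseteq> I \<Longrightarrow> (\<lambda>z. power_prod L z i j) holomorphic_on UNIV"
proof (induction L arbitrary: i j)
  case (Cons l L)
  then have l: "l \<in> I" by simp
  have "(\<lambda>z. \<Sum>m\<in>tidx dims. tpow dims (C l) z i m * power_prod L z m j) holomorphic_on UNIV"
    unfolding tpow_C[OF l] tdiag_def using Cons by (intro holomorphic_intros) auto
  then show ?case by (cases "i \<in> tidx dims \<and> j \<in> tidx dims") (auto simp: power_prod_simps einstein_def)
qed (simp add: power_prod_simps)

lemma power_prod_0: "set L \<subseteq> I \<Longrightarrow> power_prod L 0 = tid dims"
proof (induction L)
  case (Cons l L)
  then have l: "l \<in> I" and IH: "power_prod L 0 = tid dims" by simp_all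
  have "tpow dims (C l) 0 = tid dims"
    unfolding tpow_C[OF l] tid_eq_tdiag[OF ortho_U[OF l]] by simp
  then show ?case by (simp add: power_prod_simps IH einstein_tid_left is_tensor_tid)
qed (simp add: power_prod_simps)

text \<open>In the product rule at 0 every undifferentiated factor is the identity, so the order of
  the noncommuting factors leaves no trace in the derivative.\<close>

lemma power_prod_deriv:
  "set L \<subseteq> I \<Longrightarrow> i \<in> tidx dims \<Longrightarrow> j \<in> tidx dims \<Longrightarrow>
    ((\<lambda>z. power_prod L z i j) has_field_derivative logsum L i j) (at 0)"
proof (induction L arbitrary: i j)
  case (Cons l L)
  then have l: "l \<in> I" and L: "set L \<subseteq> I" by simp_all
  have dT: "((\<lambda>z. tpow dims (C l) z i m) has_field_derivative tlog dims (C l) i m) (at 0)" for m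
  proof -
    have "((\<lambda>z. exp (z * of_real (ln (lam l a))) * touter (U l a) (U l a) i m) has_field_derivative
       of_real (ln (lam l a)) * touter (U l a) (U l a) i m) (at 0)" for a
      by (auto intro!: derivative_eq_intros)
    then show ?thesis unfolding tpow_C[OF l] tlog_C[OF l] tdiag_def by (intro DERIV_sum)
  qed
  have T0: "tpow dims (C l) 0 = tid dims"
    unfolding tpow_C[OF l] tid_eq_tdiag[OF ortho_U[OF l]] by simp
  have "((\<lambda>z. \<Sum>m\<in>tidx dims. tpow dims (C l) z i m * power_prod L z m j) has_field_derivative
     (\<Sum>m\<in>tidx dims. tlog dims (C l) i m * power_prod L 0 m j + logsum L m j * tpow dims (C l) 0 i m)) (at 0)"
    by (intro DERIV_sum DERIV_mult dT Cons.IH L Cons.prems) auto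
  moreover have "(\<Sum>m\<in>tidx dims. tlog dims (C l) i m * power_prod L 0 m j + logsum L m j * tpow dims (C l) 0 i m) = logsum (l # L) i j"
  proof -
    have "(\<Sum>m\<in>tidx dims. tlog dims (C l) i m * power_prod L 0 m j) = (\<Sum>m\<in>tidx dims. (if j = m then 1 else 0) * tlog dims (C l) i m)"
      using Cons.prems by (intro sum.cong refl) (auto simp: power_prod_0[OF L] tid_def)
    moreover have "(\<Sum>m\<in>tidx dims. logsum L m j * tpow dims (C l) 0 i m) = (\<Sum>m\<in>tidx dims. (if i = m then 1 else 0) * logsum L m j)"
      using Cons.prems by (intro sum.cong refl) (auto simp: T0 tid_def)
    ultimately show ?thesis using Cons.prems
      by (simp add: sum.distrib sum_delta_mult finite_tidx logsum_def)
  qed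
  ultimately show ?case using Cons.prems by (simp add: power_prod_simps einstein_def)
qed (simp add: power_prod_simps logsum_def)

text \<open>On the closed strip |exp (z ln x)| = exp (Re z ln x) <= exp |ln x|, whatever Im z is.
  This is the a priori bound that the Phragmen-Lindelof argument needs.\<close>

lemma power_prod_bound:
  "set L \<subseteq> I \<Longrightarrow> \<exists>K. \<forall>z i j. 0 \<le> Re z \<longrightarrow> Re z \<le> 1 \<longrightarrow> norm (power_prod L z i j) \<le> K"
proof (induction L)
  case Nil
  have "norm (tid dims i j) \<le> 1" for i j by (simp add: tid_def)
  then show ?case by (auto simp: power_prod_simps)
next
  case (Cons l L)
  then have l: "l \<in> I" by simp
  obtain K where K: "\<And>z i j. 0 \<le> Re z \<Longrightarrow> Re z \<le> 1 \<Longrightarrow> norm (power_prod L z i j) \<le> K"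
    using Cons by auto
  have K0: "K \<ge> 0" using K[of 0 undefined undefined] by (smt (verit) norm_ge_zero zero_complex.simps(1))
  define K1 where "K1 = (\<Sum>a<tdim dims. exp \<bar>ln (lam l a)\<bar>)"
  have T: "norm (tpow dims (C l) z i m) \<le> K1" if z: "0 \<le> Re z" "Re z \<le> 1" and im: "i \<in> tidx dims" "m \<in> tidx dims" for z i m
    unfolding tpow_C[OF l] tdiag_def K1_def
  proof (intro order_trans[OF norm_sum] sum_mono)
    fix a assume a: "a \<in> {..<tdim dims}"
    have "Re z * ln (lam l a) \<le> \<bar>Re z\<bar> * \<bar>ln (lam l a)\<bar>" by (metis abs_ge_self abs_mult)
    also have "\<dots> \<le> 1 * \<bar>ln (lam l a)\<bar>" using z by (intro mult_right_mono) auto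
    finally have "norm (exp (z * of_real (ln (lam l a)))) \<le> exp \<bar>ln (lam l a)\<bar>" by simp
    moreover have "norm (touter (U l a) (U l a) i m) \<le> 1 * 1"
      unfolding touter_def norm_mult
      using ortho_norm_le_1[OF ortho_U[OF l], of a] a im by (intro mult_mono) auto
    ultimately show "norm (exp (z * of_real (ln (lam l a))) * touter (U l a) (U l a) i m) \<le> exp \<bar>ln (lam l a)\<bar>"
      unfolding norm_mult by (metis mult_mono' mult.right_neutral norm_ge_zero)
  qed
  have "norm (power_prod (l # L) z i j) \<le> real (card (tidx dims)) * (K1 * K)" if z: "0 \<le> Re z" "Re z \<le> 1" for z i j
  proof (cases "i \<in> tidx dims \<and> j \<in> tidx dims")
    case True
    have "norm (power_prod (l # L) z i j) \<le> (\<Sum>m\<in>tidx dims. norm (tpow dims (C l) z i m * power_prod L z m j))"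
      using True by (simp add: power_prod_simps einstein_def norm_sum)
    also have "\<dots> \<le> (\<Sum>m\<in>tidx dims. K1 * K)"
      unfolding norm_mult using T[OF z] K[OF z] True K0
      by (intro sum_mono mult_mono) (auto intro: order_trans[OF norm_ge_zero])
    finally show ?thesis by simp
  next
    case False
    have "K1 \<ge> 0" unfolding K1_def by (intro sum_nonneg) auto
    then show ?thesis using False K0 by (auto simp: power_prod_simps einstein_def)
  qed
  then show ?case by blast
qed

lemma power_prod_unitary:
  "set L \<subseteq> I \<Longrightarrow> Re z = 0 \<Longrightarrow> einstein dims (tct (power_prod L z)) (power_prod L z) = tid dims"
proof (induction L)
  case Nil
  have "tct (tid dims) = tid dims" by (auto simp: tct_def tid_def fun_eq_iff)
  then show ?case by (simp add: power_prod_simps einstein_tid_left is_tensor_tid)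
next
  case (Cons l L)
  then have l: "l \<in> I" by simp
  let ?T = "tpow dims (C l) z"
  have "cnj (exp (z * of_real x)) * exp (z * of_real x) = 1" for x
  proof -
    have "cnj z + z = 0" using Cons.prems(2) by (simp add: complex_eq_iff)
    then have "cnj z * of_real x + z * of_real x = 0" by (metis distrib_right mult_zero_left)
    then show ?thesis by (simp add: exp_cnj flip: exp_add)
  qed
  then have TT: "einstein dims (tct ?T) ?T = tid dims"
    unfolding tpow_C[OF l] tct_tdiag einstein_tdiag[OF ortho_U[OF l]] tid_eq_tdiag[OF ortho_U[OF l]] by simp
  have "einstein dims (tct (power_prod (l # L) z)) (power_prod (l # L) z) =
      einstein dims (tct (power_prod L z)) (einstein dims (einstein dims (tct ?T) ?T) (power_prod L z))"
    by (simp add: power_prod_simps tct_einstein einstein_assoc)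
  also have "\<dots> = tid dims" using Cons by (simp add: TT einstein_tid_left is_tensor_P)
  finally show ?case .
qed

text \<open>The coefficient exp ((1 + it) ln x) has modulus x for all t, so each factor multiplies
  squared lengths by something between p^2 and q^2, and the bounds multiply. They keep the
  logarithms of the singular values bounded uniformly in t.\<close>

lemma power_prod_norm_bounds:
  "set L \<subseteq> I \<Longrightarrow> \<exists>m M. m > 0 \<and> (\<forall>t X. is_otensor dims X \<longrightarrow>
     m * Re (tinner dims X X) \<le> Re (tinner dims (tapp dims (power_prod L (1 + \<i> * of_real t)) X) (tapp dims (power_prod L (1 + \<i> * of_real t)) X)) \<and>
     Re (tinner dims (tapp dims (power_prod L (1 + \<i> * of_real t)) X) (tapp dims (power_prod L (1 + \<i> * of_real t)) X)) \<le> M * Re (tinner dims X X))"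
proof (induction L)
  case Nil
  then show ?case by (intro exI[of _ 1]) (simp add: power_prod_simps tapp_tid)
next
  case (Cons l L)
  then have l: "l \<in> I" by simp
  let ?d = "tdim dims"
  obtain m M where m: "m > 0" and mM: "\<And>t X. is_otensor dims X \<Longrightarrow>
     m * Re (tinner dims X X) \<le> Re (tinner dims (tapp dims (power_prod L (1 + \<i> * of_real t)) X) (tapp dims (power_prod L (1 + \<i> * of_real t)) X)) \<and>
     Re (tinner dims (tapp dims (power_prod L (1 + \<i> * of_real t)) X) (tapp dims (power_prod L (1 + \<i> * of_real t)) X)) \<le> M * Re (tinner dims X X)"
    using Cons by auto
  \<comment> \<open>The inserted 1 ensures that minimum and maximum are taken over a nonempty
    set.\<close>
  define A where "A = insert 1 (lam l ` {..<?d})"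
  have fA: "finite A" "A \<noteq> {}" by (auto simp: A_def)
  define p q where "p = Min A" and "q = Max A"
  have p: "p > 0" unfolding p_def using fA pos[OF l] by (subst Min_gr_iff) (auto simp: A_def)
  have q: "q \<ge> 1" unfolding q_def using fA by (intro Max_ge) (auto simp: A_def)
  have pq: "p \<le> lam l a" "lam l a \<le> q" if "a < ?d" for a
    unfolding p_def q_def using fA that by (auto intro!: Min_le Max_ge simp: A_def)
  have nn: "Re (tinner dims X X) \<ge> 0" for X by (simp add: tinner_self sum_nonneg)
  have T: "p^2 * Re (tinner dims Y Y) \<le> Re (tinner dims (tapp dims (tpow dims (C l) (1 + \<i> * of_real t)) Y) (tapp dims (tpow dims (C l) (1 + \<i> * of_real t)) Y)) \<and>
      Re (tinner dims (tapp dims (tpow dims (C l) (1 + \<i> * of_real t)) Y) (tapp dims (tpow dims (C l) (1 + \<i> * of_real t)) Y)) \<le> q^2 * Re (tinner dims Y Y)" for t Y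
  proof -
    let ?c = "\<lambda>a. exp ((1 + \<i> * of_real t) * of_real (ln (lam l a)))"
    have inner: "tinner dims (U l a) (tapp dims (tpow dims (C l) (1 + \<i> * of_real t)) Y) = ?c a * tinner dims (U l a) Y" if a: "a < ?d" for a
    proof -
      have "tinner dims (U l a) (tapp dims (tpow dims (C l) (1 + \<i> * of_real t)) Y) =
         (\<Sum>b<?d. if b = a then ?c a * tinner dims (U l a) Y else 0)"
        unfolding tpow_C[OF l] tapp_tdiag[OF ortho_U[OF l]] tinner_sum_right
        using a by (intro sum.cong refl) (auto simp: orthoD[OF ortho_U[OF l]])
      then show ?thesis using a by simp
    qed
    have e1: "Re (tinner dims (tapp dims (tpow dims (C l) (1 + \<i> * of_real t)) Y) (tapp dims (tpow dims (C l) (1 + \<i> * of_real t)) Y)) =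
       (\<Sum>a<?d. (lam l a)^2 * (norm (tinner dims (U l a) Y))^2)"
      unfolding tinner_parseval_norm[OF ortho_U[OF l]] Re_complex_of_real
      by (intro sum.cong refl) (simp add: inner norm_mult power_mult_distrib pos[OF l])
    have e2: "Re (tinner dims Y Y) = (\<Sum>a<?d. (norm (tinner dims (U l a) Y))^2)"
      unfolding tinner_parseval_norm[OF ortho_U[OF l], of Y] by simp
    show ?thesis unfolding e1 e2 sum_distrib_left
      using p pq pos[OF l] by (intro conjI sum_mono mult_right_mono power_mono) (auto simp: less_imp_le)
  qed
  have "p^2 * m * Re (tinner dims X X) \<le> Re (tinner dims (tapp dims (power_prod (l # L) (1 + \<i> * of_real t)) X) (tapp dims (power_prod (l # L) (1 + \<i> * of_real t)) X)) \<and>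
     Re (tinner dims (tapp dims (power_prod (l # L) (1 + \<i> * of_real t)) X) (tapp dims (power_prod (l # L) (1 + \<i> * of_real t)) X)) \<le> q^2 * M * Re (tinner dims X X)"
    if X: "is_otensor dims X" for t X
  proof -
    let ?Y = "tapp dims (power_prod L (1 + \<i> * of_real t)) X"
    have "p^2 * (m * Re (tinner dims X X)) \<le> p^2 * Re (tinner dims ?Y ?Y)"
      "q^2 * Re (tinner dims ?Y ?Y) \<le> q^2 * (M * Re (tinner dims X X))"
      using mM[OF X, of t] by (auto intro: mult_left_mono)
    then show ?thesis using T[of ?Y t] unfolding power_prod_simps tapp_einstein by (simp add: mult.assoc)
  qed
  moreover have "p^2 * m > 0" using p m by simp
  ultimately show ?case by blast
qed

lemma power_prod_det:
  assumes W: "ortho dims (tdim dims) W"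
  shows "set L \<subseteq> I \<Longrightarrow> norm (tdet dims W (power_prod L (1 + \<i> * of_real t))) = exp (\<Sum>l\<leftarrow>L. \<Sum>a<tdim dims. ln (lam l a))"
proof (induction L)
  case Nil
  then show ?case unfolding power_prod_simps tid_eq_tdiag[OF W] tdet_tdiag[OF W W] by simp
next
  case (Cons l L)
  then have l: "l \<in> I" by simp
  have "norm (tdet dims W (tpow dims (C l) (1 + \<i> * of_real t))) = (\<Prod>a<tdim dims. exp (ln (lam l a)))"
    unfolding tpow_C[OF l] tdet_tdiag[OF W ortho_U[OF l]] prod_norm[symmetric] by (intro prod.cong refl) simp
  then show ?case using Cons unfolding power_prod_simps tdet_einstein[OF W] norm_mult
    by (simp add: exp_add exp_sum)
qed

lemma logsum_trace: "set L \<subseteq> I \<Longrightarrow> (\<Sum>i\<in>tidx dims. logsum L i i) = of_real (\<Sum>l\<leftarrow>L. \<Sum>a<tdim dims. ln (lam l a))"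
proof (induction L)
  case (Cons l L)
  then have l: "l \<in> I" by simp
  have "(\<Sum>i\<in>tidx dims. tlog dims (C l) i i) = of_real (\<Sum>a<tdim dims. ln (lam l a))"
    unfolding tlog_C[OF l] trace_tdiag[OF ortho_U[OF l]] by simp
  then show ?case using Cons by (simp add: logsum_def sum.distrib)
qed (simp add: logsum_def)

lemma logsum_hermitian: "set L \<subseteq> I \<Longrightarrow> hermitian dims (logsum L)"
proof (induction L)
  case Nil
  show ?case by (auto simp: hermitian_def logsum_def is_tensor_def tct_def)
next
  case (Cons l L)
  then have "hermitian dims (logsum L)" "hermitian dims (tlog dims (C l))"
    using herm_dec_hermitian[OF tfun_dec[OF dec], of l ln] by (auto simp: tlog_def)
  moreover have "logsum (l # L) = (\<lambda>i j. tlog dims (C l) i j + logsum L i j)"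
    by (simp add: logsum_def fun_eq_iff)
  ultimately show ?case by (simp add: hermitian_def is_tensor_def tct_def fun_eq_iff)
qed

end

section \<open>Singular values on the line Re z = 1\<close>

lemma integrable_bounded_beta0:
  assumes cont: "continuous_on UNIV h" and bd: "\<And>t. \<bar>h t\<bar> \<le> (B::real)"
  shows "integrable lborel (\<lambda>t. h t * beta0 t)"
proof (rule Bochner_Integration.integrable_bound)
  show "integrable lborel (\<lambda>t. B * beta0 t)" by (intro integrable_mult_right beta0_integral)
  show "(\<lambda>t. h t * beta0 t) \<in> borel_measurable lborel"
    using borel_measurable_continuous_onI[OF cont]
    by (intro borel_measurable_times borel_measurable_integrable[OF beta0_integral(1)]) simp
  have "B \<ge> 0" using bd[of 0] by linarith
  then show "AE t in lborel. norm (h t * beta0 t) \<le> norm (B * beta0 t)"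
    using bd beta0_pos by (intro AE_I2) (auto simp: abs_mult intro!: mult_right_mono)
qed

context positive_family
begin

definition gram :: "nat list \<Rightarrow> real \<Rightarrow> tensor" where
  "gram L t = einstein dims (tct (power_prod L (1 + \<i> * of_real t))) (power_prod L (1 + \<i> * of_real t))"

definition log_sv :: "nat list \<Rightarrow> real \<Rightarrow> nat \<Rightarrow> real" where
  "log_sv L t j = ln (sqrt (heigvals dims (gram L t) ! j))"

lemma gram_hermitian: "hermitian dims (gram L t)"
  unfolding gram_def by (rule hermitian_gram[OF is_tensor_P])

text \<open>An eigenvalue of the Gram tensor is the squared length of the image of a unit
  eigenvector under the product.\<close>

lemma gram_bounds:
  assumes L: "set L \<subseteq> I"
  shows "\<exists>m M. m > 0 \<and> (\<forall>t. \<forall>j<tdim dims. m \<le> heigvals dims (gram L t) ! j \<and> heigvals dims (gram L t) ! j \<le> M)"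
proof -
  obtain m M where m: "m > 0" and mM: "\<And>t X. is_otensor dims X \<Longrightarrow>
     m * Re (tinner dims X X) \<le> Re (tinner dims (tapp dims (power_prod L (1 + \<i> * of_real t)) X) (tapp dims (power_prod L (1 + \<i> * of_real t)) X)) \<and>
     Re (tinner dims (tapp dims (power_prod L (1 + \<i> * of_real t)) X) (tapp dims (power_prod L (1 + \<i> * of_real t)) X)) \<le> M * Re (tinner dims X X)"
    using power_prod_norm_bounds[OF L] by blast
  have "m \<le> heigvals dims (gram L t) ! j \<and> heigvals dims (gram L t) ! j \<le> M" if j: "j < tdim dims" for t j
  proof -
    obtain V where V: "herm_dec dims (tdim dims) (gram L t) (\<lambda>j. heigvals dims (gram L t) ! j) V"
      using heigvals_dec[OF gram_hermitian] .
    have oV: "ortho dims (tdim dims) V" using V by (simp add: herm_dec_iff)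
    have VV: "tinner dims (V j) (V j) = 1" using orthoD(2)[OF oV j j] by simp
    have "tinner dims (tapp dims (power_prod L (1 + \<i> * of_real t)) (V j)) (tapp dims (power_prod L (1 + \<i> * of_real t)) (V j)) =
        tinner dims (V j) (tapp dims (gram L t) (V j))"
      unfolding gram_def tapp_einstein tinner_tapp[of dims "V j"] by simp
    also have "\<dots> = of_real (heigvals dims (gram L t) ! j)"
      unfolding herm_dec_eigen[OF V j] tinner_scale_right VV by simp
    finally show ?thesis using mM[OF orthoD(1)[OF oV j], of t] VV by simp
  qed
  then show ?thesis using m by blast
qed

lemma gram_pos: "set L \<subseteq> I \<Longrightarrow> j < tdim dims \<Longrightarrow> heigvals dims (gram L t) ! j > 0"
  using gram_bounds[of L] by (meson less_le_trans)

lemma power_prod_continuous: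
  assumes "set L \<subseteq> I"
  shows "continuous_on UNIV (\<lambda>t::real. power_prod L (1 + \<i> * of_real t) i j)"
  by (rule continuous_on_compose2[OF holomorphic_on_imp_continuous_on[OF power_prod_holomorphic[OF assms]]])
     (auto intro!: continuous_intros)

lemma log_sv_continuous:
  assumes L: "set L \<subseteq> I" and j: "j < tdim dims"
  shows "continuous_on UNIV (\<lambda>t. log_sv L t j)"
proof -
  have "continuous_on UNIV (\<lambda>t. heigvals dims (gram L t) ! j)"
  proof (rule heigvals_continuous[OF gram_hermitian _ j])
    fix a b assume ab: "a \<in> tidx dims" "b \<in> tidx dims"
    have "continuous_on UNIV (\<lambda>t. \<Sum>m\<in>tidx dims. cnj (power_prod L (1 + \<i> * of_real t) m a) * power_prod L (1 + \<i> * of_real t) m b)"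
      by (intro continuous_intros power_prod_continuous[OF L])
    then show "continuous_on UNIV (\<lambda>t. gram L t a b)"
      using ab by (simp add: gram_def einstein_def tct_def)
  qed
  moreover have "sqrt (heigvals dims (gram L t) ! j) \<noteq> 0" for t using gram_pos[OF L j, of t] by simp
  ultimately show ?thesis unfolding log_sv_def by (intro continuous_intros) auto
qed

lemma log_sv_bounds:
  assumes L: "set L \<subseteq> I"
  shows "\<exists>p q. \<forall>t. \<forall>j<tdim dims. p \<le> log_sv L t j \<and> log_sv L t j \<le> q"
proof -
  obtain m M where m: "m > 0" and mM: "\<And>t j. j < tdim dims \<Longrightarrow> m \<le> heigvals dims (gram L t) ! j \<and> heigvals dims (gram L t) ! j \<le> M"
    using gram_bounds[OF L] by blast
  have "ln (sqrt m) \<le> log_sv L t j" "log_sv L t j \<le> ln (sqrt M)" if "j < tdim dims" for t j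
    using mM[OF that, of t] m unfolding log_sv_def by (auto intro!: ln_mono)
  then show ?thesis by blast
qed

text \<open>The determinant of the Gram tensor is the squared modulus of that of the product, and a
  factor with coefficients exp ((1 + it) ln x) has a determinant whose modulus is independent of t.
  So the total is the same for every t; it is also the trace of \<open>logsum L\<close>.\<close>

lemma log_sv_total:
  assumes L: "set L \<subseteq> I"
  shows "(\<Sum>j<tdim dims. log_sv L t j) = (\<Sum>l\<leftarrow>L. \<Sum>a<tdim dims. ln (lam l a))"
proof -
  let ?d = "tdim dims" and ?A = "power_prod L (1 + \<i> * of_real t)" and ?c = "\<Sum>l\<leftarrow>L. \<Sum>a<tdim dims. ln (lam l a)"
  let ?e = "\<lambda>j. heigvals dims (gram L t) ! j"
  obtain V where V: "herm_dec dims ?d (gram L t) ?e V" using heigvals_dec[OF gram_hermitian] .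
  have oV: "ortho dims ?d V" and G: "gram L t = tdiag ?d (\<lambda>j. of_real (?e j)) V" using V by (auto simp: herm_dec_iff)
  have "of_real (\<Prod>j<?d. ?e j) = tdet dims V (tdiag ?d (\<lambda>j. of_real (?e j)) V)"
    unfolding tdet_tdiag[OF oV oV] by simp
  also have "\<dots> = tdet dims V (gram L t)" by (rule arg_cong[OF G[symmetric]])
  also have "\<dots> = cnj (tdet dims V ?A) * tdet dims V ?A"
    unfolding gram_def tdet_einstein[OF oV] tdet_tct[OF oV] ..
  also have "\<dots> = of_real ((norm (tdet dims V ?A))^2)" by (metis complex_norm_square mult.commute)
  finally have "(\<Prod>j<?d. ?e j) = (exp ?c)^2" unfolding power_prod_det[OF oV L] by (simp only: of_real_eq_iff)
  then have "ln (\<Prod>j<?d. ?e j) = 2 * ?c" by (simp add: ln_realpow)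
  moreover have "ln (\<Prod>j<?d. ?e j) = (\<Sum>j<?d. ln (?e j))"
  proof (rule ln_prod)
    show "?e j \<noteq> 0" if "j \<in> {..<?d}" for j using gram_pos[OF L, of j t] that by auto
  qed simp
  moreover have "(\<Sum>j<?d. log_sv L t j) = (\<Sum>j<?d. ln (?e j) / 2)"
  proof (intro sum.cong refl)
    fix j assume "j \<in> {..<?d}"
    then have "?e j > 0" using gram_pos[OF L, of j t] by simp
    then show "log_sv L t j = ln (?e j) / 2" unfolding log_sv_def by (intro ln_sqrt less_imp_le)
  qed
  ultimately show ?thesis by (simp flip: sum_divide_distrib)
qed

lemma log_sv_majorizes:
  assumes L: "set L \<subseteq> I" and mu: "herm_dec dims (tdim dims) (logsum L) mu V"
    and k: "k \<le> tdim dims" and \<kappa>: "inj_on \<kappa> {..<k}" "\<kappa> ` {..<k} \<subseteq> {..<tdim dims}"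
  shows "(\<Sum>i<k. mu (\<kappa> i)) \<le> (LINT t|lborel. (\<Sum>j<k. log_sv L t j) * beta0 t)"
proof -
  let ?d = "tdim dims"
  have V: "ortho dims ?d V" using mu by (simp add: herm_dec_iff)
  define x where "x a = V (\<kappa> a)" for a
  have x: "ortho dims k x" unfolding x_def by (rule ortho_permute[OF V \<kappa>])
  define E where "E z a b = tinner dims (x a) (tapp dims (power_prod L z) (x b))" for z a b
  define F where "F z = kdet k (E z)" for z
  have E_sum: "E z a b = (\<Sum>i\<in>tidx dims. cnj (x a i) * (\<Sum>j\<in>tidx dims. power_prod L z i j * x b j))" for z a b
    by (simp add: E_def tinner_def tapp_def)
  have E_hol: "(\<lambda>z. E z a b) holomorphic_on UNIV" for a b
    unfolding E_sum by (intro holomorphic_intros power_prod_holomorphic[OF L])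
  obtain K where K: "\<And>z i j. 0 \<le> Re z \<Longrightarrow> Re z \<le> 1 \<Longrightarrow> norm (power_prod L z i j) \<le> K"
    using power_prod_bound[OF L] by blast
  obtain p q where pq: "\<And>t j. j < ?d \<Longrightarrow> p \<le> log_sv L t j" "\<And>t j. j < ?d \<Longrightarrow> log_sv L t j \<le> q"
    using log_sv_bounds[OF L] by blast
  have "Re (of_real (\<Sum>i<k. mu (\<kappa> i))) \<le> (LINT t|lborel. (\<Sum>j<k. log_sv L t j) * beta0 t)"
  proof (rule strip_derivative_bound[of F])
    show "F holomorphic_on UNIV" unfolding F_def[abs_def] by (rule kdet_holomorphic[OF E_hol])
    \<comment> \<open>Entries of orthonormal vectors have modulus at most 1, so each entry of the
      minor is a sum of terms of size at most K.\<close>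
    show "norm (F z) \<le> fact k * (\<Sum>i\<in>tidx dims. 1 * (\<Sum>j\<in>tidx dims. K * 1)) ^ k" if z: "0 \<le> Re z" "Re z \<le> 1" for z
      unfolding F_def
    proof (rule kdet_bound)
      fix a b assume ab: "a < k" "b < k"
      have K0: "K \<ge> 0" using K[OF z] norm_ge_zero order_trans by blast
      show "norm (E z a b) \<le> (\<Sum>i\<in>tidx dims. 1 * (\<Sum>j\<in>tidx dims. K * 1))"
        unfolding E_sum
        by (intro order_trans[OF norm_sum] sum_mono norm_mult[THEN ord_eq_le_trans] mult_mono
              norm_ge_zero zero_le_one K0 K[OF z])
           (use ortho_norm_le_1[OF x] ab K0 in \<open>auto\<close>)
    qed
    have one: "herm_dec dims ?d (tid dims) (\<lambda>_. 1) V"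
      using V by (simp add: herm_dec_iff tid_eq_tdiag[OF V])
    \<comment> \<open>On the imaginary axis the Gram tensor is the identity, so the minor bound
      applies with all singular values 1.\<close>
    show "norm (F (\<i> * of_real t)) \<le> 1" for t
    proof -
      have "herm_dec dims ?d (einstein dims (tct (power_prod L (\<i> * of_real t))) (power_prod L (\<i> * of_real t))) (\<lambda>_. 1) V"
        using power_prod_unitary[OF L, of "\<i> * of_real t"] one by simp
      from minor_le_singular_values[OF this _ _ x x k] show ?thesis by (simp add: F_def E_def[abs_def])
    qed
    show "norm (F (1 + \<i> * of_real t)) \<le> exp (\<Sum>j<k. log_sv L t j)" for t
    proof -
      obtain W where W: "herm_dec dims ?d (gram L t) (\<lambda>j. heigvals dims (gram L t) ! j) W"
        using heigvals_dec[OF gram_hermitian] .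
      have "norm (F (1 + \<i> * of_real t)) \<le> (\<Prod>j<k. sqrt (heigvals dims (gram L t) ! j))"
        unfolding F_def E_def[abs_def]
        by (rule minor_le_singular_values[OF W[unfolded gram_def[of L t]], folded gram_def, OF gram_pos[OF L] heigvals_decreasing x x k])
      also have "\<dots> = exp (\<Sum>j<k. log_sv L t j)"
        unfolding log_sv_def exp_sum[OF finite_lessThan] using gram_pos[OF L] k by (intro prod.cong refl) simp
      finally show ?thesis .
    qed
    show "continuous_on UNIV (\<lambda>t. \<Sum>j<k. log_sv L t j)"
      using k by (intro continuous_intros log_sv_continuous[OF L]) auto
    show "\<bar>\<Sum>j<k. log_sv L t j\<bar> \<le> (\<Sum>j<k. \<bar>p\<bar> + \<bar>q\<bar>)" for t
    proof (intro order_trans[OF sum_abs] sum_mono)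
      fix j assume "j \<in> {..<k}"
      then show "\<bar>log_sv L t j\<bar> \<le> \<bar>p\<bar> + \<bar>q\<bar>" using pq[of j t] k by auto
    qed
    have E0: "E 0 a b = (if a = b then 1 else 0)" if "a < k" "b < k" for a b
      using that by (simp add: E_def power_prod_0[OF L] tapp_tid orthoD[OF x])
    then show "F 0 = 1" unfolding F_def using kdet_cong[of k "E 0" "\<lambda>a b. if a = b then 1 else 0"] by (simp add: kdet_id)
    have "(F has_field_derivative (\<Sum>i<k. tinner dims (x i) (tapp dims (logsum L) (x i)))) (at 0)"
      unfolding F_def[abs_def]
    proof (rule kdet_derivative_at_id[where M = E and D = "\<lambda>a b. tinner dims (x a) (tapp dims (logsum L) (x b))"])
      fix a b
      have "((\<lambda>z. \<Sum>i\<in>tidx dims. cnj (x a i) * (\<Sum>j\<in>tidx dims. power_prod L z i j * x b j)) has_field_derivative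
         (\<Sum>i\<in>tidx dims. cnj (x a i) * (\<Sum>j\<in>tidx dims. logsum L i j * x b j))) (at 0)"
        by (intro DERIV_sum DERIV_cmult DERIV_cmult_right power_prod_deriv[OF L])
      then show "((\<lambda>z. E z a b) has_field_derivative tinner dims (x a) (tapp dims (logsum L) (x b))) (at 0)"
        unfolding E_sum by (simp add: tinner_def tapp_def)
    qed (rule E0)
    moreover have "tinner dims (x i) (tapp dims (logsum L) (x i)) = of_real (mu (\<kappa> i))" if "i < k" for i
    proof -
      have \<kappa>i: "\<kappa> i < ?d" using \<kappa>(2) that by auto
      show ?thesis unfolding x_def herm_dec_eigen[OF mu \<kappa>i] tinner_scale_right using orthoD(2)[OF V \<kappa>i \<kappa>i] by simp
    qed
    ultimately show "(F has_field_derivative of_real (\<Sum>i<k. mu (\<kappa> i))) (at 0)" by simp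
  qed
  then show ?thesis by simp
qed

lemma log_majorization_jensen:
  assumes L: "set L \<subseteq> I" and mu: "herm_dec dims (tdim dims) (logsum L) mu V"
    and conv: "fun_convex \<Psi>"
    and local: "\<And>x y. (\<And>i. i < tdim dims \<Longrightarrow> x i = y i) \<Longrightarrow> \<Psi> x = \<Psi> y"
    and sym: "\<And>x p. p permutes {..<tdim dims} \<Longrightarrow> \<Psi> (\<lambda>i. x (p i)) = \<Psi> x"
    and int: "integrable lborel (\<lambda>t. \<Psi> (log_sv L t) * beta0 t)"
  shows "\<Psi> mu \<le> (LINT t|lborel. \<Psi> (log_sv L t) * beta0 t)"
proof (rule majorization_jensen[OF conv local sym beta0_integral(1) less_imp_le[OF beta0_pos] beta0_integral(2) _ int])
  let ?d = "tdim dims"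
  obtain p q where pq: "\<And>t j. j < ?d \<Longrightarrow> p \<le> log_sv L t j" "\<And>t j. j < ?d \<Longrightarrow> log_sv L t j \<le> q"
    using log_sv_bounds[OF L] by blast
  show "integrable lborel (\<lambda>t. log_sv L t j * beta0 t)" if j: "j < ?d" for j
    by (rule integrable_bounded_beta0[OF log_sv_continuous[OF L j], of "\<bar>p\<bar> + \<bar>q\<bar>"]) (use pq[OF j] in smt)
  show "(\<Sum>i<k. mu (\<kappa> i)) \<le> (LINT t|lborel. (\<Sum>j<k. log_sv L t j) * beta0 t)"
    if "k \<le> ?d" "inj_on \<kappa> {..<k}" "\<kappa> ` {..<k} \<subseteq> {..<?d}" for \<kappa> k
    by (rule log_sv_majorizes[OF L mu that])
  \<comment> \<open>Both totals equal the sum of all ln (lam l a): that of mu is the trace of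
    \<open>logsum L\<close>, and the other is constant in t and is averaged by a density of mass
    1.\<close>
  have "complex_of_real (\<Sum>i<?d. mu i) = (\<Sum>i\<in>tidx dims. tdiag ?d (\<lambda>a. of_real (mu a)) V i i)"
    using mu by (subst trace_tdiag) (auto simp: herm_dec_iff)
  also have "tdiag ?d (\<lambda>a. of_real (mu a)) V = logsum L"
    using mu by (simp add: herm_dec_iff)
  also have "(\<Sum>i\<in>tidx dims. logsum L i i) = of_real (\<Sum>l\<leftarrow>L. \<Sum>a<?d. ln (lam l a))"
    by (rule logsum_trace[OF L])
  finally have "(\<Sum>i<?d. mu i) = (\<Sum>l\<leftarrow>L. \<Sum>a<?d. ln (lam l a))" by (simp only: of_real_eq_iff)
  then show "(\<Sum>i<?d. mu i) = (LINT t|lborel. (\<Sum>j<?d. log_sv L t j) * beta0 t)"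
    unfolding log_sv_total[OF L] by (simp add: beta0_integral(2))
qed

end

section \<open>The two norm inequalities\<close>

theorem theorem1p1:
  fixes dims :: "nat list" and n r :: nat and C :: "nat \<Rightarrow> tensor"
    and \<rho> :: "real list \<Rightarrow> real"
  assumes "dims \<noteq> []" and "\<forall>k<length dims. dims ! k > 0"
    and "n \<ge> 1"
    and "\<forall>i\<in>{1..n}. hermitian dims (C i) \<and> pos_def dims (C i) \<and> hrank dims (C i) = r"
    and "sym_gauge r \<rho>"
  shows
   "(\<forall>f :: real \<Rightarrow> real. continuous_on {0<..} f \<and> (\<forall>x>0. f x > 0)
        \<and> convex_on UNIV (\<lambda>x. ln (f (exp x))) \<longrightarrow>
      unorm dims \<rho> (tfun dims f (texp dims (tsum n (\<lambda>i. tlog dims (C i)))))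
      \<le> exp (LINT t|lborel. ln (unorm dims \<rho>
              (tfun dims f (tabs dims (tprod dims n (\<lambda>i. tpow dims (C i) (1 + \<i> * complex_of_real t))))))
            * beta0 t))
    \<and>
    (\<forall>g :: real \<Rightarrow> real. continuous_on {0<..} g \<and> (\<forall>x>0. g x \<ge> 0)
        \<and> convex_on UNIV (\<lambda>x. g (exp x)) \<longrightarrow>
      unorm dims \<rho> (tfun dims g (texp dims (tsum n (\<lambda>i. tlog dims (C i)))))
      \<le> (LINT t|lborel. unorm dims \<rho>
              (tfun dims g (tabs dims (tprod dims n (\<lambda>i. tpow dims (C i) (1 + \<i> * complex_of_real t)))))
            * beta0 t))"
proof -
  define d where "d = tdim dims"
  define L where "L = [1..<Suc n]"
  define I where "I = {1..n}"
  have pd: "pos_def dims (C i)" if "i \<in> I" for i using assms(4) that by (simp add: I_def)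
  \<comment> \<open>The Hermitian rank of one factor, available since n >= 1, identifies r with the
    full dimension.\<close>
  have "hrank dims (C 1) = r" "pos_def dims (C 1)" using assms(3,4) by auto
  then have r: "r = d" using pos_def_hrank by (simp add: d_def)
  have d: "d > 0" unfolding d_def by (rule tdim_pos[OF assms(2)])
  have sg: "sym_gauge d \<rho>" using assms(5) r by simp
  interpret symmetric_gauge d \<rho> by unfold_locales (rule sg)
  have "\<forall>i\<in>I. \<exists>p. herm_dec dims d (C i) (fst p) (snd p) \<and> (\<forall>k<d. fst p k > 0)"
    using pd unfolding pos_def_def d_def by (metis fst_conv snd_conv)
  then obtain dc where dc: "\<And>i. i \<in> I \<Longrightarrow> herm_dec dims d (C i) (fst (dc i)) (snd (dc i))"
    "\<And>i k. i \<in> I \<Longrightarrow> k < d \<Longrightarrow> fst (dc i) k > 0" by metis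
  interpret positive_family dims C I "\<lambda>i. fst (dc i)" "\<lambda>i. snd (dc i)"
    by unfold_locales (use dc in \<open>auto simp: d_def\<close>)
  have L: "set L \<subseteq> I" by (auto simp: L_def I_def)
  have tsum_eq: "tsum n (\<lambda>i. tlog dims (C i)) = logsum L"
    unfolding tsum_def logsum_def L_def
    by (simp add: interv_sum_list_conv_sum_set_nat atLeastLessThanSuc_atLeastAtMost del: upt_Suc)
  have tprod_eq: "tprod dims n (\<lambda>i. tpow dims (C i) z) = power_prod L z" for z
    by (simp add: tprod_def power_prod_def L_def)
  obtain mu V where mu: "herm_dec dims d (logsum L) mu V"
    using hermitian_spectral[OF logsum_hermitian[OF L]] by (auto simp: d_def)
  have lhs: "unorm dims \<rho> (tfun dims f (texp dims (logsum L))) = gauge_of (\<lambda>i. f (exp (mu i)))"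
    if f: "\<forall>x>0. f x \<ge> 0" for f
  proof -
    have "herm_dec dims (tdim dims) (tfun dims f (texp dims (logsum L))) (\<lambda>i. f (exp (mu i))) V"
      unfolding texp_def by (intro tfun_dec mu[unfolded d_def])
    from unorm_eq[OF sg[unfolded d_def] this] f show ?thesis by (simp add: d_def)
  qed
  have rhs: "unorm dims \<rho> (tfun dims f (tabs dims (power_prod L (1 + \<i> * of_real t)))) = gauge_of (\<lambda>i. f (exp (log_sv L t i)))"
    if f: "\<forall>x>0. f x \<ge> 0" for f t
  proof -
    obtain W where W: "herm_dec dims (tdim dims) (gram L t) (\<lambda>j. heigvals dims (gram L t) ! j) W"
      using heigvals_dec[OF gram_hermitian] .
    have "herm_dec dims (tdim dims) (tfun dims f (tabs dims (power_prod L (1 + \<i> * of_real t)))) (\<lambda>j. f (sqrt (heigvals dims (gram L t) ! j))) W"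
      using W by (intro tfun_dec tabs_dec) (simp only: gram_def[symmetric])
    from unorm_eq[OF sg[unfolded d_def] this] f gram_pos[OF L, of _ t]
    have "unorm dims \<rho> (tfun dims f (tabs dims (power_prod L (1 + \<i> * of_real t)))) = gauge_of (\<lambda>j. f (sqrt (heigvals dims (gram L t) ! j)))"
      by (simp add: d_def)
    also have "\<dots> = gauge_of (\<lambda>i. f (exp (log_sv L t i)))"
      using gram_pos[OF L, of _ t] by (intro gauge_of_cong) (simp add: log_sv_def d_def)
    finally show ?thesis .
  qed
  \<comment> \<open>All logarithms of singular values lie in one compact interval, on which the
    composition of a continuous function with exp is bounded.\<close>
  obtain p q where pq: "\<And>t j. j < d \<Longrightarrow> p \<le> log_sv L t j \<and> log_sv L t j \<le> q"
    using log_sv_bounds[OF L] unfolding d_def by blast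
  have fcont: "continuous_on UNIV (\<lambda>t. gauge_of (\<lambda>i. f (exp (log_sv L t i))))" if f: "continuous_on {0<..} f" for f
    unfolding continuous_on_def
  proof
    fix s :: real
    have "((\<lambda>t. f (exp (log_sv L t i))) \<longlongrightarrow> f (exp (log_sv L s i))) (at s within UNIV)" if "i < d" for i
    proof -
      have "continuous_on UNIV (\<lambda>t. f (exp (log_sv L t i)))"
        by (rule continuous_on_compose2[OF f]) (use log_sv_continuous[OF L, of i] that in \<open>auto simp: d_def intro!: continuous_intros\<close>)
      then show ?thesis by (auto simp: continuous_on_def)
    qed
    then show "((\<lambda>t. gauge_of (\<lambda>i. f (exp (log_sv L t i)))) \<longlongrightarrow> gauge_of (\<lambda>i. f (exp (log_sv L s i)))) (at s within UNIV)"
      by (rule gauge_of_tendsto)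
  qed
  have fbound: "\<exists>B. \<forall>t. \<forall>i<d. \<bar>f (exp (log_sv L t i))\<bar> \<le> B" if f: "continuous_on {0<..} f" for f :: "real \<Rightarrow> real"
  proof -
    have "continuous_on {p..q} (\<lambda>x. f (exp x))"
      by (rule continuous_on_compose2[OF f]) (auto intro!: continuous_intros)
    then have "bounded ((\<lambda>x. f (exp x)) ` {p..q})"
      by (intro compact_imp_bounded compact_continuous_image) auto
    then obtain B where "\<forall>x\<in>{p..q}. \<bar>f (exp x)\<bar> \<le> B" by (auto simp: bounded_iff)
    then show ?thesis using pq by (intro exI[of _ B]) auto
  qed
  have part2: "unorm dims \<rho> (tfun dims g (texp dims (tsum n (\<lambda>i. tlog dims (C i)))))
      \<le> (LINT t|lborel. unorm dims \<rho>
          (tfun dims g (tabs dims (tprod dims n (\<lambda>i. tpow dims (C i) (1 + \<i> * complex_of_real t))))) * beta0 t)"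
    if g: "continuous_on {0<..} g" "\<forall>x>0. g x \<ge> 0" "convex_on UNIV (\<lambda>x. g (exp x))" for g
    unfolding tsum_eq tprod_eq lhs[OF g(2)] rhs[OF g(2)]
  proof (rule log_majorization_jensen[OF L mu[unfolded d_def], where \<Psi> = "\<lambda>x. gauge_of (\<lambda>i. g (exp (x i)))"])
    show "fun_convex (\<lambda>x. gauge_of (\<lambda>i. g (exp (x i))))" by (rule gauge_convex[OF g(3)]) (use g(2) in simp)
    show "gauge_of (\<lambda>i. g (exp (x i))) = gauge_of (\<lambda>i. g (exp (y i)))" if "\<And>i. i < tdim dims \<Longrightarrow> x i = y i" for x y
      by (rule gauge_of_cong) (simp add: that d_def)
    show "gauge_of (\<lambda>i. g (exp (x (p i)))) = gauge_of (\<lambda>i. g (exp (x i)))" if "p permutes {..<tdim dims}" for x p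
      using gauge_of_permute[of p "\<lambda>i. g (exp (x i))"] that by (simp add: d_def)
    obtain B where B: "\<forall>t. \<forall>i<d. \<bar>g (exp (log_sv L t i))\<bar> \<le> B" using fbound[OF g(1)] by blast
    have "\<bar>gauge_of (\<lambda>i. g (exp (log_sv L t i)))\<bar> \<le> gauge_of (\<lambda>_. B)" for t
    proof -
      have "gauge_of (\<lambda>i. g (exp (log_sv L t i))) \<le> gauge_of (\<lambda>_. B)"
        using B g(2) by (intro gauge_of_mono) (auto intro: order_trans[OF abs_ge_self])
      then show ?thesis using gauge_of_nonneg by simp
    qed
    then show "integrable lborel (\<lambda>t. gauge_of (\<lambda>i. g (exp (log_sv L t i))) * beta0 t)"
      by (rule integrable_bounded_beta0[OF fcont[OF g(1)]])
  qed
  have part1: "unorm dims \<rho> (tfun dims f (texp dims (tsum n (\<lambda>i. tlog dims (C i)))))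
      \<le> exp (LINT t|lborel. ln (unorm dims \<rho>
          (tfun dims f (tabs dims (tprod dims n (\<lambda>i. tpow dims (C i) (1 + \<i> * complex_of_real t)))))) * beta0 t)"
    if f: "continuous_on {0<..} f" "\<forall>x>0. f x > 0" "convex_on UNIV (\<lambda>x. ln (f (exp x)))" for f
  proof -
    have f0: "\<forall>x>0. f x \<ge> 0" using f(2) by (auto simp: less_imp_le)
    \<comment> \<open>A nonempty index set and f > 0 make the gauge positive, so that its logarithm
      can be undone by exp at the end.\<close>
    have Rpos: "gauge_of (\<lambda>i. f (exp (x i))) > 0" for x by (rule gauge_of_pos[OF d]) (use f(2) in \<open>simp add: less_imp_neq[symmetric]\<close>)
    have Rexp: "gauge_of (\<lambda>i. exp (ln (f (exp (x i))))) = gauge_of (\<lambda>i. f (exp (x i)))" for x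
      using f(2) by simp
    have "ln (gauge_of (\<lambda>i. f (exp (mu i)))) \<le> (LINT t|lborel. ln (gauge_of (\<lambda>i. f (exp (log_sv L t i)))) * beta0 t)"
    proof (rule log_majorization_jensen[OF L mu[unfolded d_def], where \<Psi> = "\<lambda>x. ln (gauge_of (\<lambda>i. f (exp (x i))))"])
      show "fun_convex (\<lambda>x. ln (gauge_of (\<lambda>i. f (exp (x i)))))"
        using gauge_log_convex[OF f(3) d] unfolding Rexp .
      show "ln (gauge_of (\<lambda>i. f (exp (x i)))) = ln (gauge_of (\<lambda>i. f (exp (y i))))" if "\<And>i. i < tdim dims \<Longrightarrow> x i = y i" for x y
        by (intro arg_cong[where f = ln] gauge_of_cong) (simp add: that d_def)
      show "ln (gauge_of (\<lambda>i. f (exp (x (p i))))) = ln (gauge_of (\<lambda>i. f (exp (x i))))" if "p permutes {..<tdim dims}" for x p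
        using gauge_of_permute[of p "\<lambda>i. f (exp (x i))"] that by (simp add: d_def)
      have lf: "continuous_on {0<..} (\<lambda>x. ln (f x))"
        using f(1,2) by (intro continuous_intros) (auto simp: less_imp_neq[symmetric])
      obtain B where B: "\<forall>t. \<forall>i<d. \<bar>ln (f (exp (log_sv L t i)))\<bar> \<le> B" using fbound[OF lf] by blast
      \<comment> \<open>The logarithm needs a lower bound too: the vector is squeezed between the
        constant vectors exp (- B) and exp B, whose gauges are positive because d > 0.\<close>
      have "\<bar>ln (gauge_of (\<lambda>i. f (exp (log_sv L t i))))\<bar> \<le> \<bar>ln (gauge_of (\<lambda>_. exp (- B)))\<bar> + \<bar>ln (gauge_of (\<lambda>_. exp B))\<bar>" for t
      proof -
        have "gauge_of (\<lambda>_. exp (- B)) \<le> gauge_of (\<lambda>i. exp (ln (f (exp (log_sv L t i)))))"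
          using B by (intro gauge_of_mono) (auto simp: abs_le_iff minus_le_iff)
        moreover have "gauge_of (\<lambda>i. exp (ln (f (exp (log_sv L t i))))) \<le> gauge_of (\<lambda>_. exp B)"
          using B by (intro gauge_of_mono) (auto simp: abs_le_iff)
        moreover have "gauge_of (\<lambda>_. exp (- B)) > 0" by (rule gauge_of_pos[OF d]) simp
        ultimately have "ln (gauge_of (\<lambda>_. exp (- B))) \<le> ln (gauge_of (\<lambda>i. f (exp (log_sv L t i))))"
          "ln (gauge_of (\<lambda>i. f (exp (log_sv L t i)))) \<le> ln (gauge_of (\<lambda>_. exp B))"
          unfolding Rexp using Rpos by (auto intro!: ln_mono)
        then show ?thesis by linarith
      qed
      moreover have "continuous_on UNIV (\<lambda>t. ln (gauge_of (\<lambda>i. f (exp (log_sv L t i)))))"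
        using Rpos by (intro continuous_on_ln fcont[OF f(1)]) (auto simp: less_imp_neq[symmetric])
      ultimately show "integrable lborel (\<lambda>t. ln (gauge_of (\<lambda>i. f (exp (log_sv L t i)))) * beta0 t)"
        by (intro integrable_bounded_beta0)
    qed
    then have "exp (ln (gauge_of (\<lambda>i. f (exp (mu i))))) \<le> exp (LINT t|lborel. ln (gauge_of (\<lambda>i. f (exp (log_sv L t i)))) * beta0 t)"
      by simp
    then show ?thesis unfolding tsum_eq tprod_eq lhs[OF f0] rhs[OF f0] using Rpos by simp
  qed
  show ?thesis using part1 part2 by blast
qed

end
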